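(* Let $X$ be a stratifiable topological space. The function space $C_k(X)$ is Baire if and only if $X$ has the Moving Off Property and for some $n\in\omega$ the function space $C_k(X^{[n]})$ is Baire.
   Context: $C_k(X)$ is the space of continuous real-valued functions on $X$ endowed with the compact-open topology. A topological space is Baire if the intersection of any sequence of open dense subsets is dense. A point $x$ of a space $A$ is isolated in $A$ if $\{x\}$ is clopen in $A$; $A'$ denotes the set of non-isolated points of the space $A$. The derived sets are $X^{[0]}=X$ and $X^{[n+1]}=(X^{[n]})'$ (with subspace topologies). Stratifiable: a regular space $X$ (regular spaces are understood to be $T_1$) is stratifiable if to each $x\in X$ one can assign a decreasing sequence $(U_n(x))_{n\in\omega}$ of neighborhoods of $x$ such that each closed set $F\subset X$ equals $\bigcap_{n\in\omega}\overline{U_n[F]}$, where $U_n[F]=\bigcup_{x\in F}U_n(x)$. Moving Off Property: a family $\mathcal F$ of subsets of $X$ is a moving off family if for any compact $K\subset X$ there is a non-empty $F\in\mathcal F$ with $K\cap F=\emptyset$. A family $\mathcal F$ is strongly discrete if each $F\in\mathcal F$ has an open neighborhood $O_F\subset X$ such that the indexed family $\{O_F\}_{F\in\mathcal F}$ is discrete, i.e. each $x\in X$ has a neighborhood meeting $O_F$ for at most one index $F\in\mathcal F$. $X$ has the Moving Off Property if each moving off family of compact subsets of $X$ contains an infinite strongly discrete subfamily. *)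

theory Defs
  imports "HOL-Analysis.Analysis"
begin

definition nbhd_in :: "'a topology \<Rightarrow> 'a \<Rightarrow> 'a set \<Rightarrow> bool"
  where "nbhd_in X x N \<longleftrightarrow> N \<subseteq> topspace X \<and> (\<exists>V. openin X V \<and> x \<in> V \<and> V \<subseteq> N)"

definition Baire_space :: "'a topology \<Rightarrow> bool"
  where "Baire_space X \<longleftrightarrow>
    (\<forall>G :: nat \<Rightarrow> 'a set. (\<forall>n. openin X (G n) \<and> X closure_of (G n) = topspace X) \<longrightarrow>
       X closure_of (\<Inter>n. G n) = topspace X)"

text \<open>Maps out of the space \<open>X\<close> are HOL functions that take the value \<open>undefined\<close> off
  \<open>topspace X\<close>, so that distinct elements of \<open>C_carrier X\<close> are distinct maps on \<open>X\<close>.\<close>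

definition C_carrier :: "'a topology \<Rightarrow> ('a \<Rightarrow> real) set"
  where "C_carrier X = {f \<in> extensional (topspace X). continuous_map X euclideanreal f}"

definition Ck :: "'a topology \<Rightarrow> ('a \<Rightarrow> real) topology"
  where "Ck X = topology_generated_by
    {{f \<in> C_carrier X. f ` K \<subseteq> U} | K U. compactin X K \<and> openin euclideanreal U}"

lemma topspace_Ck: "topspace (Ck X) = C_carrier X"
proof -
  have "C_carrier X = {f \<in> C_carrier X. f ` {} \<subseteq> UNIV} \<and> compactin X {} \<and> openin euclideanreal UNIV"
    by simp
  then have "C_carrier X \<in>
      {{f \<in> C_carrier X. f ` K \<subseteq> U} | K U. compactin X K \<and> openin euclideanreal U}"
    by blast
  then show ?thesis
    unfolding Ck_def topology_generated_by_topspace by blast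
qed

definition isolated_in_space :: "'a topology \<Rightarrow> 'a \<Rightarrow> bool"
  where "isolated_in_space A x \<longleftrightarrow> x \<in> topspace A \<and> openin A {x} \<and> closedin A {x}"

definition non_isolated :: "'a topology \<Rightarrow> 'a set"
  where "non_isolated A = {x \<in> topspace A. \<not> isolated_in_space A x}"

primrec derived_space :: "'a topology \<Rightarrow> nat \<Rightarrow> 'a topology"
  where
    "derived_space X 0 = X"
  | "derived_space X (Suc n) = subtopology (derived_space X n) (non_isolated (derived_space X n))"

definition stratifiable :: "'a topology \<Rightarrow> bool"
  where "stratifiable X \<longleftrightarrow> regular_space X \<and> t1_space X \<and>
    (\<exists>U :: 'a \<Rightarrow> nat \<Rightarrow> 'a set.
       (\<forall>x \<in> topspace X. decseq (U x) \<and> (\<forall>n. nbhd_in X x (U x n))) \<and>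
       (\<forall>F. closedin X F \<longrightarrow> F = (\<Inter>n. X closure_of (\<Union>x\<in>F. U x n))))"

definition moving_off_family :: "'a topology \<Rightarrow> 'a set set \<Rightarrow> bool"
  where "moving_off_family X \<F> \<longleftrightarrow> (\<forall>F \<in> \<F>. F \<subseteq> topspace X) \<and>
    (\<forall>K. compactin X K \<longrightarrow> (\<exists>F \<in> \<F>. F \<noteq> {} \<and> K \<inter> F = {}))"

text \<open>Discreteness is that of the indexed family \<open>V\<close>: equal sets \<open>V F = V G\<close> for
  distinct \<open>F\<close> and \<open>G\<close> count twice.\<close>

definition strongly_discrete :: "'a topology \<Rightarrow> 'a set set \<Rightarrow> bool"
  where "strongly_discrete X \<F> \<longleftrightarrow>
    (\<exists>V :: 'a set \<Rightarrow> 'a set.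
       (\<forall>F \<in> \<F>. openin X (V F) \<and> F \<subseteq> V F) \<and>
       (\<forall>x \<in> topspace X. \<exists>N. nbhd_in X x N \<and>
          (\<forall>F \<in> \<F>. \<forall>G \<in> \<F>. V F \<inter> N \<noteq> {} \<and> V G \<inter> N \<noteq> {} \<longrightarrow> F = G)))"

definition Moving_Off_Property :: "'a topology \<Rightarrow> bool"
  where "Moving_Off_Property X \<longleftrightarrow>
    (\<forall>\<F>. moving_off_family X \<F> \<and> (\<forall>F \<in> \<F>. compactin X F) \<longrightarrow>
       (\<exists>\<G> \<subseteq> \<F>. infinite \<G> \<and> strongly_discrete X \<G>))"

end

(*
If C_k(X) is Baire and F is a moving off family of compact sets, a generic function takes values
above n on some member of F, for every n; members on which its values are far apart form a strongly
discrete sequence. This gives the Moving Off Property.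

Conversely, by induction on n it is enough to pass from a closed set A with isolated complement D to
X. A closing-off argument (C_k(X) satisfies the countable chain condition) reduces the Baire property
of C_k(X) to that of C_k(Z) for closed separable subspaces Z, for which C_k(Z) is separable. A
stratification yields a continuous retraction r of X onto A, so near any compact set a function on X
is u o r + g with u in C(A) and g of finite support in D. Given dense open sets W_n, the passage from
one condition (u, g, compact set, radius) to a smaller one inside W_n changes u or g by more than a
small error only on a compact set B that can be chosen disjoint from any prescribed compact set. The
Moving Off Property therefore provides a countable tree of conditions whose sets B are locally finite.
Local finiteness makes the projections of the children of a node dense below its projection, so the
Baire property of C_k(A) yields a function u on A that lies in all projections along a branch; along
this branch the functions g converge locally uniformly, and u o r + lim g lies in every W_n.
*)
theory Submission
  imports Defs
begin

section \<open>The compact-open topology\<close>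

text \<open>The Moving Off Property only thins out families that are given in advance; it cannot
  react to a construction in progress. So all conditions are laid out as a tree before any branch is
  chosen, and the tree has to be countable. This is why \<open>C_k(A)\<close> must be separable, and
  why X is first cut down to the closure of a countable set. The children of a node aim at each
  member of a countable dense set with each precision \<open>1 / 2 ^ k\<close>. For a fixed target
  and a fixed compact set, local finiteness spoils only finitely many k, and this makes the
  projections of the children dense.

  Each exceptional set B is compact because closed inequalities cut it out of a compact set. Its
  disjointness from the old compact set protects what is already decided, while local finiteness of
  all B makes the limit continuous. A retraction is used instead of the Tietze theorem because u has
  to be extended by one formula that respects closeness on compact sets. Isolated points enter
  through finiteness: a compact set missing A is finite, so the corrections g can have finite
  support.\<close>

definition Cball :: "'a topology \<Rightarrow> ('a \<Rightarrow> real) \<Rightarrow> 'a set \<Rightarrow> real \<Rightarrow> ('a \<Rightarrow> real) set"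
  where "Cball X f K e = {h \<in> C_carrier X. \<forall>x\<in>K. \<bar>h x - f x\<bar> < e}"

lemma Cball_iff: "h \<in> Cball X f K e \<longleftrightarrow> h \<in> C_carrier X \<and> (\<forall>x\<in>K. \<bar>h x - f x\<bar> < e)"
  by (simp add: Cball_def)

lemma C_carrier_cont: "f \<in> C_carrier X \<Longrightarrow> continuous_map X euclideanreal f"
  by (simp add: C_carrier_def)

lemma restrict_C_carrier:
  "continuous_map X euclideanreal f \<Longrightarrow> restrict f (topspace X) \<in> C_carrier X"
  by (auto simp: C_carrier_def intro: continuous_map_eq)

lemma openin_preimage_real:
  "continuous_map X euclideanreal f \<Longrightarrow> open U \<Longrightarrow> openin X {x \<in> topspace X. f x \<in> U}"
  using openin_continuous_map_preimage[of X euclideanreal f U] by simp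

lemma closedin_preimage_real:
  "continuous_map X euclideanreal f \<Longrightarrow> closed U \<Longrightarrow> closedin X {x \<in> topspace X. f x \<in> U}"
  using closedin_continuous_map_preimage[of X euclideanreal f U] by simp

lemma compactin_Int_preimage_real:
  assumes "continuous_map X euclideanreal f" "closed U" "compactin X K"
  shows "compactin X {x \<in> K. f x \<in> U}"
proof -
  have "{x \<in> K. f x \<in> U} = K \<inter> {x \<in> topspace X. f x \<in> U}"
    using compactin_subset_topspace[OF assms(3)] by auto
  then show ?thesis
    using compact_Int_closedin[OF assms(3) closedin_preimage_real[OF assms(1,2)]] by simp
qed

lemma compactin_abs_ge:
  assumes "continuous_map X euclideanreal f" "compactin X K"
  shows "compactin X {x \<in> K. c \<le> \<bar>f x\<bar>}"
  using compactin_Int_preimage_real[OF continuous_map_real_abs[OF assms(1)] closed_atLeast[of c] assms(2)]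
  by simp

text \<open>A continuous function attains its maximum on a compact set, so a strict bound leaves a
  uniform margin. This is how smaller balls are fitted inside given ones.\<close>

lemma compactin_slack:
  assumes "continuous_map X euclideanreal f" "compactin X K" "e > 0" "\<And>x. x \<in> K \<Longrightarrow> \<bar>f x\<bar> < e"
  obtains d :: real where "d > 0" "\<And>x. x \<in> K \<Longrightarrow> \<bar>f x\<bar> + d \<le> e"
proof (cases "K = {}")
  case True
  then show ?thesis using that[of 1] by simp
next
  case False
  let ?g = "\<lambda>x. \<bar>f x\<bar>"
  have "compactin euclideanreal (?g ` K)"
    by (rule image_compactin[OF assms(2) continuous_map_real_abs[OF assms(1)]])
  then have "compact (?g ` K)" by simp
  then obtain s where s: "s \<in> ?g ` K" "\<forall>t\<in>?g ` K. t \<le> s"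
    using compact_attains_sup[of "?g ` K"] False by auto
  then have "s < e" using assms(4) by auto
  then show ?thesis using that[of "e - s"] s by force
qed

lemma topology_generated_by_base: "s \<in> B \<Longrightarrow> openin (topology_generated_by B) s"
  by (simp add: openin_topology_generated_by_iff generate_topology_on.Basis)

lemma openin_Ck_sub:
  "compactin X K \<Longrightarrow> open U \<Longrightarrow> openin (Ck X) {f \<in> C_carrier X. f ` K \<subseteq> U}"
  unfolding Ck_def by (rule topology_generated_by_base) auto

text \<open>Finitely many subbasic conditions suffice: K is covered by finitely many sets on which
  \<open>f\<close> is within \<open>e/3\<close> of a value \<open>f x\<close>, and on the compact
  pieces \<open>V x\<close> the competitor is kept within \<open>e/2\<close> of \<open>f x\<close>.
  The sum of the two errors is below \<open>e\<close>.\<close>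

lemma Ck_nbhd_in_Cball:
  assumes f: "f \<in> C_carrier X" and K: "compactin X K" and e: "e > 0"
  shows "\<exists>N. openin (Ck X) N \<and> f \<in> N \<and> N \<subseteq> Cball X f K e"
proof -
  have cf: "continuous_map X euclideanreal f" using f by (rule C_carrier_cont)
  have KX: "K \<subseteq> topspace X" using K by (rule compactin_subset_topspace)
  define Nb where "Nb x = {y \<in> topspace X. f y \<in> ball (f x) (e/3)}" for x
  define V where "V x = {y \<in> K. f y \<in> cball (f x) (e/3)}" for x
  have Nb: "openin X (Nb x)" for x unfolding Nb_def by (rule openin_preimage_real[OF cf open_ball])
  have V: "compactin X (V x)" for x unfolding V_def
    by (rule compactin_Int_preimage_real[OF cf closed_cball K])
  have "K \<subseteq> \<Union>(Nb ` K)" using KX e by (force simp: Nb_def)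
  then obtain \<F> where F: "finite \<F>" "\<F> \<subseteq> Nb ` K" "K \<subseteq> \<Union>\<F>"
    using compactinD[OF K, of "Nb ` K"] Nb by blast
  then obtain T where T: "finite T" "T \<subseteq> K" "\<F> = Nb ` T" by (meson finite_subset_image)
  define N where "N = C_carrier X \<inter> (\<Inter>x\<in>T. {h \<in> C_carrier X. h ` V x \<subseteq> ball (f x) (e/2)})"
  have "openin (Ck X) (topspace (Ck X) \<inter> \<Inter>((\<lambda>x. {h \<in> C_carrier X. h ` V x \<subseteq> ball (f x) (e/2)}) ` T))"
    by (rule openin_Int_Inter) (use T V in \<open>auto intro!: openin_Ck_sub\<close>)
  then have "openin (Ck X) N" by (simp add: N_def topspace_Ck)
  moreover have "f \<in> N" using f e by (force simp: N_def V_def)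
  moreover have "N \<subseteq> Cball X f K e"
  proof
    fix h assume h: "h \<in> N"
    have "\<bar>h y - f y\<bar> < e" if y: "y \<in> K" for y
    proof -
      obtain x where x: "x \<in> T" "y \<in> Nb x" using F T y by auto
      then have "y \<in> V x" using y by (auto simp: Nb_def V_def)
      moreover have "h ` V x \<subseteq> ball (f x) (e/2)" using h x by (simp add: N_def)
      ultimately have "h y \<in> ball (f x) (e/2)" by blast
      then have "\<bar>f x - h y\<bar> < e/2" by (simp add: dist_real_def)
      moreover have "\<bar>f x - f y\<bar> < e/3" using x by (simp add: Nb_def dist_real_def)
      ultimately show ?thesis using e by linarith
    qed
    then show "h \<in> Cball X f K e" using h by (auto simp: Cball_def N_def)
  qed
  ultimately show ?thesis by blast
qed

text \<open>This identifies the compact-open topology with that of uniform convergence on compact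
  sets. For a subbasic set a radius exists because the compact image of K has an
  epsilon-neighborhood inside U.\<close>

lemma openin_Ck_iff:
  "openin (Ck X) S \<longleftrightarrow> S \<subseteq> C_carrier X \<and>
     (\<forall>f\<in>S. \<exists>K e. compactin X K \<and> e > 0 \<and> Cball X f K e \<subseteq> S)" (is "?L \<longleftrightarrow> ?R S")
proof
  assume ?L
  then have "generate_topology_on
     {{f \<in> C_carrier X. f ` K \<subseteq> U} | K U. compactin X K \<and> openin euclideanreal U} S"
    by (simp add: Ck_def openin_topology_generated_by_iff)
  then show "?R S"
  proof induction
    case Empty
    then show ?case by simp
  next
    case (Int a b)
    have "\<exists>K e. compactin X K \<and> e > 0 \<and> Cball X f K e \<subseteq> a \<inter> b" if f: "f \<in> a \<inter> b" for f
    proof -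
      obtain K1 e1 K2 e2 where "compactin X K1" "e1 > 0" "Cball X f K1 e1 \<subseteq> a"
        "compactin X K2" "e2 > 0" "Cball X f K2 e2 \<subseteq> b" using Int f by blast
      moreover have "Cball X f (K1 \<union> K2) (min e1 e2) \<subseteq> Cball X f K1 e1 \<inter> Cball X f K2 e2"
        by (auto simp: Cball_def)
      ultimately show ?thesis
        using compactin_Un[of X K1 K2]
        by (intro exI[of _ "K1 \<union> K2"] exI[of _ "min e1 e2"]) (simp, blast)
    qed
    then show ?case using Int by auto
  next
    case (UN \<K>)
    have "\<exists>K e. compactin X K \<and> e > 0 \<and> Cball X f K e \<subseteq> \<Union>\<K>" if "f \<in> \<Union>\<K>" for f
    proof -
      from that obtain k where k: "k \<in> \<K>" "f \<in> k" by blast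
      then have "\<exists>K e. compactin X K \<and> e > 0 \<and> Cball X f K e \<subseteq> k" using UN.IH[of k] by blast
      then show ?thesis using k(1) by blast
    qed
    then show ?case using UN.IH by blast
  next
    case (Basis s)
    then obtain K U where K: "compactin X K" "open U" "s = {f \<in> C_carrier X. f ` K \<subseteq> U}"
      by auto
    have "\<exists>K e. compactin X K \<and> e > 0 \<and> Cball X f K e \<subseteq> s" if f: "f \<in> s" for f
    proof -
      have "compactin euclideanreal (f ` K)"
        using image_compactin[OF K(1), of euclideanreal f] f K by (auto simp: C_carrier_def)
      then have "compact (f ` K)" by simp
      moreover have "f ` K \<subseteq> U" using f K by auto
      ultimately obtain e where e: "e > 0" "(\<Union>x\<in>f ` K. ball x e) \<subseteq> U"
        using compact_subset_open_imp_ball_epsilon_subset[of "f ` K" U] K(2) by blast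
      have "Cball X f K e \<subseteq> s"
      proof
        fix h assume h: "h \<in> Cball X f K e"
        have "h x \<in> ball (f x) e" if "x \<in> K" for x
          using h that by (auto simp: Cball_def dist_real_def abs_minus_commute)
        then show "h \<in> s" using h e K by (force simp: Cball_def)
      qed
      then show ?thesis using K e by blast
    qed
    then show ?case using K by auto
  qed
next
  assume R: "?R S"
  have "\<exists>N. openin (Ck X) N \<and> f \<in> N \<and> N \<subseteq> S" if "f \<in> S" for f
  proof -
    from R that obtain K e where K: "compactin X K" "e > 0" "Cball X f K e \<subseteq> S" by blast
    moreover have "f \<in> C_carrier X" using R that by blast
    ultimately show ?thesis using Ck_nbhd_in_Cball[of f X K e] by blast
  qed
  then show ?L using openin_subopen[of "Ck X" S] by blast
qed

lemma openin_Cball: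
  assumes "f \<in> C_carrier X" "compactin X K" "e > 0"
  shows "openin (Ck X) (Cball X f K e)"
proof -
  have "\<exists>d>0. Cball X h K d \<subseteq> Cball X f K e" if h: "h \<in> Cball X f K e" for h
  proof -
    have "continuous_map X euclideanreal (\<lambda>x. h x - f x)"
      using h assms(1) by (simp add: continuous_map_diff C_carrier_cont Cball_iff)
    moreover have "\<And>x. x \<in> K \<Longrightarrow> \<bar>h x - f x\<bar> < e" using h by (simp add: Cball_def)
    ultimately obtain d where "d > 0" and d: "\<And>x. x \<in> K \<Longrightarrow> \<bar>h x - f x\<bar> + d \<le> e"
      using compactin_slack[of X "\<lambda>x. h x - f x" K e] assms(2,3) by blast
    have "Cball X h K d \<subseteq> Cball X f K e"
    proof
      fix g assume g: "g \<in> Cball X h K d"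
      have "\<bar>g x - f x\<bar> < e" if "x \<in> K" for x
      proof -
        have "\<bar>g x - h x\<bar> < d" using g that by (simp add: Cball_iff)
        then show ?thesis using d[OF that] by linarith
      qed
      then show "g \<in> Cball X f K e" using g by (simp add: Cball_iff)
    qed
    then show ?thesis using \<open>d > 0\<close> by blast
  qed
  note * = this
  show ?thesis unfolding openin_Ck_iff
  proof (intro conjI ballI)
    show "Cball X f K e \<subseteq> C_carrier X" by (auto simp: Cball_iff)
    fix h assume "h \<in> Cball X f K e"
    then obtain d where "d > 0" "Cball X h K d \<subseteq> Cball X f K e" using * by blast
    then show "\<exists>L d. compactin X L \<and> d > 0 \<and> Cball X h L d \<subseteq> Cball X f K e"
      by (intro exI[of _ K] exI[of _ d]) (simp add: assms(2))
  qed
qed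

definition Ck_dense :: "'a topology \<Rightarrow> ('a \<Rightarrow> real) set \<Rightarrow> bool"
  where "Ck_dense X S \<longleftrightarrow> (\<forall>f K e. f \<in> C_carrier X \<longrightarrow> compactin X K \<longrightarrow> e > 0 \<longrightarrow> (\<exists>h\<in>S. h \<in> Cball X f K e))"

lemma Ck_denseD:
  "Ck_dense X S \<Longrightarrow> f \<in> C_carrier X \<Longrightarrow> compactin X K \<Longrightarrow> e > 0 \<Longrightarrow> \<exists>h\<in>S. h \<in> Cball X f K e"
  by (auto simp: Ck_dense_def)

lemma closure_of_Ck_eq: "Ck X closure_of S = topspace (Ck X) \<longleftrightarrow> Ck_dense X S"
proof
  assume L: "Ck X closure_of S = topspace (Ck X)"
  show "Ck_dense X S" unfolding Ck_dense_def
  proof (intro allI impI)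
    fix f K and e :: real assume a: "f \<in> C_carrier X" "compactin X K" "e > 0"
    then have "f \<in> Ck X closure_of S" using L by (simp add: topspace_Ck)
    moreover have "f \<in> Cball X f K e" using a by (simp add: Cball_iff)
    ultimately show "\<exists>h\<in>S. h \<in> Cball X f K e"
      using openin_Cball[OF a] by (auto simp: in_closure_of)
  qed
next
  assume R: "Ck_dense X S"
  have "f \<in> Ck X closure_of S" if f: "f \<in> C_carrier X" for f
  proof -
    have "\<exists>y. y \<in> S \<and> y \<in> T" if T: "f \<in> T" "openin (Ck X) T" for T
    proof -
      obtain K e where "compactin X K" "e > 0" "Cball X f K e \<subseteq> T"
        using T unfolding openin_Ck_iff by blast
      then show ?thesis using Ck_denseD[OF R f, of K e] by auto
    qed
    then show ?thesis using f by (auto simp: in_closure_of topspace_Ck)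
  qed
  then show "Ck X closure_of S = topspace (Ck X)"
    using closure_of_subset_topspace[of "Ck X" S] by (auto simp: topspace_Ck)
qed

lemma Baire_Ck_iff:
  "Baire_space (Ck X) \<longleftrightarrow>
    (\<forall>G :: nat \<Rightarrow> ('a \<Rightarrow> real) set. (\<forall>n. openin (Ck X) (G n) \<and> Ck_dense X (G n)) \<longrightarrow> Ck_dense X (\<Inter>n. G n))"
  unfolding Baire_space_def closure_of_Ck_eq by (rule refl)

lemma Baire_Ck_countable:
  assumes B: "Baire_space (Ck X)" and I: "countable I"
    and G: "\<And>i. i \<in> I \<Longrightarrow> openin (Ck X) (G i)" "\<And>i. i \<in> I \<Longrightarrow> Ck_dense X (G i)"
    and f: "f \<in> C_carrier X" "compactin X K" "e > 0"
  obtains h where "h \<in> Cball X f K e" "\<And>i. i \<in> I \<Longrightarrow> h \<in> G i"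
proof (cases "I = {}")
  case True
  have "f \<in> Cball X f K e" using f by (simp add: Cball_iff)
  then show ?thesis using that True by blast
next
  case False
  let ?H = "\<lambda>n. G (from_nat_into I n)"
  have "Ck_dense X (\<Inter>n. ?H n)"
    using B[unfolded Baire_Ck_iff, rule_format, of ?H] G from_nat_into[OF False] by simp
  from Ck_denseD[OF this f] obtain h where h: "h \<in> Cball X f K e" "h \<in> (\<Inter>n. ?H n)" by auto
  have "h \<in> G i" if "i \<in> I" for i
    using h(2) from_nat_into_surj[OF I that] by blast
  then show ?thesis using that h(1) by blast
qed

section \<open>Stratifications\<close>

text \<open>A normalized form: the neighborhoods are open, and the equation between a closed set and
  an intersection of closures becomes a pointwise statement, an index n for each point z
  outside.\<close>

definition stratification :: "'a topology \<Rightarrow> ('a \<Rightarrow> nat \<Rightarrow> 'a set) \<Rightarrow> bool"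
  where "stratification X U \<longleftrightarrow>
    (\<forall>x\<in>topspace X. \<forall>n. openin X (U x n) \<and> x \<in> U x n \<and> U x (Suc n) \<subseteq> U x n) \<and>
    (\<forall>F z. closedin X F \<longrightarrow> z \<in> topspace X - F \<longrightarrow> (\<exists>n. z \<notin> X closure_of (\<Union>x\<in>F. U x n)))"

lemma not_in_closure_of: "openin X T \<Longrightarrow> z \<in> T \<Longrightarrow> T \<inter> S = {} \<Longrightarrow> z \<notin> X closure_of S"
  by (auto simp: in_closure_of)

lemma stratification_open: "stratification X U \<Longrightarrow> x \<in> topspace X \<Longrightarrow> openin X (U x n)"
  by (simp add: stratification_def)

lemma stratification_mem: "stratification X U \<Longrightarrow> x \<in> topspace X \<Longrightarrow> x \<in> U x n"
  by (simp add: stratification_def)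

lemma stratification_antimono:
  assumes "stratification X U" "x \<in> topspace X" "m \<le> n"
  shows "U x n \<subseteq> U x m"
  using lift_Suc_antimono_le[of "U x" m n] assms by (simp add: stratification_def)

lemma stratification_separate:
  "stratification X U \<Longrightarrow> closedin X F \<Longrightarrow> z \<in> topspace X \<Longrightarrow> z \<notin> F \<Longrightarrow> \<exists>n. z \<notin> X closure_of (\<Union>x\<in>F. U x n)"
  by (simp add: stratification_def)

lemma stratification_Union_antimono:
  assumes "stratification X U" "F \<subseteq> topspace X" "m \<le> n"
  shows "(\<Union>x\<in>F. U x n) \<subseteq> (\<Union>x\<in>F. U x m)"
  using stratification_antimono[OF assms(1) _ assms(3)] assms(2) by blast

lemma stratification_subset_Union:
  assumes "stratification X U" "F \<subseteq> topspace X"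
  shows "F \<subseteq> (\<Union>x\<in>F. U x n)"
proof
  fix x assume "x \<in> F"
  moreover have "x \<in> U x n" using calculation assms(2) stratification_mem[OF assms(1)] by blast
  ultimately show "x \<in> (\<Union>x\<in>F. U x n)" by (rule UN_I)
qed

lemma stratification_Union_open:
  assumes "stratification X U" "F \<subseteq> topspace X"
  shows "openin X (\<Union>x\<in>F. U x n)"
  using assms by (auto intro!: openin_Union simp: stratification_open subset_iff)

lemma stratifiable_imp_stratification:
  assumes "stratifiable X"
  shows "\<exists>U. stratification X U"
proof -
  obtain U :: "'a \<Rightarrow> nat \<Rightarrow> 'a set"
    where U: "\<forall>x \<in> topspace X. decseq (U x) \<and> (\<forall>n. nbhd_in X x (U x n))"
    and F: "\<forall>F. closedin X F \<longrightarrow> F = (\<Inter>n. X closure_of (\<Union>x\<in>F. U x n))"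
    using assms by (auto simp: stratifiable_def)
  let ?V = "\<lambda>x n. X interior_of (U x n)"
  have "x \<in> ?V x n" if "x \<in> topspace X" for x n
    using U that unfolding nbhd_in_def interior_of_def by blast
  moreover have "?V x (Suc n) \<subseteq> ?V x n" if "x \<in> topspace X" for x n
    using U that by (intro interior_of_mono) (auto simp: decseq_Suc_iff)
  moreover have "\<exists>n. z \<notin> X closure_of (\<Union>x\<in>F. ?V x n)"
    if "closedin X F" "z \<in> topspace X - F" for F z
  proof -
    have "z \<notin> (\<Inter>n. X closure_of (\<Union>x\<in>F. U x n))" using F that by blast
    then obtain n where n: "z \<notin> X closure_of (\<Union>x\<in>F. U x n)" by blast
    have "(\<Union>x\<in>F. ?V x n) \<subseteq> (\<Union>x\<in>F. U x n)" using interior_of_subset[of X] by blast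
    then show ?thesis using n closure_of_mono by blast
  qed
  ultimately show ?thesis by (intro exI[of _ ?V]) (simp add: stratification_def)
qed

lemma stratification_imp_stratifiable:
  assumes "regular_space X" "t1_space X" and U: "stratification X U"
  shows "stratifiable X"
proof -
  have 1: "decseq (U x) \<and> (\<forall>n. nbhd_in X x (U x n))" if "x \<in> topspace X" for x
    using U that openin_subset[of X] unfolding stratification_def nbhd_in_def decseq_Suc_iff by blast
  have 2: "F = (\<Inter>n. X closure_of (\<Union>x\<in>F. U x n))" if F: "closedin X F" for F
  proof
    have FX: "F \<subseteq> topspace X" using F by (rule closedin_subset)
    have "(\<Union>x\<in>F. U x n) \<subseteq> topspace X" for n
      by (rule openin_subset[OF stratification_Union_open[OF U FX]])
    then have "(\<Union>x\<in>F. U x n) \<subseteq> X closure_of (\<Union>x\<in>F. U x n)" for n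
      by (rule closure_of_subset)
    then have "F \<subseteq> X closure_of (\<Union>x\<in>F. U x n)" for n
      using stratification_subset_Union[OF U FX, of n] by (meson order_trans)
    then show "F \<subseteq> (\<Inter>n. X closure_of (\<Union>x\<in>F. U x n))" by (rule INF_greatest)
    show "(\<Inter>n. X closure_of (\<Union>x\<in>F. U x n)) \<subseteq> F"
    proof
      fix z assume z: "z \<in> (\<Inter>n. X closure_of (\<Union>x\<in>F. U x n))"
      then have "z \<in> topspace X" using closure_of_subset_topspace by fast
      then show "z \<in> F" using stratification_separate[OF U F, of z] z by blast
    qed
  qed
  show ?thesis unfolding stratifiable_def using assms(1,2) 1 2 by blast
qed

text \<open>In \<open>W A B\<close> each n-th neighborhood of A is trimmed by the closure of the
  n-th neighborhood of B. A point in \<open>W S T\<close> with index n and in \<open>W T S\<close>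
  with index m is impossible: the trimming at the smaller index already removes the neighborhood of
  larger index.\<close>

lemma stratification_normal:
  assumes U: "stratification X U"
  shows "normal_space X"
  unfolding normal_space_def
proof (intro allI impI)
  fix S T assume ST: "closedin X S \<and> closedin X T \<and> disjnt S T"
  then have sub: "S \<subseteq> topspace X" "T \<subseteq> topspace X" by (simp_all add: closedin_subset)
  define N where "N A n = (\<Union>x\<in>A. U x n)" for A n
  define W where "W A B = (\<Union>n. N A n - X closure_of (N B n))" for A B
  have op: "openin X (W A B)" if "A \<subseteq> topspace X" for A B
    unfolding W_def N_def using stratification_Union_open[OF U that]
    by (intro openin_Union) (auto intro: openin_diff)
  have cov: "A \<subseteq> W A B" if A: "closedin X A" and B: "closedin X B" and AB: "disjnt A B" for A B
  proof
    fix x assume x: "x \<in> A"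
    then have xX: "x \<in> topspace X" "x \<notin> B" using closedin_subset[OF A] AB by (auto simp: disjnt_iff)
    then obtain n where "x \<notin> X closure_of (N B n)"
      using stratification_separate[OF U B] unfolding N_def by blast
    moreover have "x \<in> N A n" using x stratification_mem[OF U xX(1)] by (auto simp: N_def)
    ultimately show "x \<in> W A B" by (auto simp: W_def)
  qed
  have le: "z \<notin> N B m" if "m \<ge> n" "z \<notin> X closure_of (N B n)" "B \<subseteq> topspace X" for z B m n
  proof -
    have "N B m \<subseteq> N B n"
      unfolding N_def by (rule stratification_Union_antimono[OF U that(3,1)])
    moreover have "N B n \<subseteq> X closure_of (N B n)"
      unfolding N_def by (intro closure_of_subset openin_subset stratification_Union_open[OF U that(3)])
    ultimately show ?thesis using that(2) by blast
  qed
  have "disjnt (W S T) (W T S)"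
  proof -
    have False if "z \<in> N S n" "z \<notin> X closure_of (N T n)" "z \<in> N T m" "z \<notin> X closure_of (N S m)" for z n m
      using le[of n m z T] le[of m n z S] that sub by linarith
    then show ?thesis by (auto simp: W_def disjnt_iff)
  qed
  then show "\<exists>U V. openin X U \<and> openin X V \<and> S \<subseteq> U \<and> T \<subseteq> V \<and> disjnt U V"
    using op sub cov[of S T] cov[of T S] ST by (metis disjnt_sym)
qed

lemma stratifiable_normal: "stratifiable X \<Longrightarrow> normal_space X"
  using stratifiable_imp_stratification stratification_normal by blast

lemma stratifiable_Hausdorff: "stratifiable X \<Longrightarrow> Hausdorff_space X"
  using normal_t1_eq_Hausdorff_space stratifiable_normal stratifiable_def by blast

lemma stratification_closed_subspace:
  assumes U: "stratification X U" and S: "closedin X S"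
  shows "stratification (subtopology X S) (\<lambda>x n. S \<inter> U x n)"
proof -
  have "\<exists>n. z \<notin> subtopology X S closure_of (\<Union>x\<in>F. S \<inter> U x n)"
    if F: "closedin (subtopology X S) F" and z: "z \<in> topspace (subtopology X S) - F" for F z
  proof -
    have "closedin X F" using F S closedin_trans_full by blast
    then obtain n where n: "z \<notin> X closure_of (\<Union>x\<in>F. U x n)"
      using stratification_separate[OF U] z by auto
    have "X closure_of (S \<inter> (\<Union>x\<in>F. S \<inter> U x n)) \<subseteq> X closure_of (\<Union>x\<in>F. U x n)"
      by (rule closure_of_mono) blast
    then show ?thesis using n by (auto simp: closure_of_subtopology)
  qed
  moreover have "openin (subtopology X S) (S \<inter> U x n) \<and> x \<in> S \<inter> U x n \<and> S \<inter> U x (Suc n) \<subseteq> S \<inter> U x n"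
    if "x \<in> topspace (subtopology X S)" for x n
    using that U by (auto simp: stratification_def openin_subtopology_Int2)
  ultimately show ?thesis unfolding stratification_def by blast
qed

lemma stratifiable_closed_subspace:
  assumes "stratifiable X" "closedin X S"
  shows "stratifiable (subtopology X S)"
proof -
  obtain U where "stratification X U" using assms stratifiable_imp_stratification by blast
  then have "stratification (subtopology X S) (\<lambda>x n. S \<inter> U x n)"
    using assms by (intro stratification_closed_subspace)
  then show ?thesis using assms stratification_imp_stratifiable
    by (metis regular_space_subtopology stratifiable_def t1_space_subtopology)
qed

text \<open>If a box \<open>P \<times> Q\<close> around z misses F, each point of F has its first
  coordinate outside P or its second outside Q, so at index \<open>max k l\<close> its neighborhood
  misses \<open>P' \<times> Q'\<close>. The case needed is the square of X, whose normality yields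
  functions separating points from the diagonal.\<close>

lemma stratification_prod:
  assumes U: "stratification X U" and V: "stratification Y V"
  shows "stratification (prod_topology X Y) (\<lambda>z n. U (fst z) n \<times> V (snd z) n)"
proof -
  let ?W = "\<lambda>z n. U (fst z) n \<times> V (snd z) n"
  have "\<exists>n. z \<notin> prod_topology X Y closure_of (\<Union>p\<in>F. ?W p n)"
    if F: "closedin (prod_topology X Y) F" and z: "z \<in> topspace (prod_topology X Y) - F" for F z
  proof -
    obtain a b where ab: "z = (a, b)" by (cases z)
    have "openin (prod_topology X Y) (topspace (prod_topology X Y) - F)" using F by blast
    then obtain P Q where PQ: "openin X P" "openin Y Q" "a \<in> P" "b \<in> Q"
      "P \<times> Q \<subseteq> topspace (prod_topology X Y) - F"
      using z ab unfolding openin_prod_topology_alt by meson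
    have aX: "a \<in> topspace X" and bY: "b \<in> topspace Y" using z ab by auto
    obtain k where k: "a \<notin> X closure_of (\<Union>x\<in>topspace X - P. U x k)"
      using stratification_separate[OF U _ aX, of "topspace X - P"] PQ by auto
    obtain l where l: "b \<notin> Y closure_of (\<Union>y\<in>topspace Y - Q. V y l)"
      using stratification_separate[OF V _ bY, of "topspace Y - Q"] PQ by auto
    define n where "n = max k l"
    obtain P' where P': "openin X P'" "a \<in> P'" "P' \<inter> (\<Union>x\<in>topspace X - P. U x k) = {}"
      using k aX unfolding in_closure_of by auto
    obtain Q' where Q': "openin Y Q'" "b \<in> Q'" "Q' \<inter> (\<Union>y\<in>topspace Y - Q. V y l) = {}"
      using l bY unfolding in_closure_of by auto
    have "False" if p: "(x, y) \<in> F" and w: "(s, t) \<in> U x n \<times> V y n" "(s, t) \<in> P' \<times> Q'" for x y s t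
    proof -
      have xy: "x \<in> topspace X" "y \<in> topspace Y" using p closedin_subset[OF F] by auto
      have "s \<in> U x k" "t \<in> V y l"
        using w stratification_antimono[OF U xy(1), of k n] stratification_antimono[OF V xy(2), of l n]
        by (auto simp: n_def)
      then have "x \<in> P" "y \<in> Q" using P'(3) Q'(3) w xy by auto
      then show False using PQ(5) p by auto
    qed
    note no = this
    have "(P' \<times> Q') \<inter> (\<Union>p\<in>F. ?W p n) = {}"
    proof (rule equals0I)
      fix w assume w: "w \<in> (P' \<times> Q') \<inter> (\<Union>p\<in>F. ?W p n)"
      then obtain p where p: "p \<in> F" "w \<in> ?W p n" by (elim IntE UN_E)
      have "(fst p, snd p) \<in> F" "(fst w, snd w) \<in> U (fst p) n \<times> V (snd p) n"
        "(fst w, snd w) \<in> P' \<times> Q'" using p w by auto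
      then show False by (rule no)
    qed
    moreover have "openin (prod_topology X Y) (P' \<times> Q')"
      using P' Q' by (simp add: openin_prod_Times_iff)
    moreover have "z \<in> P' \<times> Q'" using ab P' Q' by simp
    ultimately have "z \<notin> prod_topology X Y closure_of (\<Union>p\<in>F. ?W p n)"
      by (intro not_in_closure_of[of _ "P' \<times> Q'"])
    then show ?thesis by (rule exI)
  qed
  moreover have "openin (prod_topology X Y) (?W z n) \<and> z \<in> ?W z n \<and> ?W z (Suc n) \<subseteq> ?W z n"
    if "z \<in> topspace (prod_topology X Y)" for z n
    using that U V by (auto simp: stratification_def openin_prod_Times_iff mem_Times_iff subset_iff)
  ultimately show ?thesis unfolding stratification_def by simp
qed

section \<open>Heredity of the Moving Off Property to closed subspaces\<close>

lemma Moving_Off_PropertyD: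
  "Moving_Off_Property X \<Longrightarrow> moving_off_family X \<F> \<Longrightarrow> \<forall>F\<in>\<F>. compactin X F \<Longrightarrow>
    \<exists>\<G>\<subseteq>\<F>. infinite \<G> \<and> strongly_discrete X \<G>"
  by (simp add: Moving_Off_Property_def)

text \<open>A compact set of X has a compact trace on S, so a family that moves off in S also moves
  off in X. The discrete open expansion found in X is then intersected with S.\<close>

lemma MOP_closed_subspace:
  assumes M: "Moving_Off_Property X" and S: "closedin X S"
  shows "Moving_Off_Property (subtopology X S)"
  unfolding Moving_Off_Property_def
proof (intro allI impI)
  fix \<F> assume F: "moving_off_family (subtopology X S) \<F> \<and> (\<forall>F\<in>\<F>. compactin (subtopology X S) F)"
  have SX: "S \<subseteq> topspace X" using S by (rule closedin_subset)
  have c: "\<forall>F\<in>\<F>. compactin X F \<and> F \<subseteq> S" using F by (auto simp: compactin_subtopology)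
  have "\<exists>F\<in>\<F>. F \<noteq> {} \<and> K \<inter> F = {}" if K: "compactin X K" for K
  proof -
    have "compactin (subtopology X S) (K \<inter> S)"
      using compact_Int_closedin[OF K S] by (simp add: compactin_subtopology)
    then obtain F where "F \<in> \<F>" "F \<noteq> {}" "(K \<inter> S) \<inter> F = {}"
      using F unfolding moving_off_family_def by blast
    then show ?thesis using c by blast
  qed
  note mo = this
  have "\<forall>F\<in>\<F>. F \<subseteq> topspace X" using c SX by (meson subset_trans)
  then have "moving_off_family X \<F>"
    unfolding moving_off_family_def by (intro conjI allI impI mo)
  moreover have "\<forall>F\<in>\<F>. compactin X F" using c by simp
  ultimately obtain \<G> where G: "\<G> \<subseteq> \<F>" "infinite \<G>" "strongly_discrete X \<G>"
    using Moving_Off_PropertyD[OF M, of \<F>] by blast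
  from G(3) obtain V where V: "\<forall>F\<in>\<G>. openin X (V F) \<and> F \<subseteq> V F"
    and d: "\<forall>x\<in>topspace X. \<exists>N. nbhd_in X x N \<and>
          (\<forall>F\<in>\<G>. \<forall>G\<in>\<G>. V F \<inter> N \<noteq> {} \<and> V G \<inter> N \<noteq> {} \<longrightarrow> F = G)"
    unfolding strongly_discrete_def by (elim exE conjE)
  have "strongly_discrete (subtopology X S) \<G>"
    unfolding strongly_discrete_def
  proof (intro exI[of _ "\<lambda>F. S \<inter> V F"] conjI ballI)
    fix F assume "F \<in> \<G>"
    then show "openin (subtopology X S) (S \<inter> V F)" "F \<subseteq> S \<inter> V F"
      using V c G(1) by (auto simp: openin_subtopology_Int2)
  next
    fix x assume x: "x \<in> topspace (subtopology X S)"
    then have "x \<in> topspace X" by simp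
    from d[rule_format, OF this] obtain N where N: "nbhd_in X x N"
      "\<forall>F\<in>\<G>. \<forall>G\<in>\<G>. V F \<inter> N \<noteq> {} \<and> V G \<inter> N \<noteq> {} \<longrightarrow> F = G" by metis
    from N(1) obtain W where "openin X W" "x \<in> W" "W \<subseteq> N" unfolding nbhd_in_def by blast
    then have "nbhd_in (subtopology X S) x (S \<inter> W)"
      using x SX openin_subtopology_Int2[of X W S] openin_subset[of X W] unfolding nbhd_in_def by auto
    moreover have "\<forall>F\<in>\<G>. \<forall>G\<in>\<G>. (S \<inter> V F) \<inter> (S \<inter> W) \<noteq> {} \<and> (S \<inter> V G) \<inter> (S \<inter> W) \<noteq> {} \<longrightarrow> F = G"
      using N(2) \<open>W \<subseteq> N\<close> by blast
    ultimately show "\<exists>N. nbhd_in (subtopology X S) x N \<and>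
          (\<forall>F\<in>\<G>. \<forall>G\<in>\<G>. (S \<inter> V F) \<inter> N \<noteq> {} \<and> (S \<inter> V G) \<inter> N \<noteq> {} \<longrightarrow> F = G)" by blast
  qed
  then show "\<exists>\<G>\<subseteq>\<F>. infinite \<G> \<and> strongly_discrete (subtopology X S) \<G>" using G by blast
qed

section \<open>Extension of functions and the Moving Off Property\<close>

lemma Urysohn_cutoff:
  assumes "normal_space X" "closedin X S" "closedin X T" "S \<inter> T = {}"
  obtains \<theta> where "continuous_map X euclideanreal \<theta>" "\<And>x. x \<in> topspace X \<Longrightarrow> 0 \<le> \<theta> x \<and> \<theta> x \<le> 1"
    "\<And>x. x \<in> S \<Longrightarrow> \<theta> x = 0" "\<And>x. x \<in> T \<Longrightarrow> \<theta> x = 1"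
proof -
  obtain \<theta> where t: "continuous_map X (top_of_set {0..1::real}) \<theta>" "\<theta> ` S \<subseteq> {0}" "\<theta> ` T \<subseteq> {1}"
    using Urysohn_lemma[OF assms(1-3), of 0 1] assms(4) by (auto simp: disjnt_def)
  have c: "continuous_map X euclideanreal \<theta>"
    using t(1) continuous_map_into_fulltopology by blast
  have "\<theta> x \<in> {0..1}" if "x \<in> topspace X" for x
    using continuous_map_image_subset_topspace[OF t(1)] that by auto
  then show ?thesis using that[OF c] t(2,3) by (simp add: image_subset_iff)
qed

lemma cutoff_product_bound:
  fixes t a e :: real
  assumes "0 \<le> t" "t \<le> 1" "\<bar>a\<bar> < e"
  shows "\<bar>t * a\<bar> < e"
  using mult_right_mono[of t 1 "\<bar>a\<bar>"] assms by (simp add: abs_mult)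

text \<open>A Tietze extension of \<open>g\<close> may stray from \<open>f\<close> on K, but it does
  so by \<open>e\<close> or more only on a compact set disjoint from Z. A Urysohn function switches
  the difference off there, and elsewhere on K the convex combination stays within \<open>e\<close>
  of \<open>f\<close>.\<close>

lemma Ck_extend:
  assumes X: "normal_space X" "Hausdorff_space X" and Z: "closedin X Z"
    and f: "f \<in> C_carrier X" and g: "continuous_map (subtopology X Z) euclideanreal g"
    and K: "compactin X K" and e: "e > 0" and fg: "\<And>x. x \<in> K \<Longrightarrow> x \<in> Z \<Longrightarrow> \<bar>g x - f x\<bar> < e"
  obtains h where "h \<in> Cball X f K e" "\<And>x. x \<in> Z \<Longrightarrow> h x = g x"
proof -
  have ZX: "Z \<subseteq> topspace X" using Z by (rule closedin_subset)
  have KX: "K \<subseteq> topspace X" using K by (rule compactin_subset_topspace)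
  obtain g' where g': "continuous_map X euclideanreal g'" "\<And>x. x \<in> Z \<Longrightarrow> g' x = g x"
    using Tietze_extension_realinterval[OF X(1) Z is_interval_univ UNIV_not_empty g] by auto
  define S where "S = {x \<in> K. e \<le> \<bar>g' x - f x\<bar>}"
  have cd: "continuous_map X euclideanreal (\<lambda>x. g' x - f x)"
    using g'(1) f by (simp add: continuous_map_diff C_carrier_cont)
  have "compactin X S" unfolding S_def by (rule compactin_abs_ge[OF cd K])
  then have "closedin X S" using X(2) compactin_imp_closedin by blast
  moreover have "S \<inter> Z = {}" using fg g'(2) by (fastforce simp: S_def)
  ultimately obtain \<theta> where t: "continuous_map X euclideanreal \<theta>"
    "\<And>x. x \<in> topspace X \<Longrightarrow> 0 \<le> \<theta> x \<and> \<theta> x \<le> 1"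
    "\<And>x. x \<in> S \<Longrightarrow> \<theta> x = 0" "\<And>x. x \<in> Z \<Longrightarrow> \<theta> x = 1"
    using Urysohn_cutoff[OF X(1) _ Z, of S] by metis
  define h where "h = restrict (\<lambda>x. f x + \<theta> x * (g' x - f x)) (topspace X)"
  have "h \<in> C_carrier X" unfolding h_def
    by (intro restrict_C_carrier continuous_map_add continuous_map_real_mult t(1) cd C_carrier_cont[OF f])
  moreover have "\<bar>h x - f x\<bar> < e" if "x \<in> K" for x
  proof (cases "x \<in> S")
    case True
    then show ?thesis using t(3) KX that e by (simp add: h_def subset_iff)
  next
    case False
    then have "\<bar>g' x - f x\<bar> < e" using that by (auto simp: S_def)
    moreover have "x \<in> topspace X" using KX that by blast
    ultimately show ?thesis using t(2)[of x] cutoff_product_bound by (simp add: h_def)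
  qed
  moreover have "h x = g x" if "x \<in> Z" for x
    using that ZX t(4) g'(2) by (auto simp: h_def)
  ultimately show ?thesis using that[of h] by (simp add: Cball_iff)
qed

lemma restrict_C_carrier_subtopology:
  assumes "f \<in> C_carrier X" "Z \<subseteq> topspace X"
  shows "restrict f Z \<in> C_carrier (subtopology X Z)"
proof -
  have "continuous_map (subtopology X Z) euclideanreal f"
    using assms(1) by (simp add: C_carrier_cont continuous_map_from_subtopology)
  then show ?thesis using restrict_C_carrier assms(2) by (metis topspace_subtopology_subset)
qed

lemma compactin_Int_closed:
  assumes "compactin X K" "closedin X Z"
  shows "compactin (subtopology X Z) (K \<inter> Z)"
  using compact_Int_closedin[OF assms] by (simp add: compactin_subtopology)

text \<open>Restriction to Z is continuous, and preimages of dense sets under it are dense by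
  \<open>Ck_extend\<close>. Hence the Baire property passes to its image.\<close>

lemma Baire_Ck_closed_subspace:
  assumes X: "normal_space X" "Hausdorff_space X" and Z: "closedin X Z" and B: "Baire_space (Ck X)"
  shows "Baire_space (Ck (subtopology X Z))"
  unfolding Baire_Ck_iff
proof (intro allI impI)
  let ?Z = "subtopology X Z"
  fix G :: "nat \<Rightarrow> ('a \<Rightarrow> real) set"
  assume G: "\<forall>n. openin (Ck ?Z) (G n) \<and> Ck_dense ?Z (G n)"
  have ZX: "Z \<subseteq> topspace X" using Z by (rule closedin_subset)
  then have tZ: "topspace ?Z = Z" by auto
  define H where "H n = {f \<in> C_carrier X. restrict f Z \<in> G n}" for n
  have op: "openin (Ck X) (H n)" for n
    unfolding openin_Ck_iff
  proof (intro conjI ballI)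
    show "H n \<subseteq> C_carrier X" by (auto simp: H_def)
    fix f assume f: "f \<in> H n"
    then have "restrict f Z \<in> G n" by (simp add: H_def)
    moreover have "openin (Ck ?Z) (G n)" using G by simp
    ultimately obtain K e where K: "compactin ?Z K" "e > 0" "Cball ?Z (restrict f Z) K e \<subseteq> G n"
      unfolding openin_Ck_iff by metis
    have KZ: "K \<subseteq> Z" "compactin X K" using K(1) by (simp_all add: compactin_subtopology)
    have "Cball X f K e \<subseteq> H n"
    proof
      fix h assume h: "h \<in> Cball X f K e"
      then have "restrict h Z \<in> Cball ?Z (restrict f Z) K e"
        using KZ restrict_C_carrier_subtopology[OF _ ZX] by (auto simp: Cball_iff subset_iff)
      then show "h \<in> H n" using K(3) h by (auto simp: H_def Cball_iff)
    qed
    then show "\<exists>K e. compactin X K \<and> e > 0 \<and> Cball X f K e \<subseteq> H n"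
      using KZ(2) K(2) by (intro exI[of _ K] exI[of _ e]) simp
  qed
  have de: "Ck_dense X (H n)" for n
    unfolding Ck_dense_def
  proof (intro allI impI)
    fix f K and e :: real assume f: "f \<in> C_carrier X" and K: "compactin X K" and e: "e > 0"
    have "Ck_dense ?Z (G n)" using G by simp
    from Ck_denseD[OF this restrict_C_carrier_subtopology[OF f ZX] compactin_Int_closed[OF K Z] e]
    obtain g where g: "g \<in> G n" "g \<in> Cball ?Z (restrict f Z) (K \<inter> Z) e" by metis
    have gc: "g \<in> C_carrier ?Z" using g(2) by (simp add: Cball_iff)
    have "\<bar>g x - f x\<bar> < e" if "x \<in> K" "x \<in> Z" for x
      using g(2) that by (auto simp: Cball_iff)
    then obtain h where h: "h \<in> Cball X f K e" "\<And>x. x \<in> Z \<Longrightarrow> h x = g x"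
      using Ck_extend[OF X Z f C_carrier_cont[OF gc] K e] by metis
    have "restrict h Z = g"
    proof (rule extensionalityI[of _ Z])
      show "g \<in> extensional Z" using gc tZ by (simp add: C_carrier_def)
    qed (use h(2) in auto)
    then have "h \<in> H n" using g(1) h(1) by (simp add: H_def Cball_iff)
    then show "\<exists>h\<in>H n. h \<in> Cball X f K e" using h(1) by blast
  qed
  show "Ck_dense ?Z (\<Inter>n. G n)"
    unfolding Ck_dense_def
  proof (intro allI impI)
    fix g K and e :: real assume g: "g \<in> C_carrier ?Z" and K: "compactin ?Z K" and e: "e > 0"
    have KZ: "K \<subseteq> Z" "compactin X K" using K(1) by (simp_all add: compactin_subtopology)
    have z: "restrict (\<lambda>x. 0) (topspace X) \<in> C_carrier X"
      by (rule restrict_C_carrier) simp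
    obtain f where f: "f \<in> C_carrier X" "\<And>x. x \<in> Z \<Longrightarrow> f x = g x"
      using Ck_extend[OF X Z z C_carrier_cont[OF g], of "{}" 1] by (auto simp: Cball_iff)
    obtain h where h: "h \<in> Cball X f K e" "\<And>n. h \<in> H n"
      by (rule Baire_Ck_countable[OF B countableI_type, of UNIV H f K e])
        (use op de f(1) KZ(2) e in auto)
    have "restrict h Z \<in> (\<Inter>n. G n)" using h(2) by (simp add: H_def)
    moreover have "restrict h Z \<in> Cball ?Z g K e"
      using h(1) f(2) KZ(1) restrict_C_carrier_subtopology[OF _ ZX, of h]
      by (auto simp: Cball_iff subset_iff)
    ultimately show "\<exists>h\<in>\<Inter>n. G n. h \<in> Cball ?Z g K e" by blast
  qed
qed

lemma Baire_imp_Moving_Off: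
  assumes X: "normal_space X" "Hausdorff_space X" and B: "Baire_space (Ck X)"
  shows "Moving_Off_Property X"
  unfolding Moving_Off_Property_def
proof (intro allI impI)
  fix \<F> assume F: "moving_off_family X \<F> \<and> (\<forall>F\<in>\<F>. compactin X F)"
  define G where "G n = \<Union> ((\<lambda>F. {f \<in> C_carrier X. f ` F \<subseteq> {real n<..}}) ` {F \<in> \<F>. F \<noteq> {}})" for n
  have op: "openin (Ck X) (G n)" for n
    unfolding G_def by (rule openin_Union) (use F in \<open>auto intro!: openin_Ck_sub\<close>)
  have de: "Ck_dense X (G n)" for n
    unfolding Ck_dense_def
  proof (intro allI impI)
    fix f K and e :: real assume f: "f \<in> C_carrier X" and K: "compactin X K" and e: "e > 0"
    obtain F where FF: "F \<in> \<F>" "F \<noteq> {}" "K \<inter> F = {}"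
      using F K unfolding moving_off_family_def by metis
    have FX: "compactin X F" using F FF by blast
    have cl: "closedin X K" "closedin X F" using X(2) K FX compactin_imp_closedin by blast+
    obtain \<theta> where t: "continuous_map X euclideanreal \<theta>"
      "\<And>x. x \<in> K \<Longrightarrow> \<theta> x = 0" "\<And>x. x \<in> F \<Longrightarrow> \<theta> x = 1"
      using Urysohn_cutoff[OF X(1) cl FF(3)] by metis
    define h where "h = restrict (\<lambda>x. f x + \<theta> x * (\<bar>f x\<bar> + real n + 1)) (topspace X)"
    have "h \<in> C_carrier X" unfolding h_def
      by (intro restrict_C_carrier continuous_map_add continuous_map_real_mult t(1)
          continuous_map_real_abs C_carrier_cont[OF f]) simp_all
    moreover have "h x = f x" if "x \<in> K" for x
      using that t(2) compactin_subset_topspace[OF K] by (auto simp: h_def)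
    moreover have "h x > real n" if "x \<in> F" for x
    proof -
      have "h x = f x + (\<bar>f x\<bar> + real n + 1)"
        using that t(3) compactin_subset_topspace[OF FX] by (auto simp: h_def)
      then show ?thesis by linarith
    qed
    ultimately have "h \<in> G n" "h \<in> Cball X f K e"
      using FF e by (auto simp: G_def Cball_iff)
    then show "\<exists>h\<in>G n. h \<in> Cball X f K e" by blast
  qed
  have z: "restrict (\<lambda>x. 0) (topspace X) \<in> C_carrier X"
    by (rule restrict_C_carrier) simp
  obtain f where f: "f \<in> C_carrier X" "\<And>n. f \<in> G n"
    using Baire_Ck_countable[OF B countableI_type, of UNIV G _ "{}" 1] op de z
    by (auto simp: Cball_iff)
  have cf: "continuous_map X euclideanreal f" using f(1) by (rule C_carrier_cont)
  have "\<exists>F\<in>\<F>. F \<noteq> {} \<and> (\<forall>x\<in>F. f x > real n)" for n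
    using f(2)[of n] unfolding G_def by auto
  then obtain A where A: "\<And>n. A n \<in> \<F>" "\<And>n. A n \<noteq> {}" "\<And>n x. x \<in> A n \<Longrightarrow> f x > real n"
    by metis
  have "\<exists>M. \<forall>x\<in>A n. f x \<le> M" for n
  proof -
    have "compactin X (A n)" using A(1) F by blast
    then have "compactin euclideanreal (f ` A n)" by (rule image_compactin[OF _ cf])
    then have "compact (f ` A n)" by simp
    then have "bdd_above (f ` A n)"
      by (intro bounded_imp_bdd_above compact_imp_bounded)
    then show ?thesis by (auto simp: bdd_above_def)
  qed
  then obtain M where M: "\<And>n x. x \<in> A n \<Longrightarrow> f x \<le> M n" by metis
  \<comment> \<open>The next index is chosen beyond the maximum of \<open>f\<close> on the current
    set, with room 3 for a collar around the values and for a gap.\<close>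
  define k where "k = rec_nat 0 (\<lambda>_ p. nat \<lceil>M p\<rceil> + 3)"
  have kS: "real (k (Suc m)) \<ge> M (k m) + 3" for m
    unfolding k_def by simp linarith
  have kM: "real (k m) < M (k m)" for m
    using A(2)[of "k m"] A(3) M by (meson ex_in_conv less_le_trans)
  have k_step: "real (k m) + 3 \<le> real (k (Suc m))" for m
    using kS[of m] kM[of m] by linarith
  have mono: "strict_mono k"
    unfolding strict_mono_Suc_iff
  proof
    fix n show "k n < k (Suc n)" using k_step[of n] by linarith
  qed
  \<comment> \<open>On \<open>A (k m)\<close> the values of \<open>f\<close> lie above
    \<open>k m\<close> and at most at \<open>k (Suc m) - 3\<close>. This band ends at
    \<open>k (Suc m) - 3/2\<close> and the next begins at \<open>k (Suc m) - 1/2\<close>, so two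
    points whose values differ by less than 1 cannot lie in different bands.\<close>
  define B where "B m = {x \<in> topspace X. f x \<in> {real (k m) - 1/2 <..< real (k (Suc m)) - 3/2}}" for m
  have AB: "A (k m) \<subseteq> B m" for m
  proof
    fix x assume x: "x \<in> A (k m)"
    have "compactin X (A (k m))" using A(1) F by blast
    then have "x \<in> topspace X" using x compactin_subset_topspace by blast
    then show "x \<in> B m" using A(3)[OF x] M[OF x] kS[of m] by (simp add: B_def)
  qed
  have sep: "m = n" if x: "x \<in> B m" and y: "y \<in> B n" and xy: "\<bar>f x - f y\<bar> < 1" for m n x y
  proof -
    have le: "real (k (Suc i)) \<le> real (k j)" if "i < j" for i j
      using mono that by (simp add: strict_mono_less_eq Suc_leI)
    have "\<not> m < n"
    proof
      assume "m < n"
      from le[OF this] x y xy show False by (simp add: B_def)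
    qed
    moreover have "\<not> n < m"
    proof
      assume "n < m"
      from le[OF this] x y xy show False by (simp add: B_def)
    qed
    ultimately show ?thesis by simp
  qed
  have inj: "inj (\<lambda>m. A (k m))"
  proof (rule injI)
    fix m n assume eq: "A (k m) = A (k n)"
    obtain x where "x \<in> A (k m)" using A(2) by blast
    then have "x \<in> B m" "x \<in> B n" using AB eq by blast+
    then show "m = n" using sep by fastforce
  qed
  \<comment> \<open>The expansion has to be a function of the set, not of its index. By injectivity
    the union has just one term for each chosen set.\<close>
  define V where "V S = \<Union> (B ` {m. S = A (k m)})" for S
  have VA: "V (A (k m)) = B m" for m
    using inj by (auto simp: V_def inj_def)
  have opB: "openin X (B m)" for m
    unfolding B_def by (rule openin_preimage_real[OF cf]) simp
  have "strongly_discrete X (range (\<lambda>m. A (k m)))"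
    unfolding strongly_discrete_def
  proof (intro exI[of _ V] conjI ballI)
    fix F assume "F \<in> range (\<lambda>m. A (k m))"
    then obtain m where "F = A (k m)" by blast
    then show "openin X (V F)" "F \<subseteq> V F" using VA opB AB by simp_all
  next
    fix x assume x: "x \<in> topspace X"
    let ?N = "{y \<in> topspace X. f y \<in> {f x - 1/2 <..< f x + 1/2}}"
    have "openin X ?N" by (rule openin_preimage_real[OF cf]) simp
    then have "nbhd_in X x ?N" unfolding nbhd_in_def using x by (intro conjI exI[of _ ?N]) auto
    moreover have "F = G" if F: "F \<in> range (\<lambda>m. A (k m))" and G: "G \<in> range (\<lambda>m. A (k m))"
      and FN: "V F \<inter> ?N \<noteq> {}" and GN: "V G \<inter> ?N \<noteq> {}" for F G
    proof -
      obtain m n where mn: "F = A (k m)" "G = A (k n)" using F G by blast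
      obtain y z where "y \<in> B m" "y \<in> ?N" "z \<in> B n" "z \<in> ?N" using FN GN mn VA by auto
      moreover from calculation have "\<bar>f y - f z\<bar> < 1" by (simp add: abs_less_iff)
      ultimately show ?thesis using sep mn by metis
    qed
    ultimately show "\<exists>N. nbhd_in X x N \<and> (\<forall>F\<in>range (\<lambda>m. A (k m)). \<forall>G\<in>range (\<lambda>m. A (k m)).
            V F \<inter> N \<noteq> {} \<and> V G \<inter> N \<noteq> {} \<longrightarrow> F = G)"
      by (intro exI[of _ ?N]) simp
  qed
  moreover have "infinite (range (\<lambda>m. A (k m)))" using inj by (rule range_inj_infinite)
  ultimately show "\<exists>\<G>\<subseteq>\<F>. infinite \<G> \<and> strongly_discrete X \<G>"
    using A(1) by (intro exI[of _ "range (\<lambda>m. A (k m))"]) auto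
qed

section \<open>Diagonal functions and rational lattices\<close>

text \<open>A functional form of a strong G-delta property of the diagonal. The values 0 and 1 leave
  a gap that survives when the first argument is moved to a nearby point of a dense set.\<close>

definition diagonal_functions :: "'a topology \<Rightarrow> (nat \<Rightarrow> 'a \<Rightarrow> 'a \<Rightarrow> real) \<Rightarrow> bool"
  where "diagonal_functions X F \<longleftrightarrow>
    (\<forall>n. continuous_map (prod_topology X X) euclideanreal (\<lambda>p. F n (fst p) (snd p))) \<and>
    (\<forall>n. \<forall>x\<in>topspace X. F n x x = 0) \<and>
    (\<forall>x\<in>topspace X. \<forall>y\<in>topspace X. x \<noteq> y \<longrightarrow> (\<exists>n. F n x y = 1))"

text \<open>The square of X carries a stratification and is therefore normal, so there are Urysohn
  functions between the diagonal and the complement of each of its n-th neighborhoods. A point off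
  the diagonal is outside one of these neighborhoods.\<close>

lemma stratifiable_diagonal_functions:
  assumes X: "stratifiable X"
  shows "\<exists>F. diagonal_functions X F"
proof -
  let ?P = "prod_topology X X"
  obtain U where U: "stratification X U" using stratifiable_imp_stratification[OF X] by blast
  define V where "V = (\<lambda>z n. U (fst z) n \<times> U (snd z) n)"
  have V: "stratification ?P V" unfolding V_def by (rule stratification_prod[OF U U])
  have nP: "normal_space ?P" by (rule stratification_normal[OF V])
  define D where "D = (\<lambda>x. (x, x)) ` topspace X"
  have D: "closedin ?P D"
    using stratifiable_Hausdorff[OF X] unfolding Hausdorff_space_closedin_diagonal D_def .
  have DX: "D \<subseteq> topspace ?P" using D by (rule closedin_subset)
  define O' where "O' n = (\<Union>z\<in>D. V z n)" for n
  have O': "openin ?P (O' n)" for n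
    unfolding O'_def by (rule stratification_Union_open[OF V DX])
  have DO: "D \<subseteq> O' n" for n
    unfolding O'_def by (rule stratification_subset_Union[OF V DX])
  have "\<exists>f. continuous_map ?P euclideanreal f \<and> (\<forall>z\<in>D. f z = (0::real)) \<and> (\<forall>z\<in>topspace ?P - O' n. f z = 1)" for n
  proof -
    have "closedin ?P (topspace ?P - O' n)" using O' by blast
    moreover have "D \<inter> (topspace ?P - O' n) = {}" using DO by blast
    ultimately obtain f where "continuous_map ?P euclideanreal f"
      "\<And>z. z \<in> D \<Longrightarrow> f z = 0" "\<And>z. z \<in> topspace ?P - O' n \<Longrightarrow> f z = 1"
      using Urysohn_cutoff[OF nP D] by metis
    then show ?thesis by (intro exI[of _ f]) simp
  qed
  then obtain f where f: "\<And>n. continuous_map ?P euclideanreal (f n)" "\<And>n. \<forall>z\<in>D. f n z = (0::real)"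
    "\<And>n. \<forall>z\<in>topspace ?P - O' n. f n z = 1" by metis
  have "\<exists>n. f n (x, y) = 1" if xy: "x \<in> topspace X" "y \<in> topspace X" "x \<noteq> y" for x y
  proof -
    have "(x, y) \<in> topspace ?P" "(x, y) \<notin> D" using xy by (auto simp: D_def)
    then obtain n where n: "(x, y) \<notin> ?P closure_of (\<Union>z\<in>D. V z n)"
      using stratification_separate[OF V D] by metis
    have "O' n \<subseteq> ?P closure_of (O' n)" by (intro closure_of_subset openin_subset O')
    then have "(x, y) \<notin> O' n" using n by (auto simp: O'_def)
    then show ?thesis using f(3)[of n] xy by auto
  qed
  moreover have "f n (x, x) = 0" if "x \<in> topspace X" for n x
    using f(2)[of n] that by (simp add: D_def)
  ultimately have "diagonal_functions X (\<lambda>n x y. f n (x, y))"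
    using f(1) by (simp add: diagonal_functions_def)
  then show ?thesis by (intro exI[of _ "\<lambda>n x y. f n (x, y)"])
qed

lemma diagonal_functions_continuous:
  assumes F: "diagonal_functions X F" and q: "q \<in> topspace X"
  shows "continuous_map X euclideanreal (F n q)" "continuous_map X euclideanreal (\<lambda>y. F n y q)"
proof -
  let ?P = "prod_topology X X"
  have c: "continuous_map ?P euclideanreal (\<lambda>p. F n (fst p) (snd p))"
    using F by (simp add: diagonal_functions_def)
  have "continuous_map X ?P (\<lambda>y. (q, y))" using q by (simp add: continuous_map_pairwise o_def)
  from continuous_map_compose[OF this c] show "continuous_map X euclideanreal (F n q)"
    by (simp add: o_def)
  have "continuous_map X ?P (\<lambda>y. (y, q))" using q by (simp add: continuous_map_pairwise o_def)
  from continuous_map_compose[OF this c] show "continuous_map X euclideanreal (\<lambda>y. F n y q)"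
    by (simp add: o_def)
qed

lemma in_closure_ofD: "y \<in> X closure_of Q \<Longrightarrow> openin X T \<Longrightarrow> y \<in> T \<Longrightarrow> \<exists>q\<in>Q. q \<in> T"
  by (auto simp: in_closure_of)

definition diagonal_slices :: "(nat \<Rightarrow> 'a \<Rightarrow> 'a \<Rightarrow> real) \<Rightarrow> 'a set \<Rightarrow> ('a \<Rightarrow> real) set"
  where "diagonal_slices F Q = (\<lambda>(n, q). F n q) ` (UNIV \<times> Q)"

lemma diagonal_slices_continuous:
  assumes "diagonal_functions X F" "Q \<subseteq> topspace X" "\<phi> \<in> diagonal_slices F Q"
  shows "continuous_map X euclideanreal \<phi>"
proof -
  obtain n q where "q \<in> Q" "\<phi> = F n q" using assms(3) by (auto simp: diagonal_slices_def)
  then show ?thesis using diagonal_functions_continuous(1)[OF assms(1), of q n] assms(2) by auto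
qed

text \<open>For \<open>q = y\<close> some \<open>F n q\<close> is 1 at x and 0 at y. Both values
  depend continuously on q, so a point q of Q near y keeps them on different sides of 1/2.\<close>

lemma diagonal_slices_separate:
  assumes F: "diagonal_functions X F"
    and y: "y \<in> X closure_of Q" and x: "x \<in> topspace X" "x \<noteq> y"
  shows "\<exists>\<phi>\<in>diagonal_slices F Q. \<phi> x \<noteq> \<phi> y"
proof -
  have yX: "y \<in> topspace X" using y closure_of_subset_topspace by fast
  have "\<exists>n. F n y x = 1" using F yX x by (simp add: diagonal_functions_def)
  then obtain n where n: "F n y x = 1" ..
  have n0: "F n y y = 0" using F yX unfolding diagonal_functions_def by auto
  have cx: "continuous_map X euclideanreal (\<lambda>q. F n q x)"
    and cy: "continuous_map X euclideanreal (\<lambda>q. F n q y)"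
    by (rule diagonal_functions_continuous(2)[OF F x(1)], rule diagonal_functions_continuous(2)[OF F yX])
  let ?N = "{q \<in> topspace X. F n q x \<in> {1/2<..}} \<inter> {q \<in> topspace X. F n q y \<in> {..<1/2}}"
  have "openin X ?N"
    by (intro openin_Int openin_preimage_real cx cy open_greaterThan open_lessThan)
  moreover have "y \<in> ?N" using yX n n0 by simp
  ultimately have "\<exists>q\<in>Q. q \<in> ?N" by (rule in_closure_ofD[OF y])
  then obtain q where "q \<in> Q" "q \<in> ?N" ..
  then show ?thesis by (intro bexI[of _ "F n q"]) (auto simp: diagonal_slices_def)
qed

section \<open>A countable lattice version of the Stone-Weierstrass theorem\<close>

inductive_set rat_lattice :: "('a \<Rightarrow> real) set \<Rightarrow> ('a \<Rightarrow> real) set" for \<Phi> :: "('a \<Rightarrow> real) set"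
  where
    const: "a \<in> \<rat> \<Longrightarrow> (\<lambda>x. a) \<in> rat_lattice \<Phi>"
  | affine: "a \<in> \<rat> \<Longrightarrow> b \<in> \<rat> \<Longrightarrow> \<phi> \<in> \<Phi> \<Longrightarrow> (\<lambda>x. a + b * \<phi> x) \<in> rat_lattice \<Phi>"
  | max: "f \<in> rat_lattice \<Phi> \<Longrightarrow> g \<in> rat_lattice \<Phi> \<Longrightarrow> (\<lambda>x. max (f x) (g x)) \<in> rat_lattice \<Phi>"
  | min: "f \<in> rat_lattice \<Phi> \<Longrightarrow> g \<in> rat_lattice \<Phi> \<Longrightarrow> (\<lambda>x. min (f x) (g x)) \<in> rat_lattice \<Phi>"

lemma rat_lattice_mono:
  assumes "\<Phi> \<subseteq> \<Psi>" shows "rat_lattice \<Phi> \<subseteq> rat_lattice \<Psi>"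
proof
  fix f assume "f \<in> rat_lattice \<Phi>"
  then show "f \<in> rat_lattice \<Psi>"
    by induction (use assms in \<open>auto intro: rat_lattice.intros\<close>)
qed

lemma rat_lattice_continuous:
  assumes "f \<in> rat_lattice \<Phi>" "\<And>\<phi>. \<phi> \<in> \<Phi> \<Longrightarrow> continuous_map X euclideanreal \<phi>"
  shows "continuous_map X euclideanreal f"
  using assms(1)
proof induction
  case (affine a b \<phi>)
  then show ?case using assms(2)
    by (intro continuous_map_add continuous_map_real_mult) simp_all
qed (simp_all add: continuous_map_real_max continuous_map_real_min)

text \<open>An element of the lattice is built from finitely many generators, so it already appears
  at one stage of an increasing chain. This lets the closing-off process end after \<omega>
  steps.\<close>

lemma rat_lattice_chain:
  assumes "f \<in> rat_lattice (\<Union>t::nat. \<Phi> t)" and "mono \<Phi>"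
  shows "\<exists>t. f \<in> rat_lattice (\<Phi> t)"
  using assms(1)
proof induction
  case (const a)
  then show ?case by (auto intro: rat_lattice.const)
next
  case (affine a b \<phi>)
  then show ?case by (auto intro: rat_lattice.affine)
next
  case (max f g)
  then obtain s t where st: "f \<in> rat_lattice (\<Phi> s)" "g \<in> rat_lattice (\<Phi> t)" by blast
  have "\<Phi> s \<subseteq> \<Phi> (s + t)" "\<Phi> t \<subseteq> \<Phi> (s + t)" using assms(2) by (simp_all add: monoD)
  from this[THEN rat_lattice_mono] st have "f \<in> rat_lattice (\<Phi> (s + t))" "g \<in> rat_lattice (\<Phi> (s + t))"
    by auto
  then show ?case by (auto intro: rat_lattice.max)
next
  case (min f g)
  then obtain s t where st: "f \<in> rat_lattice (\<Phi> s)" "g \<in> rat_lattice (\<Phi> t)" by blast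
  have "\<Phi> s \<subseteq> \<Phi> (s + t)" "\<Phi> t \<subseteq> \<Phi> (s + t)" using assms(2) by (simp_all add: monoD)
  from this[THEN rat_lattice_mono] st have "f \<in> rat_lattice (\<Phi> (s + t))" "g \<in> rat_lattice (\<Phi> (s + t))"
    by auto
  then show ?case by (auto intro: rat_lattice.min)
qed

lemma countable_rat_lattice:
  assumes "countable \<Phi>"
  shows "countable (rat_lattice \<Phi>)"
proof -
  define S0 where "S0 = (\<lambda>a x. a) ` \<rat> \<union> (\<lambda>(a, b, \<phi>) x. a + b * \<phi> x) ` (\<rat> \<times> \<rat> \<times> \<Phi>)"
  define S where "S = rec_nat S0 (\<lambda>_ T. T \<union> (\<lambda>(f, g) x. max (f x) (g x)) ` (T \<times> T)
      \<union> (\<lambda>(f, g) x. min (f x) (g x)) ` (T \<times> T))"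
  have S_Suc: "S (Suc n) = S n \<union> (\<lambda>(f, g) x. max (f x) (g x)) ` (S n \<times> S n)
      \<union> (\<lambda>(f, g) x. min (f x) (g x)) ` (S n \<times> S n)" for n
    by (simp add: S_def)
  have "countable (S n)" for n
  proof (induction n)
    case 0
    have "S 0 = S0" by (simp add: S_def)
    then show ?case unfolding S0_def using assms by (simp add: countable_rat)
  next
    case (Suc n)
    then show ?case unfolding S_Suc by simp
  qed
  moreover have "rat_lattice \<Phi> \<subseteq> (\<Union>n. S n)"
  proof
    fix f assume "f \<in> rat_lattice \<Phi>"
    then have "\<exists>n. f \<in> S n"
    proof induction
      case (const a)
      then show ?case by (intro exI[of _ 0]) (auto simp: S_def S0_def)
    next
      case (affine a b \<phi>)
      then show ?case by (intro exI[of _ 0]) (force simp: S_def S0_def)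
    next
      case (max f g)
      then obtain s t where st: "f \<in> S s" "g \<in> S t" by blast
      have "mono S" unfolding mono_iff_le_Suc by (auto simp: S_Suc)
      then have "S s \<subseteq> S (s + t)" "S t \<subseteq> S (s + t)" by (simp_all add: monoD)
      then have "f \<in> S (s + t)" "g \<in> S (s + t)" using st by auto
      then show ?case by (intro exI[of _ "Suc (s + t)"]) (force simp: S_Suc)
    next
      case (min f g)
      then obtain s t where st: "f \<in> S s" "g \<in> S t" by blast
      have "mono S" unfolding mono_iff_le_Suc by (auto simp: S_Suc)
      then have "S s \<subseteq> S (s + t)" "S t \<subseteq> S (s + t)" by (simp_all add: monoD)
      then have "f \<in> S (s + t)" "g \<in> S (s + t)" using st by auto
      then show ?case by (intro exI[of _ "Suc (s + t)"]) (force simp: S_Suc)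
    qed
    then show "f \<in> (\<Union>n. S n)" by blast
  qed
  ultimately show ?thesis by (meson countable_UN countable_subset countableI_type)
qed

lemma rat_lattice_Max:
  assumes "finite T" "T \<noteq> {}" "\<And>t. t \<in> T \<Longrightarrow> g t \<in> rat_lattice \<Phi>"
  shows "\<exists>f\<in>rat_lattice \<Phi>. \<forall>x. (\<forall>t\<in>T. g t x \<le> f x) \<and> (\<exists>t\<in>T. f x = g t x)"
  using assms
proof (induction T rule: finite_ne_induct)
  case (singleton t)
  then show ?case by auto
next
  case (insert t T)
  then obtain f where f: "f \<in> rat_lattice \<Phi>" "\<And>x. (\<forall>t\<in>T. g t x \<le> f x) \<and> (\<exists>t\<in>T. f x = g t x)"
    by auto
  have "(\<lambda>x. max (g t x) (f x)) \<in> rat_lattice \<Phi>" using f(1) insert by (auto intro: rat_lattice.max)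
  moreover have "(\<forall>s\<in>insert t T. g s x \<le> max (g t x) (f x)) \<and> (\<exists>s\<in>insert t T. max (g t x) (f x) = g s x)" for x
    using f(2)[of x] by (auto simp: max_def)
  ultimately show ?case by (intro bexI[of _ "\<lambda>x. max (g t x) (f x)"]) simp_all
qed

lemma rat_lattice_Min:
  assumes "finite T" "T \<noteq> {}" "\<And>t. t \<in> T \<Longrightarrow> g t \<in> rat_lattice \<Phi>"
  shows "\<exists>f\<in>rat_lattice \<Phi>. \<forall>x. (\<forall>t\<in>T. f x \<le> g t x) \<and> (\<exists>t\<in>T. f x = g t x)"
  using assms
proof (induction T rule: finite_ne_induct)
  case (singleton t)
  then show ?case by auto
next
  case (insert t T)
  then obtain f where f: "f \<in> rat_lattice \<Phi>" "\<And>x. (\<forall>t\<in>T. f x \<le> g t x) \<and> (\<exists>t\<in>T. f x = g t x)"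
    by auto
  have "(\<lambda>x. min (g t x) (f x)) \<in> rat_lattice \<Phi>" using f(1) insert by (auto intro: rat_lattice.min)
  moreover have "(\<forall>s\<in>insert t T. min (g t x) (f x) \<le> g s x) \<and> (\<exists>s\<in>insert t T. min (g t x) (f x) = g s x)" for x
    using f(2)[of x] by (auto simp: min_def)
  ultimately show ?case by (intro bexI[of _ "\<lambda>x. min (g t x) (f x)"]) simp_all
qed

lemma Rats_near:
  fixes r e :: real
  assumes "e > 0" obtains q where "q \<in> \<rat>" "\<bar>q - r\<bar> < e"
proof -
  obtain q where "q \<in> \<rat>" "r - e < q" "q < r + e"
    using Rats_dense_in_real[of "r - e" "r + e"] assms by auto
  then show ?thesis using that[of q] by (simp add: abs_less_iff)
qed

text \<open>A real affine function of one separating \<phi> takes the two values exactly. Its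
  coefficients are then moved to rationals; the precision of the slope is divided by
  \<open>s\<close>, which bounds \<phi> at both points.\<close>

lemma rat_lattice_interpolate:
  fixes w :: "'a \<Rightarrow> real"
  assumes sep: "w x \<noteq> w y \<Longrightarrow> \<exists>\<phi>\<in>\<Phi>. \<phi> x \<noteq> \<phi> y" and e: "e > 0"
  shows "\<exists>f\<in>rat_lattice \<Phi>. \<bar>f x - w x\<bar> < e \<and> \<bar>f y - w y\<bar> < e"
proof (cases "w x = w y")
  case True
  obtain q where "q \<in> \<rat>" "\<bar>q - w x\<bar> < e" using Rats_near[OF e] by blast
  then show ?thesis using True by (intro bexI[of _ "\<lambda>_. q"]) (auto intro: rat_lattice.const)
next
  case False
  then obtain \<phi> where \<phi>: "\<phi> \<in> \<Phi>" "\<phi> x \<noteq> \<phi> y" using sep by blast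
  define b0 where "b0 = (w x - w y) / (\<phi> x - \<phi> y)"
  define a0 where "a0 = w x - b0 * \<phi> x"
  have wx: "w x = a0 + b0 * \<phi> x" by (simp add: a0_def)
  have "b0 * (\<phi> x - \<phi> y) = w x - w y" using \<phi> by (simp add: b0_def)
  then have wy: "w y = a0 + b0 * \<phi> y" by (simp add: a0_def algebra_simps)
  define s where "s = \<bar>\<phi> x\<bar> + \<bar>\<phi> y\<bar> + 1"
  have s: "s > 0" unfolding s_def by linarith
  obtain a where a: "a \<in> \<rat>" "\<bar>a - a0\<bar> < e/2" using Rats_near[of "e/2"] e by auto
  obtain b where b: "b \<in> \<rat>" "\<bar>b - b0\<bar> < e/2/s" using Rats_near[of "e/2/s"] e s by auto
  have *: "\<bar>(a + b * t) - (a0 + b0 * t)\<bar> < e" if "\<bar>t\<bar> \<le> s" for t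
  proof -
    have "\<bar>(b - b0) * t\<bar> \<le> (e/2/s) * s"
      unfolding abs_mult using b(2) that by (intro mult_mono) auto
    also have "\<dots> = e/2" using s by simp
    finally have "\<bar>(b - b0) * t\<bar> \<le> e/2" .
    moreover have "(a + b * t) - (a0 + b0 * t) = (a - a0) + (b - b0) * t" by (simp add: algebra_simps)
    ultimately show ?thesis using a(2) by linarith
  qed
  have "\<bar>\<phi> x\<bar> \<le> s" "\<bar>\<phi> y\<bar> \<le> s" by (simp_all add: s_def)
  from this[THEN *] wx wy show ?thesis
    by (intro bexI[of _ "\<lambda>x. a + b * \<phi> x"] rat_lattice.affine a b \<phi>) simp
qed

text \<open>The Kakutani-Stone argument: for fixed y a finite minimum of two-point interpolants is
  below \<open>w + e\<close> on M and above \<open>w y - e\<close> at y, and a finite maximum over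
  such y is then within \<open>e\<close> of \<open>w\<close>. Separation is asked only where
  \<open>w\<close> differs, so \<open>w\<close> may be constant on a part of M whose points the
  generators do not separate.\<close>

lemma rat_lattice_approx:
  assumes M: "compactin X M" and \<Phi>: "\<And>\<phi>. \<phi> \<in> \<Phi> \<Longrightarrow> continuous_map X euclideanreal \<phi>"
    and w: "continuous_map X euclideanreal w" and e: "e > 0"
    and sep: "\<And>x y. x \<in> M \<Longrightarrow> y \<in> M \<Longrightarrow> w x \<noteq> w y \<Longrightarrow> \<exists>\<phi>\<in>\<Phi>. \<phi> x \<noteq> \<phi> y"
  shows "\<exists>f\<in>rat_lattice \<Phi>. \<forall>x\<in>M. \<bar>f x - w x\<bar> < e"
proof (cases "M = {}")
  case True
  then show ?thesis using rat_lattice.const[of 0 \<Phi>] by auto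
next
  case False
  have MX: "M \<subseteq> topspace X" using M by (rule compactin_subset_topspace)
  have cd: "continuous_map X euclideanreal (\<lambda>z. f z - w z)" if "f \<in> rat_lattice \<Phi>" for f
    by (intro continuous_map_diff w rat_lattice_continuous[OF that \<Phi>])
  have lower: "\<exists>f\<in>rat_lattice \<Phi>. (\<forall>x\<in>M. f x < w x + e) \<and> f y > w y - e" if y: "y \<in> M" for y
  proof -
    have "\<exists>f. f \<in> rat_lattice \<Phi> \<and> \<bar>f x - w x\<bar> < e \<and> \<bar>f y - w y\<bar> < e" if "x \<in> M" for x
      using rat_lattice_interpolate[of w x y \<Phi> e] sep[OF that y] e by blast
    then obtain g where g: "\<And>x. x \<in> M \<Longrightarrow> g x \<in> rat_lattice \<Phi>"
      "\<And>x. x \<in> M \<Longrightarrow> \<bar>g x x - w x\<bar> < e" "\<And>x. x \<in> M \<Longrightarrow> \<bar>g x y - w y\<bar> < e" by metis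
    define N where "N x = {z \<in> topspace X. g x z - w z \<in> {..<e}}" for x
    have N: "openin X (N x)" if "x \<in> M" for x
      unfolding N_def by (intro openin_preimage_real cd g that) simp
    have "M \<subseteq> \<Union>(N ` M)"
    proof
      fix x assume "x \<in> M"
      then have "x \<in> N x" using g(2)[of x] MX by (auto simp: N_def)
      then show "x \<in> \<Union>(N ` M)" using \<open>x \<in> M\<close> by blast
    qed
    then obtain \<C> where C: "finite \<C>" "\<C> \<subseteq> N ` M" "M \<subseteq> \<Union>\<C>"
      using compactinD[OF M, of "N ` M"] N by auto
    then obtain T where T: "finite T" "T \<subseteq> M" "\<C> = N ` T" by (meson finite_subset_image)
    have "T \<noteq> {}" using C T False by auto
    moreover have "\<And>t. t \<in> T \<Longrightarrow> g t \<in> rat_lattice \<Phi>" using g T by blast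
    ultimately obtain f where f: "f \<in> rat_lattice \<Phi>"
      "\<And>x. (\<forall>t\<in>T. f x \<le> g t x) \<and> (\<exists>t\<in>T. f x = g t x)"
      using rat_lattice_Min[OF T(1)] by metis
    have "f x < w x + e" if xM: "x \<in> M" for x
    proof -
      obtain t where "t \<in> T" "x \<in> N t" using C(3) T(3) xM by auto
      then show ?thesis using f(2)[of x] by (fastforce simp: N_def)
    qed
    moreover have "f y > w y - e"
    proof -
      obtain t where t: "t \<in> T" "f y = g t y" using f(2)[of y] by auto
      then have "\<bar>g t y - w y\<bar> < e" using g(3) T by auto
      then show ?thesis using t by (simp add: abs_less_iff)
    qed
    ultimately show ?thesis using f(1) by blast
  qed
  then obtain g where g: "\<And>y. y \<in> M \<Longrightarrow> g y \<in> rat_lattice \<Phi>"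
    "\<And>y. y \<in> M \<Longrightarrow> (\<forall>x\<in>M. g y x < w x + e)" "\<And>y. y \<in> M \<Longrightarrow> g y y > w y - e" by metis
  define N where "N y = {z \<in> topspace X. g y z - w z \<in> {-e<..}}" for y
  have N: "openin X (N y)" if "y \<in> M" for y
    unfolding N_def by (intro openin_preimage_real cd g that) simp
  have "M \<subseteq> \<Union>(N ` M)"
  proof
    fix x assume "x \<in> M"
    then have "x \<in> N x" using g(3)[of x] MX by (auto simp: N_def)
    then show "x \<in> \<Union>(N ` M)" using \<open>x \<in> M\<close> by blast
  qed
  then obtain \<C> where C: "finite \<C>" "\<C> \<subseteq> N ` M" "M \<subseteq> \<Union>\<C>"
    using compactinD[OF M, of "N ` M"] N by auto
  then obtain T where T: "finite T" "T \<subseteq> M" "\<C> = N ` T" by (meson finite_subset_image)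
  have "T \<noteq> {}" using C T False by auto
  moreover have "\<And>t. t \<in> T \<Longrightarrow> g t \<in> rat_lattice \<Phi>" using g T by blast
  ultimately obtain f where f: "f \<in> rat_lattice \<Phi>"
    "\<And>x. (\<forall>t\<in>T. g t x \<le> f x) \<and> (\<exists>t\<in>T. f x = g t x)"
    using rat_lattice_Max[OF T(1)] by metis
  have "\<bar>f x - w x\<bar> < e" if xM: "x \<in> M" for x
  proof -
    obtain t where t: "t \<in> T" "x \<in> N t" using C(3) T(3) xM by auto
    then have 1: "f x > w x - e" using f(2)[of x] by (fastforce simp: N_def)
    obtain s where "s \<in> T" "f x = g s x" using f(2)[of x] by auto
    then have "f x < w x + e" using g(2) T(2) xM by auto
    then show ?thesis using 1 by (simp add: abs_less_iff)
  qed
  then show ?thesis using f(1) by blast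
qed

section \<open>Reduction to separable subspaces\<close>

text \<open>D collects the centers of finite covers of K by n-th neighborhoods, for all n. If x in K
  were outside the closure of D, some n-th neighborhood of that closure would miss x, although the
  centers of stage n cover x.\<close>

lemma stratification_compactin_separable:
  assumes U: "stratification X U" and K: "compactin X K"
  shows "\<exists>D. countable D \<and> D \<subseteq> K \<and> K \<subseteq> X closure_of D"
proof -
  have KX: "K \<subseteq> topspace X" using K by (rule compactin_subset_topspace)
  have "\<exists>Y. finite Y \<and> Y \<subseteq> K \<and> K \<subseteq> (\<Union>y\<in>Y. U y n)" for n
  proof -
    have "\<And>S. S \<in> (\<lambda>y. U y n) ` K \<Longrightarrow> openin X S" using stratification_open[OF U] KX by auto
    then obtain \<C> where C: "finite \<C>" "\<C> \<subseteq> (\<lambda>y. U y n) ` K" "K \<subseteq> \<Union>\<C>"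
      using compactinD[OF K _ stratification_subset_Union[OF U KX, of n]] by auto
    then obtain Y where "finite Y" "Y \<subseteq> K" "\<C> = (\<lambda>y. U y n) ` Y" by (meson finite_subset_image)
    then show ?thesis using C by (intro exI[of _ Y]) auto
  qed
  then have "\<exists>Y. \<forall>n. finite (Y n) \<and> Y n \<subseteq> K \<and> K \<subseteq> (\<Union>y\<in>Y n. U y n)" by (intro choice allI)
  then obtain Y where "\<forall>n. finite (Y n) \<and> Y n \<subseteq> K \<and> K \<subseteq> (\<Union>y\<in>Y n. U y n)" ..
  then have Y: "\<And>n. finite (Y n)" "\<And>n. Y n \<subseteq> K" "\<And>n. K \<subseteq> (\<Union>y\<in>Y n. U y n)" by simp_all
  define D where "D = (\<Union>n. Y n)"
  have D: "countable D" "D \<subseteq> K" using Y by (auto simp: D_def countable_finite)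
  have "x \<in> X closure_of D" if x: "x \<in> K" for x
  proof (rule ccontr)
    assume "x \<notin> X closure_of D"
    then obtain n where n: "x \<notin> X closure_of (\<Union>y\<in>X closure_of D. U y n)"
      using stratification_separate[OF U closedin_closure_of, of x D] x KX by auto
    have DD: "D \<subseteq> X closure_of D" using D KX by (intro closure_of_subset) auto
    obtain y where y: "y \<in> Y n" "x \<in> U y n" using Y(3)[of n] x by auto
    have "y \<in> X closure_of D" using y(1) DD by (auto simp: D_def)
    then have "x \<in> (\<Union>y\<in>X closure_of D. U y n)" using y(2) by blast
    moreover have "(\<Union>y\<in>X closure_of D. U y n) \<subseteq> X closure_of (\<Union>y\<in>X closure_of D. U y n)"
      by (intro closure_of_subset openin_subset stratification_Union_open[OF U] closure_of_subset_topspace)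
    ultimately show False using n by auto
  qed
  then show ?thesis using D by blast
qed

lemma diagonal_slices_mono: "Q \<subseteq> R \<Longrightarrow> diagonal_slices F Q \<subseteq> diagonal_slices F R"
  by (auto simp: diagonal_slices_def)

lemma countable_diagonal_slices: "countable Q \<Longrightarrow> countable (diagonal_slices F Q)"
  by (simp add: diagonal_slices_def)

text \<open>A Loewenheim-Skolem argument: the countable answers H to all pairs of functions from the
  countable lattice over the current set are added, and this is iterated. The union is closed since
  any two lattice functions over it already live at a common finite stage.\<close>

lemma closing_off:
  fixes H :: "nat \<Rightarrow> nat \<Rightarrow> ('a \<Rightarrow> real) \<Rightarrow> ('a \<Rightarrow> real) \<Rightarrow> 'a set"
  assumes Q0: "countable Q0" "Q0 \<subseteq> T" and H: "\<And>n k \<psi> \<theta>. countable (H n k \<psi> \<theta>)" "\<And>n k \<psi> \<theta>. H n k \<psi> \<theta> \<subseteq> T"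
  obtains Q where "countable Q" "Q0 \<subseteq> Q" "Q \<subseteq> T"
    "\<And>n k \<psi> \<theta>. \<psi> \<in> rat_lattice (diagonal_slices F Q) \<Longrightarrow> \<theta> \<in> rat_lattice (diagonal_slices F Q) \<Longrightarrow>
      H n k \<psi> \<theta> \<subseteq> Q"
proof -
  define L where "L Q = rat_lattice (diagonal_slices F Q)" for Q
  define N where "N Q = (\<Union>\<psi>\<in>L Q. \<Union>\<theta>\<in>L Q. \<Union>n. \<Union>k. H n k \<psi> \<theta>)" for Q
  define S where "S = rec_nat Q0 (\<lambda>_ Q. Q \<union> N Q)"
  have S0: "S 0 = Q0" and SS: "S (Suc t) = S t \<union> N (S t)" for t by (simp_all add: S_def)
  have cS: "countable (S t) \<and> S t \<subseteq> T" for t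
  proof (induction t)
    case 0
    then show ?case using Q0 by (simp add: S0)
  next
    case (Suc t)
    have "countable (L (S t))"
      unfolding L_def using Suc by (intro countable_rat_lattice countable_diagonal_slices) simp
    then have "countable (N (S t))" unfolding N_def using H(1) by (intro countable_UN) auto
    moreover have "N (S t) \<subseteq> T" unfolding N_def using H(2) by (intro UN_least)
    ultimately show ?case using Suc by (simp add: SS)
  qed
  have mS: "mono S" unfolding mono_iff_le_Suc by (simp add: SS)
  define Q where "Q = (\<Union>t. S t)"
  have chain: "\<exists>t. \<psi> \<in> L (S t)" if "\<psi> \<in> L Q" for \<psi>
  proof -
    have "diagonal_slices F Q = (\<Union>t. diagonal_slices F (S t))"
      by (auto simp: diagonal_slices_def Q_def)
    moreover have "mono (\<lambda>t. diagonal_slices F (S t))"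
      using mS by (intro monoI diagonal_slices_mono) (auto dest: monoD)
    ultimately show ?thesis
      using that rat_lattice_chain[of \<psi> "\<lambda>t. diagonal_slices F (S t)"] by (simp add: L_def)
  qed
  have LS: "L (S s) \<subseteq> L (S t)" if "s \<le> t" for s t
    unfolding L_def by (intro rat_lattice_mono diagonal_slices_mono monoD[OF mS that])
  have "H n k \<psi> \<theta> \<subseteq> Q" if pt: "\<psi> \<in> L Q" "\<theta> \<in> L Q" for n k \<psi> \<theta>
  proof -
    obtain s t where "\<psi> \<in> L (S s)" "\<theta> \<in> L (S t)" using chain[OF pt(1)] chain[OF pt(2)] by auto
    then have "\<psi> \<in> L (S (s + t))" "\<theta> \<in> L (S (s + t))" using LS[of s "s+t"] LS[of t "s+t"] by auto
    then have "H n k \<psi> \<theta> \<subseteq> S (Suc (s + t))" unfolding SS N_def by blast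
    then show ?thesis unfolding Q_def by blast
  qed
  moreover have "countable Q" "Q0 \<subseteq> Q" "Q \<subseteq> T"
    using cS S0 by (auto simp: Q_def)
  ultimately show ?thesis using that[of Q] by (simp add: L_def)
qed

text \<open>A countable version of the chain condition: if two conditions \<^term>\<open>Cball X f K e\<close> and
  \<^term>\<open>Cball X f' K' e\<close> satisfy the predicate \<open>P\<close> below for the same lattice functions
  \<open>\<psi>\<close> and \<open>\<theta>\<close>, \<^term>\<open>K'\<close> lies in the closure of \<^term>\<open>Q\<close>, and \<open>\<theta>\<close> is below 1/2 on the
  intersection of \<^term>\<open>K\<close> with that closure, then they are compatible.\<close>

lemma countable_predense:
  fixes W :: "nat \<Rightarrow> ('a \<Rightarrow> real) set"
  assumes X: "stratifiable X" and W: "\<And>n. openin (Ck X) (W n)" "\<And>n. Ck_dense X (W n)"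
    and K0: "compactin X K0"
  obtains Q where "countable Q" "Q \<subseteq> topspace X" "K0 \<subseteq> X closure_of Q"
    "\<And>n f K e. f \<in> C_carrier X \<Longrightarrow> compactin X K \<Longrightarrow> e > 0 \<Longrightarrow>
      \<exists>f' K' k. f' \<in> C_carrier X \<and> compactin X K' \<and> K' \<subseteq> X closure_of Q \<and>
        Cball X f' K' (1 / Suc k) \<subseteq> W n \<and> (\<exists>h. h \<in> Cball X f K e \<and> h \<in> Cball X f' K' (1 / Suc k))"
proof -
  obtain U where U: "stratification X U" using stratifiable_imp_stratification[OF X] by blast
  obtain F where F: "diagonal_functions X F" using stratifiable_diagonal_functions[OF X] by blast
  have nX: "normal_space X" and hX: "Hausdorff_space X"
    using X by (simp_all add: stratifiable_normal stratifiable_Hausdorff)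
  have "\<forall>K. \<exists>D. compactin X K \<longrightarrow> countable D \<and> D \<subseteq> K \<and> K \<subseteq> X closure_of D"
    using stratification_compactin_separable[OF U] by blast
  then obtain D where D: "\<And>K. compactin X K \<Longrightarrow> countable (D K) \<and> D K \<subseteq> K \<and> K \<subseteq> X closure_of (D K)"
    using choice[of "\<lambda>K D. compactin X K \<longrightarrow> countable D \<and> D \<subseteq> K \<and> K \<subseteq> X closure_of D"] by auto
  \<comment> \<open>The pair \<open>\<psi>\<close>, \<open>\<theta>\<close> is a code for a
    condition: \<open>\<psi>\<close> records its values and \<open>\<theta>\<close> masks the points
    where it does not. One condition is kept per code, and a countable dense part of its compact set
    is the answer \<open>H\<close> fed into Q.\<close>
  define P where "P n k \<psi> \<theta> fK \<longleftrightarrow> fst fK \<in> C_carrier X \<and> compactin X (snd fK) \<and>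
      Cball X (fst fK) (snd fK) (1 / Suc k) \<subseteq> W n \<and>
      (\<forall>x\<in>snd fK. \<theta> x < 1/2 \<longrightarrow> \<bar>fst fK x - \<psi> x\<bar> < 1 / Suc k / 8)"
    for n and k :: nat and \<psi> \<theta> :: "'a \<Rightarrow> real" and fK :: "('a \<Rightarrow> real) \<times> 'a set"
  define A where "A n k \<psi> \<theta> = (SOME fK. P n k \<psi> \<theta> fK)" for n k \<psi> \<theta>
  define H where "H n k \<psi> \<theta> = (if \<exists>fK. P n k \<psi> \<theta> fK then D (snd (A n k \<psi> \<theta>)) else {})" for n k \<psi> \<theta>
  have PA: "P n k \<psi> \<theta> (A n k \<psi> \<theta>)" if "\<exists>fK. P n k \<psi> \<theta> fK" for n k \<psi> \<theta>
    unfolding A_def using that by (rule someI_ex)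
  have cA: "compactin X (snd (A n k \<psi> \<theta>))" if "\<exists>fK. P n k \<psi> \<theta> fK" for n k \<psi> \<theta>
    using PA[OF that] by (simp add: P_def)
  have H1: "countable (H n k \<psi> \<theta>)" for n k \<psi> \<theta>
    using D[OF cA] by (auto simp: H_def)
  have H2: "H n k \<psi> \<theta> \<subseteq> topspace X" for n k \<psi> \<theta>
  proof (cases "\<exists>fK. P n k \<psi> \<theta> fK")
    case True
    then show ?thesis using D[OF cA[OF True]] compactin_subset_topspace[OF cA[OF True]]
      by (auto simp: H_def)
  qed (simp add: H_def)
  have DK0: "countable (D K0)" "D K0 \<subseteq> topspace X"
    using D[OF K0] compactin_subset_topspace[OF K0] by auto
  obtain Q where Q: "countable Q" "D K0 \<subseteq> Q" "Q \<subseteq> topspace X"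
    and cl: "\<And>n k \<psi> \<theta>. \<psi> \<in> rat_lattice (diagonal_slices F Q) \<Longrightarrow> \<theta> \<in> rat_lattice (diagonal_slices F Q) \<Longrightarrow>
      H n k \<psi> \<theta> \<subseteq> Q"
    by (rule closing_off[of "D K0" "topspace X" H F, OF DK0 H1 H2]) metis
  let ?Y = "X closure_of Q"
  let ?\<Phi> = "diagonal_slices F Q"
  have \<Phi>: "\<And>\<phi>. \<phi> \<in> ?\<Phi> \<Longrightarrow> continuous_map X euclideanreal \<phi>"
    by (rule diagonal_slices_continuous[OF F Q(3)])
  have sep: "\<exists>\<phi>\<in>?\<Phi>. \<phi> x \<noteq> \<phi> y" if "x \<in> topspace X" "y \<in> topspace X" "x \<noteq> y" "x \<in> ?Y \<or> y \<in> ?Y" for x y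
  proof (cases "y \<in> ?Y")
    case True
    show ?thesis by (rule diagonal_slices_separate[OF F True that(1,3)])
  next
    case False
    then have "x \<in> ?Y" using that(4) by simp
    from diagonal_slices_separate[OF F this that(2)] that(3) show ?thesis by metis
  qed
  have "K0 \<subseteq> ?Y" using D[OF K0] closure_of_mono[OF Q(2), of X] by auto
  moreover have "\<exists>f' K' k. f' \<in> C_carrier X \<and> compactin X K' \<and> K' \<subseteq> ?Y \<and>
        Cball X f' K' (1 / Suc k) \<subseteq> W n \<and> (\<exists>h. h \<in> Cball X f K e \<and> h \<in> Cball X f' K' (1 / Suc k))"
    if f: "f \<in> C_carrier X" and K: "compactin X K" and e: "e > 0" for n f K e
  proof -
    obtain g where g: "g \<in> W n" "g \<in> Cball X f K e" using Ck_denseD[OF W(2) f K e] by blast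
    have "openin (Ck X) (W n \<inter> Cball X f K e)" by (intro openin_Int W openin_Cball f K e)
    moreover have "g \<in> W n \<inter> Cball X f K e" using g by simp
    ultimately have "\<exists>K1 e1. compactin X K1 \<and> e1 > 0 \<and> Cball X g K1 e1 \<subseteq> W n \<inter> Cball X f K e"
      unfolding openin_Ck_iff by metis
    then obtain K1 e1 where K1: "compactin X K1" "e1 > 0" "Cball X g K1 e1 \<subseteq> W n \<inter> Cball X f K e"
      by (elim exE conjE)
    obtain k where k: "1 / Suc k < e1" using nat_approx_posE[OF K1(2)] by blast
    define r :: real where "r = 1 / Suc k"
    have r: "r > 0" "r < e1" using k by (simp_all add: r_def)
    have "Cball X g K1 r \<subseteq> Cball X g K1 e1" using r by (fastforce simp: Cball_iff)
    then have gr: "Cball X g K1 r \<subseteq> W n" "Cball X g K1 r \<subseteq> Cball X f K e" using K1(3) by auto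
    have gC: "g \<in> C_carrier X" using g by (simp add: Cball_iff)
    have K1X: "K1 \<subseteq> topspace X" by (rule compactin_subset_topspace[OF K1(1)])
    define M where "M = K1 \<inter> ?Y"
    have M: "compactin X M" unfolding M_def by (rule compact_Int_closedin[OF K1(1) closedin_closure_of])
    have MY: "M \<subseteq> ?Y" "M \<subseteq> topspace X" using K1X by (auto simp: M_def)
    have "\<exists>\<psi>\<in>rat_lattice ?\<Phi>. \<forall>x\<in>M. \<bar>\<psi> x - g x\<bar> < r/16"
    proof (rule rat_lattice_approx[OF M \<Phi> C_carrier_cont[OF gC]])
      show "\<exists>\<phi>\<in>?\<Phi>. \<phi> x \<noteq> \<phi> y" if "x \<in> M" "y \<in> M" "g x \<noteq> g y" for x y
        using sep[of x y] that MY by auto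
    qed (use r in auto)
    then obtain \<psi> where \<psi>: "\<psi> \<in> rat_lattice ?\<Phi>" "\<And>x. x \<in> M \<Longrightarrow> \<bar>\<psi> x - g x\<bar> < r/16" by blast
    \<comment> \<open>\<open>\<psi>\<close> approximates \<open>g\<close> on M, while G is the part
      of K1 where it fails. The mask \<open>\<theta>\<close> is built to be below 1/2 on M and above
      1/2 on G, so that the code claims nothing about G.\<close>
    define G where "G = {x \<in> K1. r/8 \<le> \<bar>g x - \<psi> x\<bar>}"
    have G: "compactin X G" unfolding G_def
      by (intro compactin_abs_ge continuous_map_diff C_carrier_cont gC rat_lattice_continuous[OF \<psi>(1) \<Phi>] K1)
    have "\<bar>g x - \<psi> x\<bar> < r/8" if "x \<in> M" for x using \<psi>(2)[OF that] r by linarith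
    then have MG: "M \<inter> G = {}" by (fastforce simp: G_def)
    obtain w where w: "continuous_map X euclideanreal w" "\<And>x. x \<in> M \<Longrightarrow> w x = 0" "\<And>x. x \<in> G \<Longrightarrow> w x = 1"
      using Urysohn_cutoff[OF nX _ _ MG] M G compactin_imp_closedin[OF hX] by metis
    have "\<exists>\<theta>\<in>rat_lattice ?\<Phi>. \<forall>x\<in>M \<union> G. \<bar>\<theta> x - w x\<bar> < 1/2"
    proof (rule rat_lattice_approx[OF compactin_Un[OF M G] \<Phi> w(1)])
      fix x y assume xy: "x \<in> M \<union> G" "y \<in> M \<union> G" "w x \<noteq> w y"
      \<comment> \<open>\<open>w\<close> is 1 on G, so two points with different values of
        \<open>w\<close> cannot both lie in G. One of them is in M, hence in the closure of Q, where
        the slices separate.\<close>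
      then have "x \<in> M \<or> y \<in> M" using w(3) by force
      moreover have "x \<in> topspace X" "y \<in> topspace X" using xy MY K1X by (auto simp: G_def)
      moreover have "x \<noteq> y" using xy by blast
      ultimately show "\<exists>\<phi>\<in>?\<Phi>. \<phi> x \<noteq> \<phi> y" using sep[of x y] MY by auto
    qed auto
    then obtain \<theta> where \<theta>: "\<theta> \<in> rat_lattice ?\<Phi>" "\<And>x. x \<in> M \<union> G \<Longrightarrow> \<bar>\<theta> x - w x\<bar> < 1/2" by blast
    have "P n k \<psi> \<theta> (g, K1)"
      unfolding P_def fst_conv snd_conv r_def[symmetric]
    proof (intro conjI ballI impI gC K1(1) gr(1))
      fix x assume x: "x \<in> K1" "\<theta> x < 1/2"
      have "x \<notin> G"
      proof
        assume "x \<in> G"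
        then show False using \<theta>(2)[of x] w(3)[of x] x(2) by simp
      qed
      then show "\<bar>g x - \<psi> x\<bar> < r/8" using x(1) by (simp add: G_def)
    qed
    then have exP: "\<exists>fK. P n k \<psi> \<theta> fK" by blast
    obtain f' K' where A: "A n k \<psi> \<theta> = (f', K')" by (cases "A n k \<psi> \<theta>")
    have "P n k \<psi> \<theta> (f', K')" using PA[OF exP] A by simp
    then have f': "f' \<in> C_carrier X" "compactin X K'" "Cball X f' K' r \<subseteq> W n"
      "\<And>x. x \<in> K' \<Longrightarrow> \<theta> x < 1/2 \<Longrightarrow> \<bar>f' x - \<psi> x\<bar> < r/8" by (simp_all add: P_def r_def)
    have "D K' \<subseteq> Q" using cl[OF \<psi>(1) \<theta>(1), of n k] exP A by (simp add: H_def)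
    then have K'Y: "K' \<subseteq> ?Y" using D[OF f'(2)] closure_of_mono[of "D K'" Q X] by auto
    \<comment> \<open>The kept condition has its compact set in the closure of Q, so a common point
      of K1 and K' lies in M. There the mask is off and both functions are close to
      \<open>\<psi>\<close>.\<close>
    have "\<bar>f' x - g x\<bar> < r" if "x \<in> K1" "x \<in> K'" for x
    proof -
      have xM: "x \<in> M" using that K'Y by (auto simp: M_def)
      then have "\<theta> x < 1/2" using \<theta>(2)[of x] w(2)[of x] by simp
      then show ?thesis using f'(4)[OF that(2)] \<psi>(2)[OF xM] r by linarith
    qed
    then obtain h where h: "h \<in> Cball X g K1 r" "\<And>x. x \<in> K' \<Longrightarrow> h x = f' x"
      using Ck_extend[OF nX hX compactin_imp_closedin[OF hX f'(2)] gC
          continuous_map_from_subtopology[OF C_carrier_cont[OF f'(1)]] K1(1) r(1)] by metis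
    have "h \<in> Cball X f' K' r" using h r by (simp add: Cball_iff)
    then show ?thesis using f'(1-3) K'Y h(1) gr(2)
      by (intro exI[of _ f'] exI[of _ K'] exI[of _ k]) (auto simp: r_def)
  qed
  ultimately show ?thesis by (intro that[OF Q(1,3)])
qed

text \<open>By \<open>countable_predense\<close>, the balls inside \<open>W n\<close> with compact
  set in Z are enough for density. Membership in them depends only on the restriction to Z, so a
  generic function on Z lies in every \<open>W n\<close> however it is extended.\<close>

lemma Baire_Ck_if_separable_subspaces:
  assumes X: "stratifiable X"
    and B: "\<And>Q. countable Q \<Longrightarrow> Q \<subseteq> topspace X \<Longrightarrow> Baire_space (Ck (subtopology X (X closure_of Q)))"
  shows "Baire_space (Ck X)"
  unfolding Baire_Ck_iff
proof (intro allI impI)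
  fix W :: "nat \<Rightarrow> ('a \<Rightarrow> real) set"
  assume W: "\<forall>n. openin (Ck X) (W n) \<and> Ck_dense X (W n)"
  have nX: "normal_space X" and hX: "Hausdorff_space X"
    using X by (simp_all add: stratifiable_normal stratifiable_Hausdorff)
  show "Ck_dense X (\<Inter>n. W n)"
    unfolding Ck_dense_def
  proof (intro allI impI)
    fix f0 K0 and e0 :: real assume f0: "f0 \<in> C_carrier X" and K0: "compactin X K0" and e0: "e0 > 0"
    obtain Q where Q: "countable Q" "Q \<subseteq> topspace X" "K0 \<subseteq> X closure_of Q"
      and pre: "\<And>n f K e. f \<in> C_carrier X \<Longrightarrow> compactin X K \<Longrightarrow> e > 0 \<Longrightarrow>
      \<exists>f' K' k. f' \<in> C_carrier X \<and> compactin X K' \<and> K' \<subseteq> X closure_of Q \<and>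
        Cball X f' K' (1 / Suc k) \<subseteq> W n \<and> (\<exists>h. h \<in> Cball X f K e \<and> h \<in> Cball X f' K' (1 / Suc k))"
      by (rule countable_predense[OF X _ _ K0, of W]) (use W in auto)
    define Z where "Z = X closure_of Q"
    have Z: "closedin X Z" unfolding Z_def by (rule closedin_closure_of)
    have ZX: "Z \<subseteq> topspace X" using Z by (rule closedin_subset)
    let ?Z = "subtopology X Z"
    have BZ: "Baire_space (Ck ?Z)" unfolding Z_def by (rule B[OF Q(1,2)])
    define \<G> where "\<G> n = (\<lambda>(f', K', k). Cball ?Z (restrict f' Z) K' (1 / Suc k)) `
      {(f', K', k). f' \<in> C_carrier X \<and> compactin X K' \<and> K' \<subseteq> Z \<and> Cball X f' K' (1 / Suc k) \<subseteq> W n}" for n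
    have res: "restrict h Z \<in> Cball ?Z (restrict f Z) K e"
      if "h \<in> Cball X f K e" "K \<subseteq> Z" for h f K e
      using that restrict_C_carrier_subtopology[OF _ ZX, of h] by (auto simp: Cball_iff subset_iff)
    have ex: "\<exists>h. h \<in> C_carrier X \<and> (\<forall>x\<in>Z. h x = g x)" if g: "g \<in> C_carrier ?Z" for g
    proof -
      obtain h where "h \<in> Cball X f0 {} 1" "\<And>x. x \<in> Z \<Longrightarrow> h x = g x"
        by (rule Ck_extend[OF nX hX Z f0 C_carrier_cont[OF g], of "{}" 1]) auto
      then show ?thesis by (auto simp: Cball_iff)
    qed
    have op: "openin (Ck ?Z) (\<Union>(\<G> n))" for n
    proof (rule openin_Union)
      fix S assume "S \<in> \<G> n"
      then obtain f' K' k where "S = Cball ?Z (restrict f' Z) K' (1 / Suc k)"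
        "f' \<in> C_carrier X" "compactin X K'" "K' \<subseteq> Z" by (auto simp: \<G>_def)
      then show "openin (Ck ?Z) S"
        using openin_Cball[OF restrict_C_carrier_subtopology[OF _ ZX], of f' K' "1 / Suc k"]
        by (simp add: compactin_subtopology)
    qed
    have de: "Ck_dense ?Z (\<Union>(\<G> n))" for n
      unfolding Ck_dense_def
    proof (intro allI impI)
      fix g K and e :: real assume g: "g \<in> C_carrier ?Z" and K: "compactin ?Z K" and e: "e > 0"
      have KZ: "compactin X K" "K \<subseteq> Z" using K by (simp_all add: compactin_subtopology)
      obtain g' where g': "g' \<in> C_carrier X" "\<forall>x\<in>Z. g' x = g x" using ex[OF g] by blast
      obtain f' K' k h where f': "f' \<in> C_carrier X" "compactin X K'" "K' \<subseteq> Z"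
        "Cball X f' K' (1 / Suc k) \<subseteq> W n" and h: "h \<in> Cball X g' K e" "h \<in> Cball X f' K' (1 / Suc k)"
        using pre[OF g'(1) KZ(1) e, of n] unfolding Z_def by auto
      have "restrict h Z \<in> \<Union>(\<G> n)"
        using res[OF h(2) f'(3)] f' by (force simp: \<G>_def)
      moreover have "restrict h Z \<in> Cball ?Z g K e"
        using res[OF h(1) KZ(2)] g'(2) KZ(2) by (auto simp: Cball_iff subset_iff)
      ultimately show "\<exists>h\<in>\<Union>(\<G> n). h \<in> Cball ?Z g K e" by blast
    qed
    have K0Z: "compactin ?Z K0" using K0 Q(3) by (simp add: compactin_subtopology Z_def)
    obtain h where h: "h \<in> Cball ?Z (restrict f0 Z) K0 e0" "\<And>n. h \<in> \<Union>(\<G> n)"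
      by (rule Baire_Ck_countable[OF BZ countableI_type, of UNIV "\<lambda>n. \<Union>(\<G> n)"])
        (use op de restrict_C_carrier_subtopology[OF f0 ZX] K0Z e0 in auto)
    have hC: "h \<in> C_carrier ?Z" using h(1) by (simp add: Cball_iff)
    obtain h' where h': "h' \<in> C_carrier X" "\<forall>x\<in>Z. h' x = h x" using ex[OF hC] by blast
    have "h' \<in> Cball X f0 K0 e0"
      using h(1) h' Q(3) by (auto simp: Cball_iff Z_def subset_iff)
    moreover have "h' \<in> W n" for n
    proof -
      obtain f' K' k where f': "K' \<subseteq> Z" "Cball X f' K' (1 / Suc k) \<subseteq> W n"
        "h \<in> Cball ?Z (restrict f' Z) K' (1 / Suc k)"
        using h(2)[of n] by (auto simp: \<G>_def)
      then have "h' \<in> Cball X f' K' (1 / Suc k)" using h' by (auto simp: Cball_iff subset_iff)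
      then show ?thesis using f'(2) by blast
    qed
    ultimately show "\<exists>h\<in>\<Inter>n. W n. h \<in> Cball X f0 K0 e0" by blast
  qed
qed

lemma countable_dense_Ck:
  assumes X: "stratifiable X" and Q: "countable Q" "Q \<subseteq> topspace X"
    and A: "closedin X A" "A \<subseteq> X closure_of Q"
  shows "\<exists>S. countable S \<and> S \<subseteq> C_carrier (subtopology X A) \<and> Ck_dense (subtopology X A) S"
proof -
  obtain F where F: "diagonal_functions X F" using stratifiable_diagonal_functions[OF X] by blast
  let ?\<Phi> = "diagonal_slices F Q" and ?A = "subtopology X A"
  have \<Phi>: "continuous_map ?A euclideanreal \<phi>" if "\<phi> \<in> ?\<Phi>" for \<phi>
    using diagonal_slices_continuous[OF F Q(2) that] by (rule continuous_map_from_subtopology)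
  have AX: "A \<subseteq> topspace X" using A(1) by (rule closedin_subset)
  then have tA: "topspace ?A = A" by auto
  define S where "S = (\<lambda>\<psi>. restrict \<psi> A) ` rat_lattice ?\<Phi>"
  have "countable S"
    unfolding S_def using Q by (intro countable_image countable_rat_lattice countable_diagonal_slices)
  moreover have "S \<subseteq> C_carrier ?A"
    using restrict_C_carrier[OF rat_lattice_continuous[OF _ \<Phi>]] tA by (auto simp: S_def)
  moreover have "Ck_dense ?A S"
    unfolding Ck_dense_def
  proof (intro allI impI)
    fix w M and e :: real assume w: "w \<in> C_carrier ?A" and M: "compactin ?A M" and e: "e > 0"
    have MA: "M \<subseteq> A" using M by (simp add: compactin_subtopology)
    have "\<exists>\<psi>\<in>rat_lattice ?\<Phi>. \<forall>x\<in>M. \<bar>\<psi> x - w x\<bar> < e"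
    proof (rule rat_lattice_approx[OF M \<Phi> C_carrier_cont[OF w] e])
      fix x y assume xy: "x \<in> M" "y \<in> M" "w x \<noteq> w y"
      then have "x \<in> topspace X" "x \<noteq> y" "y \<in> X closure_of Q" using MA AX A(2) by auto
      then show "\<exists>\<phi>\<in>?\<Phi>. \<phi> x \<noteq> \<phi> y" using diagonal_slices_separate[OF F] by blast
    qed
    then obtain \<psi> where \<psi>: "\<psi> \<in> rat_lattice ?\<Phi>" "\<forall>x\<in>M. \<bar>\<psi> x - w x\<bar> < e" by blast
    have "restrict \<psi> A \<in> Cball ?A w M e"
      using restrict_C_carrier[OF rat_lattice_continuous[OF \<psi>(1) \<Phi>]] tA \<psi>(2) MA
      by (auto simp: Cball_iff subset_iff)
    then show "\<exists>h\<in>S. h \<in> Cball ?A w M e" using \<psi>(1) by (auto simp: S_def)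
  qed
  ultimately show ?thesis by blast
qed

section \<open>Retractions and selection of moving off sets\<close>

text \<open>\<open>r x\<close> is a point of A whose n-th neighborhood contains x for the largest
  possible n, hence for every n with x in \<open>N n\<close>. Continuity needs care only at points x
  of A: if y in \<open>U x n\<close> had \<open>r y\<close> outside W, then y would lie in the n-th
  neighborhood of the complement of W, whose closure avoids x for suitable n.\<close>

lemma stratification_retraction:
  assumes U: "stratification X U" and A: "closedin X A" "A \<noteq> {}"
    and iso: "\<And>x. x \<in> topspace X - A \<Longrightarrow> openin X {x}"
  shows "\<exists>r. continuous_map X X r \<and> r ` topspace X \<subseteq> A \<and> (\<forall>a\<in>A. r a = a)"
proof -
  have AX: "A \<subseteq> topspace X" using A(1) by (rule closedin_subset)
  define N where "N n = (\<Union>a\<in>A. U a n)" for n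
  have "\<exists>a. a \<in> A \<and> (x \<in> A \<longrightarrow> a = x) \<and> (\<forall>n. x \<in> N n \<longrightarrow> x \<in> U a n)" if x: "x \<in> topspace X" for x
  proof (cases "x \<in> A")
    case True
    then show ?thesis using stratification_mem[OF U x] by auto
  next
    case False
    obtain m where m: "x \<notin> X closure_of (N m)"
      using stratification_separate[OF U A(1) x False] unfolding N_def by blast
    have "N m \<subseteq> X closure_of (N m)"
      unfolding N_def by (intro closure_of_subset openin_subset stratification_Union_open[OF U AX])
    then have xm: "x \<notin> N m" using m by blast
    define T where "T = {n. x \<in> N n}"
    have "n < m" if "n \<in> T" for n
    proof (rule ccontr)
      assume "\<not> n < m"
      then have "N n \<subseteq> N m" unfolding N_def
        by (intro stratification_Union_antimono[OF U AX]) simp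
      then show False using that xm by (auto simp: T_def)
    qed
    then have fT: "finite T" by (meson bounded_nat_set_is_finite)
    show ?thesis
    proof (cases "T = {}")
      case True
      then show ?thesis using A(2) False by (auto simp: T_def)
    next
      case nonempty: False
      have "x \<in> N (Max T)" using Max_in[OF fT nonempty] by (simp add: T_def)
      then obtain a where a: "a \<in> A" "x \<in> U a (Max T)" by (auto simp: N_def)
      have "x \<in> U a n" if "x \<in> N n" for n
      proof -
        have n: "n \<le> Max T" using that fT by (simp add: T_def)
        show ?thesis using stratification_antimono[OF U _ n, of a] a AX by auto
      qed
      then show ?thesis using a(1) False by blast
    qed
  qed
  then obtain r where r: "\<And>x. x \<in> topspace X \<Longrightarrow> r x \<in> A" "\<And>x. x \<in> A \<Longrightarrow> r x = x"
    "\<And>x n. x \<in> topspace X \<Longrightarrow> x \<in> N n \<Longrightarrow> x \<in> U (r x) n"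
    using AX by (metis (no_types, lifting) subsetD)
  have "continuous_map X X r"
    unfolding continuous_map_def
  proof (intro conjI allI impI)
    show "r \<in> topspace X \<rightarrow> topspace X" using r(1) AX by auto
    fix W assume W: "openin X W"
    show "openin X {x \<in> topspace X. r x \<in> W}"
    proof (subst openin_subopen, intro ballI)
      fix x assume x: "x \<in> {x \<in> topspace X. r x \<in> W}"
      show "\<exists>T. openin X T \<and> x \<in> T \<and> T \<subseteq> {x \<in> topspace X. r x \<in> W}"
      proof (cases "x \<in> A")
        case False
        then show ?thesis using iso[of x] x by (intro exI[of _ "{x}"]) auto
      next
        case True
        then have xW: "x \<in> W" "x \<in> topspace X" using x r(2) by auto
        let ?F = "topspace X - W"
        obtain n where n: "x \<notin> X closure_of (\<Union>z\<in>?F. U z n)"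
          using stratification_separate[OF U closedin_diff[OF closedin_topspace W] xW(2)] xW(1) by auto
        let ?V = "(topspace X - X closure_of (\<Union>z\<in>?F. U z n)) \<inter> U x n"
        have "openin X ?V"
          by (intro openin_Int openin_diff openin_topspace closedin_closure_of stratification_open[OF U xW(2)])
        moreover have "x \<in> ?V" using n xW stratification_mem[OF U xW(2)] by auto
        moreover have "?V \<subseteq> {x \<in> topspace X. r x \<in> W}"
        proof
          fix y assume y: "y \<in> ?V"
          then have yX: "y \<in> topspace X" and "y \<in> N n" using True by (auto simp: N_def)
          then have yU: "y \<in> U (r y) n" using r(3) by blast
          have sub: "(\<Union>z\<in>?F. U z n) \<subseteq> X closure_of (\<Union>z\<in>?F. U z n)"
            by (intro closure_of_subset openin_subset stratification_Union_open[OF U] Diff_subset)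
          have "r y \<in> W"
          proof (rule ccontr)
            assume "r y \<notin> W"
            then have "r y \<in> ?F" using r(1)[OF yX] AX by auto
            then have "y \<in> (\<Union>z\<in>?F. U z n)" using yU by blast
            then show False using sub y by auto
          qed
          then show "y \<in> {x \<in> topspace X. r x \<in> W}" using yX by simp
        qed
        ultimately show ?thesis by (intro exI[of _ ?V] conjI)
      qed
    qed
  qed
  then show ?thesis using r(1,2) by (intro exI[of _ r]) auto
qed

section \<open>Locally finite selections from the Moving Off Property\<close>

definition loc_finite :: "'a topology \<Rightarrow> ('i \<Rightarrow> 'a set) \<Rightarrow> bool"
  where "loc_finite X B \<longleftrightarrow>
    (\<forall>x\<in>topspace X. \<exists>N. openin X N \<and> x \<in> N \<and> finite {i. B i \<inter> N \<noteq> {}})"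

lemma loc_finiteD:
  "loc_finite X B \<Longrightarrow> x \<in> topspace X \<Longrightarrow> \<exists>N. openin X N \<and> x \<in> N \<and> finite {i. B i \<inter> N \<noteq> {}}"
  by (simp add: loc_finite_def)

lemma loc_finite_compactin:
  assumes B: "loc_finite X B" and K: "compactin X K"
  shows "finite {i. B i \<inter> K \<noteq> {}}"
proof -
  define \<U> where "\<U> = {N. openin X N \<and> finite {i. B i \<inter> N \<noteq> {}}}"
  have "K \<subseteq> \<Union>\<U>"
  proof
    fix x assume "x \<in> K"
    then have "x \<in> topspace X" using compactin_subset_topspace[OF K] by blast
    from loc_finiteD[OF B this] show "x \<in> \<Union>\<U>" by (auto simp: \<U>_def)
  qed
  then obtain \<C> where C: "finite \<C>" "\<C> \<subseteq> \<U>" "K \<subseteq> \<Union>\<C>"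
    using compactinD[OF K, of \<U>] by (auto simp: \<U>_def)
  have "{i. B i \<inter> K \<noteq> {}} \<subseteq> (\<Union>N\<in>\<C>. {i. B i \<inter> N \<noteq> {}})" using C(3) by auto
  moreover have "finite (\<Union>N\<in>\<C>. {i. B i \<inter> N \<noteq> {}})" using C(1,2) by (auto simp: \<U>_def)
  ultimately show ?thesis by (rule finite_subset)
qed

lemma strongly_discrete_sequence:
  assumes G: "strongly_discrete X \<G>" and e: "inj e" "\<And>m::nat. e m \<in> \<G>"
  shows "loc_finite X e" "\<And>m n. (\<Union>\<G>) \<subseteq> topspace X \<Longrightarrow> e m \<inter> e n \<noteq> {} \<Longrightarrow> m = n"
proof -
  obtain V where V: "\<forall>F\<in>\<G>. openin X (V F) \<and> F \<subseteq> V F"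
    and d: "\<forall>x\<in>topspace X. \<exists>N. nbhd_in X x N \<and>
          (\<forall>F\<in>\<G>. \<forall>G\<in>\<G>. V F \<inter> N \<noteq> {} \<and> V G \<inter> N \<noteq> {} \<longrightarrow> F = G)"
    using G unfolding strongly_discrete_def by (elim exE conjE)
  have ex: "\<exists>N. openin X N \<and> x \<in> N \<and> (\<forall>m n. e m \<inter> N \<noteq> {} \<longrightarrow> e n \<inter> N \<noteq> {} \<longrightarrow> m = n)"
    if x: "x \<in> topspace X" for x
  proof -
    obtain N where N: "nbhd_in X x N" "\<forall>F\<in>\<G>. \<forall>G\<in>\<G>. V F \<inter> N \<noteq> {} \<and> V G \<inter> N \<noteq> {} \<longrightarrow> F = G"
      using d[rule_format, OF x] by (elim exE conjE)
    obtain W where W: "openin X W" "x \<in> W" "W \<subseteq> N"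
      using N(1) unfolding nbhd_in_def by (elim exE conjE)
    have "m = n" if mn: "e m \<inter> W \<noteq> {}" "e n \<inter> W \<noteq> {}" for m n
    proof -
      have "e m \<subseteq> V (e m)" "e n \<subseteq> V (e n)" using V e(2) by simp_all
      then have "V (e m) \<inter> N \<noteq> {}" "V (e n) \<inter> N \<noteq> {}" using mn W(3) by blast+
      then have "e m = e n" using N(2) e(2) by simp
      then show ?thesis using e(1) by (simp add: inj_eq)
    qed
    then show ?thesis using W(1,2) by (intro exI[of _ W]) simp
  qed
  show "loc_finite X e"
    unfolding loc_finite_def
  proof
    fix x assume x: "x \<in> topspace X"
    obtain N where N: "openin X N" "x \<in> N" "\<forall>m n. e m \<inter> N \<noteq> {} \<longrightarrow> e n \<inter> N \<noteq> {} \<longrightarrow> m = n"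
      using ex[OF x] by (elim exE conjE)
    have "finite {i. e i \<inter> N \<noteq> {}}"
    proof (cases "{i. e i \<inter> N \<noteq> {}} = {}")
      case False
      then obtain m where "e m \<inter> N \<noteq> {}" by auto
      then have "{i. e i \<inter> N \<noteq> {}} \<subseteq> {m}" using N(3) by auto
      then show ?thesis using finite_subset by blast
    qed simp
    then show "\<exists>N. openin X N \<and> x \<in> N \<and> finite {i. e i \<inter> N \<noteq> {}}" using N by (intro exI[of _ N]) simp
  qed
  fix m n assume top: "(\<Union>\<G>) \<subseteq> topspace X" and mn: "e m \<inter> e n \<noteq> {}"
  obtain x where x: "x \<in> e m" "x \<in> e n" using mn by auto
  have "x \<in> topspace X" using x(1) top e(2)[of m] by auto
  from ex[OF this] obtain N where "x \<in> N" and N: "\<forall>m n. e m \<inter> N \<noteq> {} \<longrightarrow> e n \<inter> N \<noteq> {} \<longrightarrow> m = n"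
    by (elim exE conjE)
  then have "e m \<inter> N \<noteq> {}" "e n \<inter> N \<noteq> {}" using x by auto
  then show "m = n" using N by simp
qed

lemma Moving_Off_sequence:
  assumes M: "Moving_Off_Property X" and F: "\<And>F. F \<in> \<F> \<Longrightarrow> compactin X F"
    and mo: "\<And>K. compactin X K \<Longrightarrow> \<exists>F\<in>\<F>. F \<noteq> {} \<and> K \<inter> F = {}"
  shows "\<exists>e::nat \<Rightarrow> 'a set. (\<forall>m. e m \<in> \<F>) \<and> loc_finite X e \<and> (\<forall>m n. e m \<inter> e n \<noteq> {} \<longrightarrow> m = n)"
proof -
  have top: "\<forall>F\<in>\<F>. F \<subseteq> topspace X" using F compactin_subset_topspace by blast
  have "moving_off_family X \<F>" unfolding moving_off_family_def by (intro conjI top allI impI mo)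
  moreover have "\<forall>F\<in>\<F>. compactin X F" using F by simp
  ultimately have "\<exists>\<G>\<subseteq>\<F>. infinite \<G> \<and> strongly_discrete X \<G>" by (rule Moving_Off_PropertyD[OF M])
  then obtain \<G> where G: "\<G> \<subseteq> \<F>" "infinite \<G>" "strongly_discrete X \<G>" by (elim exE conjE)
  obtain e :: "nat \<Rightarrow> 'a set" where e: "inj e" "range e \<subseteq> \<G>" using infinite_countable_subset[OF G(2)] by blast
  have eG: "e m \<in> \<G>" for m using e(2) by auto
  have "\<Union>\<G> \<subseteq> topspace X" using G(1) top by blast
  then have "\<forall>m n. e m \<inter> e n \<noteq> {} \<longrightarrow> m = n"
    by (intro allI impI strongly_discrete_sequence(2)[OF G(3) e(1) eG])
  moreover have "loc_finite X e" by (rule strongly_discrete_sequence(1)[OF G(3) e(1) eG])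
  moreover have "\<forall>m. e m \<in> \<F>" using eG G(1) by auto
  ultimately show ?thesis by (intro exI[of _ e] conjI)
qed

text \<open>The empty set is allowed as a member here; in a compact space it is the only choice.\<close>

lemma Moving_Off_selection:
  assumes M: "Moving_Off_Property X" and F: "\<And>n F. F \<in> \<F> n \<Longrightarrow> compactin X F"
    and mo: "\<And>n K. compactin X K \<Longrightarrow> \<exists>F\<in>\<F> n. F \<inter> K = {}"
  shows "\<exists>G::nat \<Rightarrow> 'a set. (\<forall>n. G n \<in> \<F> n) \<and> loc_finite X G"
proof (cases "compactin X (topspace X)")
  case True
  have "{} \<in> \<F> n" for n
  proof -
    obtain S where "S \<in> \<F> n" "S \<inter> topspace X = {}" using mo[OF True] by blast
    moreover from calculation have "S \<subseteq> topspace X" using F compactin_subset_topspace by blast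
    ultimately show ?thesis by (simp add: Int_absorb2)
  qed
  then show ?thesis by (intro exI[of _ "\<lambda>_. {}"]) (auto simp: loc_finite_def)
next
  case False
  \<comment> \<open>In a noncompact space the singletons move off; they supply the points
    \<open>d j\<close> used as tags.\<close>
  have s1: "\<exists>F\<in>(\<lambda>x. {x}) ` topspace X. F \<noteq> {} \<and> K \<inter> F = {}" if K: "compactin X K" for K
  proof -
    have "K \<noteq> topspace X" using False K by auto
    then obtain x where "x \<in> topspace X" "x \<notin> K" using compactin_subset_topspace[OF K] by auto
    then show ?thesis by auto
  qed
  have s2: "compactin X F" if "F \<in> (\<lambda>x. {x}) ` topspace X" for F using that by auto
  have "\<exists>c::nat \<Rightarrow> 'a set. (\<forall>m. c m \<in> (\<lambda>x. {x}) ` topspace X) \<and> loc_finite X c \<and>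
      (\<forall>m n. c m \<inter> c n \<noteq> {} \<longrightarrow> m = n)"
    by (rule Moving_Off_sequence[OF M s2 s1])
  then obtain c :: "nat \<Rightarrow> 'a set" where c: "\<forall>m. c m \<in> (\<lambda>x. {x}) ` topspace X" "loc_finite X c"
    "\<forall>m n. c m \<inter> c n \<noteq> {} \<longrightarrow> m = n" by (elim exE conjE)
  have "\<exists>x. x \<in> topspace X \<and> c m = {x}" for m using c(1) by auto
  then obtain d where d: "\<And>m. d m \<in> topspace X" "\<And>m. c m = {d m}" by metis
  \<comment> \<open>A member bundles one choice from each of the families up to j with the tag
    \<open>d j\<close>. The tag makes it non-empty, and bundles with the same j share a point, so
    the disjoint bundles found below have distinct, hence unbounded, j.\<close>
  define \<H> where "\<H> = {insert (d j) (\<Union>i\<le>j. S i) | j S. \<forall>i\<le>j. S i \<in> \<F> i}"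
  have H1: "compactin X E" if EH: "E \<in> \<H>" for E
  proof -
    obtain j S where E: "E = {d j} \<union> (\<Union>i\<le>j. S i)" and S: "\<forall>i\<le>j. S i \<in> \<F> i" using EH by (auto simp: \<H>_def)
    have "compactin X (\<Union>i\<le>j. S i)" by (rule compactin_Union) (use S F in auto)
    then show ?thesis unfolding E using d(1) by (intro compactin_Un) auto
  qed
  have H2: "\<exists>E\<in>\<H>. E \<noteq> {} \<and> K \<inter> E = {}" if K: "compactin X K" for K
  proof -
    have "finite {m. c m \<inter> K \<noteq> {}}" by (rule loc_finite_compactin[OF c(2) K])
    then obtain j where "j \<notin> {m. c m \<inter> K \<noteq> {}}" using ex_new_if_finite[OF infinite_UNIV_nat] by blast
    then have j: "d j \<notin> K" using d(2) by auto
    have "\<forall>n. \<exists>F. F \<in> \<F> n \<and> F \<inter> K = {}" using mo[OF K] by blast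
    from choice[OF this] obtain S where S: "\<forall>n. S n \<in> \<F> n \<and> S n \<inter> K = {}" ..
    have "insert (d j) (\<Union>i\<le>j. S i) \<in> \<H>"
      unfolding \<H>_def using S by (intro CollectI exI[of _ j] exI[of _ S]) simp
    moreover have "x \<notin> S i" if "x \<in> K" for x i
    proof -
      have "S i \<inter> K = {}" using S by simp
      then show ?thesis using that by auto
    qed
    then have "K \<inter> insert (d j) (\<Union>i\<le>j. S i) = {}" using j by fastforce
    ultimately show ?thesis by (intro bexI[of _ "insert (d j) (\<Union>i\<le>j. S i)"]) simp_all
  qed
  have "\<exists>e::nat \<Rightarrow> 'a set. (\<forall>m. e m \<in> \<H>) \<and> loc_finite X e \<and> (\<forall>m n. e m \<inter> e n \<noteq> {} \<longrightarrow> m = n)"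
    by (rule Moving_Off_sequence[OF M H1 H2])
  then obtain e :: "nat \<Rightarrow> 'a set" where e: "\<forall>m. e m \<in> \<H>" "loc_finite X e"
    "\<forall>m n. e m \<inter> e n \<noteq> {} \<longrightarrow> m = n" by (elim exE conjE)
  have "\<forall>m. \<exists>j S. e m = insert (d j) (\<Union>i\<le>j. S i) \<and> (\<forall>i\<le>j. S i \<in> \<F> i)"
    using e(1) by (simp add: \<H>_def)
  then obtain j S where jS: "\<And>m. e m = insert (d (j m)) (\<Union>i\<le>j m. S m i)" "\<And>m i. i \<le> j m \<Longrightarrow> S m i \<in> \<F> i"
    by metis
  have injj: "inj j"
  proof (rule injI)
    fix m n assume "j m = j n"
    then have "d (j m) \<in> e m \<inter> e n" by (simp add: jS(1))
    then show "m = n" using e(3) by blast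
  qed
  have "\<exists>m. i \<le> j m" for i
  proof (rule ccontr)
    assume "\<not> ?thesis"
    then have "range j \<subseteq> {..<i}" by (auto simp: not_le)
    then show False using injj finite_subset range_inj_infinite by blast
  qed
  then obtain m where m: "\<And>i. i \<le> j (m i)" by metis
  define G where "G i = S (m i) i" for i
  have Ge: "G i \<subseteq> e (m i)" for i using m by (auto simp: G_def jS(1))
  \<comment> \<open>The bundle \<open>e k\<close> serves only the finitely many indices up to
    \<open>j k\<close>, so local finiteness passes from \<open>e\<close> to
    \<open>G\<close>.\<close>
  have "loc_finite X G"
    unfolding loc_finite_def
  proof
    fix x assume "x \<in> topspace X"
    then obtain N where N: "openin X N" "x \<in> N" "finite {i. e i \<inter> N \<noteq> {}}"
      using loc_finiteD[OF e(2)] by metis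
    have "{i. G i \<inter> N \<noteq> {}} \<subseteq> (\<Union>k\<in>{k. e k \<inter> N \<noteq> {}}. {..j k})"
    proof
      fix i assume "i \<in> {i. G i \<inter> N \<noteq> {}}"
      then have "e (m i) \<inter> N \<noteq> {}" using Ge[of i] by auto
      then show "i \<in> (\<Union>k\<in>{k. e k \<inter> N \<noteq> {}}. {..j k})" using m[of i] by auto
    qed
    then have "finite {i. G i \<inter> N \<noteq> {}}" by (rule finite_subset) (use N(3) in simp)
    then show "\<exists>N. openin X N \<and> x \<in> N \<and> finite {i. G i \<inter> N \<noteq> {}}" using N by (intro exI[of _ N]) simp
  qed
  moreover have "\<forall>n. G n \<in> \<F> n" using jS(2) m by (simp add: G_def)
  ultimately show ?thesis by (intro exI[of _ G]) simp
qed

lemma Moving_Off_selection_countable: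
  fixes \<F> :: "'i::countable \<Rightarrow> 'a set set"
  assumes M: "Moving_Off_Property X" and F: "\<And>n F. F \<in> \<F> n \<Longrightarrow> compactin X F"
    and mo: "\<And>n K. compactin X K \<Longrightarrow> \<exists>F\<in>\<F> n. F \<inter> K = {}"
  shows "\<exists>G. (\<forall>n. G n \<in> \<F> n) \<and> loc_finite X G"
proof -
  obtain G where G: "\<forall>n. G n \<in> \<F> (from_nat n)" "loc_finite X G"
    using Moving_Off_selection[OF M, of "\<lambda>n. \<F> (from_nat n)"] F mo by auto
  have "G (to_nat i) \<in> \<F> i" for i using G(1)[rule_format, of "to_nat i"] by simp
  moreover have "loc_finite X (\<lambda>i::'i. G (to_nat i))"
    unfolding loc_finite_def
  proof
    fix x assume "x \<in> topspace X"
    then obtain N where N: "openin X N" "x \<in> N" "finite {i. G i \<inter> N \<noteq> {}}"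
      using loc_finiteD[OF G(2)] by metis
    have "finite (to_nat -` {i. G i \<inter> N \<noteq> {}} :: 'i set)" using N(3) by (rule finite_vimageI) simp
    then show "\<exists>N. openin X N \<and> x \<in> N \<and> finite {i::'i. G (to_nat i) \<inter> N \<noteq> {}}"
      using N by (intro exI[of _ N]) (simp add: vimage_def)
  qed
  ultimately show ?thesis by (intro exI[of _ "\<lambda>i. G (to_nat i)"]) simp
qed

text \<open>The selection principle is applied to a constant sequence of families: a compact set
  meets only finitely many terms of the resulting sequence.\<close>

lemma Moving_Off_countable_subfamily:
  assumes M: "Moving_Off_Property X" and F: "\<And>F. F \<in> \<F> \<Longrightarrow> compactin X F"
    and mo: "\<And>K. compactin X K \<Longrightarrow> \<exists>F\<in>\<F>. F \<inter> K = {}"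
  shows "\<exists>G::nat \<Rightarrow> 'a set. (\<forall>n. G n \<in> \<F>) \<and> (\<forall>K. compactin X K \<longrightarrow> (\<exists>n. G n \<inter> K = {}))"
proof -
  obtain G :: "nat \<Rightarrow> 'a set" where G: "\<forall>n. G n \<in> \<F>" "loc_finite X G"
    using Moving_Off_selection[OF M, of "\<lambda>_. \<F>"] F mo by auto
  have "\<exists>n. G n \<inter> K = {}" if K: "compactin X K" for K
    using ex_new_if_finite[OF infinite_UNIV_nat loc_finite_compactin[OF G(2) K]] by auto
  then show ?thesis using G(1) by (intro exI[of _ G]) simp
qed

text \<open>Countably many options are kept at every node, so that the selection principle can be
  applied to the whole countable tree of options at once; the surviving nodes form the tree
  indexed by \<^typ>\<open>nat list\<close>.\<close>

lemma Moving_Off_tree: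
  fixes R :: "'s \<Rightarrow> nat \<Rightarrow> 's \<Rightarrow> 'a set \<Rightarrow> bool"
  assumes M: "Moving_Off_Property X" and S0: "\<sigma>0 \<in> S"
    and step: "\<And>\<sigma> i K. \<sigma> \<in> S \<Longrightarrow> compactin X K \<Longrightarrow> \<exists>\<sigma>'\<in>S. \<exists>B. compactin X B \<and> B \<inter> K = {} \<and> R \<sigma> i \<sigma>' B"
  shows "\<exists>\<tau> B. \<tau> [] = \<sigma>0 \<and> (\<forall>t. \<tau> t \<in> S) \<and> (\<forall>t i. R (\<tau> t) i (\<tau> (i # t)) (B (i # t))) \<and> loc_finite X B"
proof -
  have "\<exists>c::nat \<Rightarrow> 's \<times> 'a set. \<sigma> \<in> S \<longrightarrow>
      (\<forall>j. fst (c j) \<in> S \<and> compactin X (snd (c j)) \<and> R \<sigma> i (fst (c j)) (snd (c j))) \<and>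
      (\<forall>K. compactin X K \<longrightarrow> (\<exists>j. snd (c j) \<inter> K = {}))" for \<sigma> i
  proof (cases "\<sigma> \<in> S")
    case True
    define \<F> where "\<F> = {B. compactin X B \<and> (\<exists>\<sigma>'\<in>S. R \<sigma> i \<sigma>' B)}"
    have "\<exists>F\<in>\<F>. F \<inter> K = {}" if "compactin X K" for K
      using step[OF True that, of i] by (auto simp: \<F>_def)
    then obtain G :: "nat \<Rightarrow> 'a set" where G: "\<forall>n. G n \<in> \<F>" "\<forall>K. compactin X K \<longrightarrow> (\<exists>n. G n \<inter> K = {})"
      using Moving_Off_countable_subfamily[OF M, of \<F>] by (auto simp: \<F>_def)
    have "\<forall>j. \<exists>\<sigma>'. \<sigma>' \<in> S \<and> R \<sigma> i \<sigma>' (G j)" using G(1) by (auto simp: \<F>_def)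
    from choice[OF this] obtain s where s: "\<forall>j. s j \<in> S \<and> R \<sigma> i (s j) (G j)" ..
    show ?thesis using G s by (intro exI[of _ "\<lambda>j. (s j, G j)"]) (simp add: \<F>_def)
  qed simp
  then have "\<forall>\<sigma> i. \<exists>c::nat \<Rightarrow> 's \<times> 'a set. \<sigma> \<in> S \<longrightarrow>
      (\<forall>j. fst (c j) \<in> S \<and> compactin X (snd (c j)) \<and> R \<sigma> i (fst (c j)) (snd (c j))) \<and>
      (\<forall>K. compactin X K \<longrightarrow> (\<exists>j. snd (c j) \<inter> K = {}))" by simp
  then obtain c :: "'s \<Rightarrow> nat \<Rightarrow> nat \<Rightarrow> 's \<times> 'a set" where "\<forall>\<sigma> i. \<sigma> \<in> S \<longrightarrow>
      (\<forall>j. fst (c \<sigma> i j) \<in> S \<and> compactin X (snd (c \<sigma> i j)) \<and> R \<sigma> i (fst (c \<sigma> i j)) (snd (c \<sigma> i j))) \<and>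
      (\<forall>K. compactin X K \<longrightarrow> (\<exists>j. snd (c \<sigma> i j) \<inter> K = {}))"
    by metis
  then have c: "\<And>\<sigma> i j. \<sigma> \<in> S \<Longrightarrow> fst (c \<sigma> i j) \<in> S" "\<And>\<sigma> i j. \<sigma> \<in> S \<Longrightarrow> compactin X (snd (c \<sigma> i j))"
      "\<And>\<sigma> i j. \<sigma> \<in> S \<Longrightarrow> R \<sigma> i (fst (c \<sigma> i j)) (snd (c \<sigma> i j))"
      "\<And>\<sigma> i K. \<sigma> \<in> S \<Longrightarrow> compactin X K \<Longrightarrow> \<exists>j. snd (c \<sigma> i j) \<inter> K = {}" by simp_all
  \<comment> \<open>The full tree branches over pairs: an instruction i, and the number j of the
    option that answers it.\<close>
  define T where "T = rec_list \<sigma>0 (\<lambda>(p::nat \<times> nat) _ \<sigma>. fst (c \<sigma> (fst p) (snd p)))"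
  have T: "T [] = \<sigma>0" "T (p # t) = fst (c (T t) (fst p) (snd p))" for p t
    by (simp_all add: T_def)
  have TS: "T t \<in> S" for t by (induction t) (simp_all add: T S0 c(1))
  define \<F> where "\<F> q = range (\<lambda>j. snd (c (T (fst q)) (snd q) j))" for q :: "(nat \<times> nat) list \<times> nat"
  have Fc: "compactin X E" if "E \<in> \<F> q" for q E
    using that c(2)[OF TS] by (auto simp: \<F>_def)
  have Fm: "\<exists>E\<in>\<F> q. E \<inter> K = {}" if "compactin X K" for q K
    using c(4)[OF TS that] by (auto simp: \<F>_def)
  have "\<exists>G. (\<forall>q. G q \<in> \<F> q) \<and> loc_finite X G"
    by (rule Moving_Off_selection_countable[OF M Fc Fm])
  then obtain G where G: "\<forall>q. G q \<in> \<F> q" "loc_finite X G" by (elim exE conjE)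
  have "\<exists>j. G q = snd (c (T (fst q)) (snd q) j)" for q
    using G(1)[rule_format, of q] unfolding \<F>_def by (rule rangeE) blast
  then have "\<forall>q. \<exists>j. G q = snd (c (T (fst q)) (snd q) j)" by simp
  from choice[OF this] obtain \<gamma> where \<gamma>: "\<forall>q. G q = snd (c (T (fst q)) (snd q) (\<gamma> q))" ..
  \<comment> \<open>At each node and instruction only the option named by \<open>\<gamma>\<close>
    survives. \<open>\<rho>\<close> lifts a list of instructions to its path in the full tree, and
    \<open>map fst\<close> recovers the list, so local finiteness of \<open>G\<close> carries over
    to the thinned tree.\<close>
  define \<rho> where "\<rho> = rec_list [] (\<lambda>(i::nat) _ s. (i, \<gamma> (s, i)) # s)"
  have \<rho>: "\<rho> [] = []" "\<rho> (i # t) = (i, \<gamma> (\<rho> t, i)) # \<rho> t" for i t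
    by (simp_all add: \<rho>_def)
  have m\<rho>: "map fst (\<rho> t) = t" for t by (induction t) (simp_all add: \<rho>)
  define \<tau> where "\<tau> t = T (\<rho> t)" for t
  define B where "B t = (case t of [] \<Rightarrow> {} | i # t' \<Rightarrow> G (\<rho> t', i))" for t
  have BC: "B (i # t) = snd (c (\<tau> t) i (\<gamma> (\<rho> t, i)))" for i t
    using \<gamma> by (simp add: B_def \<tau>_def)
  have \<tau>C: "\<tau> (i # t) = fst (c (\<tau> t) i (\<gamma> (\<rho> t, i)))" for i t
    by (simp add: \<tau>_def \<rho> T)
  have "loc_finite X B"
    unfolding loc_finite_def
  proof
    fix x assume "x \<in> topspace X"
    then obtain N where N: "openin X N" "x \<in> N" "finite {q. G q \<inter> N \<noteq> {}}"
      using loc_finiteD[OF G(2)] by metis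
    have "{t. B t \<inter> N \<noteq> {}} \<subseteq> (\<lambda>q. snd q # map fst (fst q)) ` {q. G q \<inter> N \<noteq> {}}"
    proof
      fix t assume t: "t \<in> {t. B t \<inter> N \<noteq> {}}"
      then obtain i t' where it: "t = i # t'" by (cases t) (auto simp: B_def)
      then have "G (\<rho> t', i) \<inter> N \<noteq> {}" using t by (simp add: B_def)
      then show "t \<in> (\<lambda>q. snd q # map fst (fst q)) ` {q. G q \<inter> N \<noteq> {}}"
        using it m\<rho> by (intro image_eqI[of _ _ "(\<rho> t', i)"]) simp_all
    qed
    then have "finite {t. B t \<inter> N \<noteq> {}}" using N(3) by (meson finite_imageI finite_subset)
    then show "\<exists>N. openin X N \<and> x \<in> N \<and> finite {t. B t \<inter> N \<noteq> {}}" using N by (intro exI[of _ N]) simp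
  qed
  moreover have "\<tau> [] = \<sigma>0" "\<forall>t. \<tau> t \<in> S" by (simp_all add: \<tau>_def \<rho> T TS)
  moreover have "\<forall>t i. R (\<tau> t) i (\<tau> (i # t)) (B (i # t))"
    unfolding BC \<tau>C using c(3)[of "\<tau> t" for t] TS by (simp add: \<tau>_def)
  ultimately show ?thesis by (intro exI[of _ \<tau>] exI[of _ B] conjI)
qed

section \<open>Adding isolated points\<close>

text \<open>Near each point, one continuous function per error bound is enough. This serves both for
  finitely supported functions and for the limit along a branch.\<close>

lemma continuous_map_locally_approx:
  fixes h :: "'a \<Rightarrow> real"
  assumes ap: "\<And>x e. x \<in> topspace X \<Longrightarrow> e > 0 \<Longrightarrow>
      \<exists>N f. openin X N \<and> x \<in> N \<and> continuous_map X euclideanreal f \<and> (\<forall>y\<in>N. \<bar>h y - f y\<bar> \<le> e)"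
  shows "continuous_map X euclideanreal h"
  unfolding continuous_map_def
proof (intro conjI allI impI)
  show "h \<in> topspace X \<rightarrow> topspace euclideanreal" by simp
  fix W :: "real set" assume "openin euclideanreal W"
  then have W: "open W" by simp
  show "openin X {x \<in> topspace X. h x \<in> W}"
  proof (subst openin_subopen, intro ballI)
    fix x assume x: "x \<in> {x \<in> topspace X. h x \<in> W}"
    then obtain d where d: "d > 0" "ball (h x) d \<subseteq> W" using W openE by blast
    have xX: "x \<in> topspace X" using x by simp
    have "d/4 > 0" using d by simp
    from ap[OF xX this] obtain N f where N: "openin X N" "x \<in> N" and f: "continuous_map X euclideanreal f"
      and hf: "\<forall>y\<in>N. \<bar>h y - f y\<bar> \<le> d/4" by (elim exE conjE)
    let ?T = "N \<inter> {y \<in> topspace X. f y \<in> ball (f x) (d/4)}"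
    have "openin X ?T" by (intro openin_Int N openin_preimage_real f open_ball)
    moreover have "x \<in> ?T" using N xX d by simp
    moreover have "?T \<subseteq> {x \<in> topspace X. h x \<in> W}"
    proof
      fix y assume y: "y \<in> ?T"
      then have "\<bar>f y - f x\<bar> < d/4" by (simp add: dist_real_def abs_minus_commute)
      moreover have "\<bar>h y - f y\<bar> \<le> d/4" "\<bar>h x - f x\<bar> \<le> d/4" using hf y N by auto
      ultimately have "\<bar>h x - h y\<bar> < d" using d(1) by linarith
      then show "y \<in> {x \<in> topspace X. h x \<in> W}" using d(2) y by (auto simp: dist_real_def subset_iff)
    qed
    ultimately show "\<exists>T. openin X T \<and> x \<in> T \<and> T \<subseteq> {x \<in> topspace X. h x \<in> W}"
      by (intro exI[of _ ?T] conjI)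
  qed
qed

text \<open>If \<^term>\<open>A\<close> is empty, then the only element of \<^term>\<open>C_carrier (subtopology X A)\<close> is
  constantly \<^term>\<open>undefined\<close>, so \<^term>\<open>r\<close> may be arbitrary.\<close>

locale isolated_complement =
  fixes X :: "'a topology" and A :: "'a set" and r :: "'a \<Rightarrow> 'a"
  assumes normal: "normal_space X" and Hausdorff: "Hausdorff_space X" and closed: "closedin X A"
    and isolated: "\<And>x. x \<in> topspace X - A \<Longrightarrow> openin X {x}"
    and r_in: "\<And>x. x \<in> topspace X \<Longrightarrow> A \<noteq> {} \<Longrightarrow> r x \<in> A"
    and r_id: "\<And>a. a \<in> A \<Longrightarrow> r a = a"
    and r_cont: "\<And>u. u \<in> C_carrier (subtopology X A) \<Longrightarrow> continuous_map X euclideanreal (\<lambda>x. u (r x))"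
    and r_compact: "\<And>K. compactin X K \<Longrightarrow> compactin X (r ` K \<inter> A)"
begin

abbreviation XA where "XA \<equiv> subtopology X A"

definition fin_supp :: "('a \<Rightarrow> real) \<Rightarrow> bool"
  where "fin_supp g \<longleftrightarrow> finite {x. g x \<noteq> 0} \<and> {x. g x \<noteq> 0} \<subseteq> topspace X - A"

text \<open>Closeness of u and w on \<open>K \<inter> A\<close> gives closeness of their
  compositions with \<open>r\<close> on K once K contains the images of its points under
  \<open>r\<close>; the hull adds these. The intersection with A covers the case of empty A, where
  \<open>r\<close> is arbitrary.\<close>

definition r_hull :: "'a set \<Rightarrow> 'a set"
  where "r_hull K = K \<union> (r ` K \<inter> A)"

definition r_closed :: "'a set \<Rightarrow> bool"
  where "r_closed K \<longleftrightarrow> r ` K \<inter> A \<subseteq> K"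

definition ext :: "('a \<Rightarrow> real) \<Rightarrow> ('a \<Rightarrow> real) \<Rightarrow> 'a \<Rightarrow> real"
  where "ext u g x = u (r x) + g x"

lemma A_subset: "A \<subseteq> topspace X"
  using closed by (rule closedin_subset)



lemma normal_XA: "normal_space XA"
  by (rule normal_space_closed_subtopology[OF normal closed])

lemma Hausdorff_XA: "Hausdorff_space XA"
  by (rule Hausdorff_space_subtopology[OF Hausdorff])

lemma r_hull: "K \<subseteq> r_hull K" "r_closed (r_hull K)"
  using r_id by (auto simp: r_hull_def r_closed_def)

lemma r_hull_compactin: "compactin X K \<Longrightarrow> compactin X (r_hull K)"
  unfolding r_hull_def by (intro compactin_Un r_compact)

lemma compactin_XA: "compactin X K \<Longrightarrow> compactin XA (K \<inter> A)"
  by (rule compactin_Int_closed[OF _ closed])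

lemma fin_supp_zero: "fin_supp g \<Longrightarrow> a \<in> A \<Longrightarrow> g a = 0"
  by (auto simp: fin_supp_def)

lemma fin_supp_continuous:
  assumes g: "fin_supp g"
  shows "continuous_map X euclideanreal g"
proof (rule continuous_map_locally_approx)
  fix x and e :: real assume x: "x \<in> topspace X" and e: "e > 0"
  let ?S = "{x. g x \<noteq> 0} - {x}"
  have "finite ?S" "?S \<subseteq> topspace X" using g by (auto simp: fin_supp_def)
  then have S: "closedin X ?S" using Hausdorff closedin_Hausdorff_finite by metis
  show "\<exists>N f. openin X N \<and> x \<in> N \<and> continuous_map X euclideanreal f \<and> (\<forall>y\<in>N. \<bar>g y - f y\<bar> \<le> e)"
  proof (cases "g x = 0")
    case True
    have "\<bar>g y - 0\<bar> \<le> e" if "y \<in> topspace X - ?S" for y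
      using that True e by auto
    then show ?thesis using S x
      by (intro exI[of _ "topspace X - ?S"] exI[of _ "\<lambda>_. 0"]) (auto intro: openin_diff)
  next
    case False
    then have "x \<in> topspace X - A" using g by (auto simp: fin_supp_def)
    then show ?thesis using isolated[of x] e
      by (intro exI[of _ "{x}"] exI[of _ "\<lambda>_. g x"]) auto
  qed
qed

lemma ext_continuous:
  assumes "u \<in> C_carrier XA" "fin_supp g"
  shows "continuous_map X euclideanreal (ext u g)"
  unfolding ext_def by (intro continuous_map_add r_cont fin_supp_continuous assms)

lemma r_close:
  assumes u: "u \<in> C_carrier XA" and w: "w \<in> C_carrier XA" and K: "r_closed K" "K \<subseteq> topspace X"
    and e: "e > 0" and uw: "\<And>a. a \<in> K \<inter> A \<Longrightarrow> \<bar>u a - w a\<bar> < e" and x: "x \<in> K"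
  shows "\<bar>u (r x) - w (r x)\<bar> < e"
proof (cases "A = {}")
  case True
  then have "u (r x) = undefined" "w (r x) = undefined"
    using u w by (auto simp: C_carrier_def extensional_def)
  then show ?thesis using e by simp
next
  case False
  then have "r x \<in> A" using r_in K(2) x by blast
  moreover from this have "r x \<in> K" using K(1) x by (auto simp: r_closed_def)
  ultimately show ?thesis using uw by blast
qed

lemma compactin_isolated_finite:
  assumes F: "compactin X F" "F \<inter> A = {}"
  shows "finite F"
proof -
  have FX: "F \<subseteq> topspace X" by (rule compactin_subset_topspace[OF F(1)])
  have "\<And>S. S \<in> (\<lambda>x. {x}) ` F \<Longrightarrow> openin X S" using isolated FX F(2) by auto
  moreover have "F \<subseteq> \<Union>((\<lambda>x. {x}) ` F)" by auto
  ultimately obtain \<C> where C: "finite \<C>" "\<C> \<subseteq> (\<lambda>x. {x}) ` F" "F \<subseteq> \<Union>\<C>"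
    using compactinD[OF F(1), of "(\<lambda>x. {x}) ` F"] by auto
  have "finite (\<Union>\<C>)" using C(1,2) by auto
  then show ?thesis using C(3) by (rule rev_finite_subset)
qed

text \<open>The difference of \<open>f\<close> and the composition of \<open>u\<close> with
  \<open>r\<close> vanishes on A, as does \<open>g\<close>. So the points of K where it differs from
  \<open>g\<close> by at least \<open>d\<close> form a compact set missing A, which is finite, and
  \<open>g\<close> is corrected only there. The third conclusion later bounds the change of
  \<open>g\<close>.\<close>

lemma fin_supp_approx:
  assumes f: "f \<in> C_carrier X" and K: "compactin X K" and d: "d > 0" and g: "fin_supp g"
  defines "u \<equiv> restrict f A"
  obtains g' where "fin_supp g'" "\<And>x. x \<in> K \<Longrightarrow> \<bar>f x - ext u g' x\<bar> < d"
    "\<And>x. g' x = g x \<or> x \<in> K \<and> g' x = f x - u (r x)"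
proof -
  have u: "u \<in> C_carrier XA"
    unfolding u_def by (rule restrict_C_carrier_subtopology[OF f A_subset])
  define k where "k x = f x - u (r x)" for x
  have kA: "k a = 0" if "a \<in> A" for a using that r_id by (simp add: k_def u_def)
  have c: "continuous_map X euclideanreal (\<lambda>x. k x - g x)"
    unfolding k_def
    by (intro continuous_map_diff C_carrier_cont[OF f] r_cont u fin_supp_continuous g)
  define F where "F = {x \<in> K. d \<le> \<bar>k x - g x\<bar>}"
  have "compactin X F" unfolding F_def by (rule compactin_abs_ge[OF c K])
  moreover have FA: "F \<inter> A = {}" using kA fin_supp_zero[OF g] d by (auto simp: F_def)
  ultimately have fF: "finite F" by (rule compactin_isolated_finite)
  have FX: "F \<subseteq> topspace X" using compactin_subset_topspace[OF K] by (auto simp: F_def)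
  define g' where "g' x = (if x \<in> F then k x else g x)" for x
  have sub: "{x. g' x \<noteq> 0} \<subseteq> F \<union> {x. g x \<noteq> 0}" by (auto simp: g'_def)
  have "fin_supp g'"
    unfolding fin_supp_def
  proof
    show "finite {x. g' x \<noteq> 0}" by (rule finite_subset[OF sub]) (use fF g in \<open>simp add: fin_supp_def\<close>)
    show "{x. g' x \<noteq> 0} \<subseteq> topspace X - A" using sub FX FA g by (auto simp: fin_supp_def)
  qed
  moreover have "\<bar>f x - ext u g' x\<bar> < d" if "x \<in> K" for x
    using that d by (auto simp: ext_def g'_def k_def F_def algebra_simps)
  moreover have "g' x = g x \<or> x \<in> K \<and> g' x = f x - u (r x)" for x
    by (auto simp: g'_def F_def k_def)
  ultimately show ?thesis by (rule that)
qed

definition valid :: "('a \<Rightarrow> real) \<Rightarrow> ('a \<Rightarrow> real) \<Rightarrow> 'a set \<Rightarrow> real \<Rightarrow> bool"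
  where "valid u g K e \<longleftrightarrow> u \<in> C_carrier XA \<and> fin_supp g \<and> compactin X K \<and> r_closed K \<and> e > 0"

text \<open>\<open>v\<close> is the target of the step. Density of W is used on a compact set M1
  containing K and M: the new function is so close to \<open>ext v g\<close> there that neither the
  correction of \<open>g\<close> nor the distance from \<open>u'\<close> to \<open>v\<close> becomes
  large on M1. Where one of them is large is the set B, which therefore misses K and M.\<close>

lemma extend_condition:
  assumes W: "openin (Ck X) W" "Ck_dense X W"
    and val: "valid u g K e" and v: "v \<in> Cball XA u (K \<inter> A) e" and d0: "d0 > 0" and M: "compactin X M"
  shows "\<exists>u' g' K' e' B. valid u' g' K' e' \<and> compactin X B \<and> B \<inter> M = {} \<and> B \<inter> K = {} \<and> K \<subseteq> K' \<and>
      e' \<le> e / 2 \<and> Cball XA u' (K' \<inter> A) e' \<subseteq> Cball XA u (K \<inter> A) e \<and>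
      Cball X (ext u' g') K' (3 * e') \<subseteq> W \<and> (\<forall>x. x \<notin> B \<longrightarrow> \<bar>g' x - g x\<bar> \<le> e / 2) \<and>
      (\<forall>a\<in>K' \<inter> A. a \<notin> B \<longrightarrow> \<bar>u' a - v a\<bar> < d0)"
proof -
  have u: "u \<in> C_carrier XA" and g: "fin_supp g" and K: "compactin X K" and rK: "r_closed K" and e: "e > 0"
    using val by (simp_all add: valid_def)
  have vC: "v \<in> C_carrier XA" and vu: "\<And>a. a \<in> K \<inter> A \<Longrightarrow> \<bar>v a - u a\<bar> < e"
    using v by (simp_all add: Cball_iff)
  have c: "continuous_map XA euclideanreal (\<lambda>a. v a - u a)"
    by (intro continuous_map_diff C_carrier_cont u vC)
  obtain d1 where d1: "d1 > 0" "\<And>a. a \<in> K \<inter> A \<Longrightarrow> \<bar>v a - u a\<bar> + d1 \<le> e"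
    by (rule compactin_slack[OF c compactin_XA[OF K] e]) (erule vu, rule that)
  \<comment> \<open>\<open>d0\<close> is the precision required off B, \<open>d1/2\<close> keeps the
    new ball inside the old one, and \<open>e/4\<close> keeps the correction of \<open>g\<close> on
    M1 below \<open>e/2\<close>.\<close>
  define d where "d = min d0 (min (d1/2) (e/4))"
  have d: "d > 0" "d \<le> d0" "2 * d \<le> d1" "2 * d \<le> e/2" using d0 d1(1) e by (auto simp: d_def)
  define M1 where "M1 = r_hull (K \<union> M)"
  have M1: "compactin X M1" "r_closed M1" "K \<subseteq> M1" "M \<subseteq> M1"
    unfolding M1_def using r_hull(1)[of "K \<union> M"] r_hull(2) K M by (auto intro!: r_hull_compactin compactin_Un)
  have M1X: "M1 \<subseteq> topspace X" by (rule compactin_subset_topspace[OF M1(1)])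
  define f where "f = restrict (ext v g) (topspace X)"
  have f: "f \<in> C_carrier X"
    unfolding f_def by (intro restrict_C_carrier ext_continuous vC g)
  obtain f' where f': "f' \<in> W" "f' \<in> Cball X f M1 d" using Ck_denseD[OF W(2) f M1(1) d(1)] by blast
  have f'C: "f' \<in> C_carrier X" using f'(2) by (simp add: Cball_iff)
  have f'f: "\<bar>f' x - ext v g x\<bar> < d" if "x \<in> M1" for x
  proof -
    have "f x = ext v g x" using that M1X by (auto simp: f_def)
    moreover have "\<bar>f' x - f x\<bar> < d" using f'(2) that by (simp add: Cball_iff)
    ultimately show ?thesis by simp
  qed
  have "\<exists>K1 c. compactin X K1 \<and> c > 0 \<and> Cball X f' K1 c \<subseteq> W"
    using W(1) f'(1) unfolding openin_Ck_iff by simp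
  then obtain K1 c where K1: "compactin X K1" "c > 0" "Cball X f' K1 c \<subseteq> W" by (elim exE conjE)
  define u' where "u' = restrict f' A"
  have u': "u' \<in> C_carrier XA"
    unfolding u'_def by (rule restrict_C_carrier_subtopology[OF f'C A_subset])
  define K' where "K' = r_hull (M1 \<union> K1)"
  have K': "compactin X K'" "r_closed K'" "M1 \<subseteq> K'" "K1 \<subseteq> K'"
    unfolding K'_def using r_hull(1)[of "M1 \<union> K1"] r_hull(2) K1(1) M1(1)
    by (auto intro!: r_hull_compactin compactin_Un)
  have K'X: "K' \<subseteq> topspace X" by (rule compactin_subset_topspace[OF K'(1)])
  \<comment> \<open>\<open>e/2\<close> makes the radii tend to 0 along branches, \<open>c/8\<close>
    gives \<open>3 * e' + c/8 < c\<close>, and \<open>d\<close> lets \<open>e' + d\<close> fit into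
    the slack \<open>d1\<close>.\<close>
  define e' where "e' = min (e/2) (min (c/8) d)"
  have e': "e' > 0" "e' \<le> e/2" "e' \<le> c/8" "e' \<le> d" using e K1(2) d(1) by (auto simp: e'_def)
  have "c/8 > 0" using K1(2) by simp
  then obtain g' where g': "fin_supp g'" "\<And>x. x \<in> K' \<Longrightarrow> \<bar>f' x - ext u' g' x\<bar> < c/8"
    "\<And>x. g' x = g x \<or> x \<in> K' \<and> g' x = f' x - u' (r x)"
    using fin_supp_approx[OF f'C K'(1) _ g] unfolding u'_def by metis
  have u'v: "\<bar>u' a - v a\<bar> < d" if "a \<in> M1 \<inter> A" for a
    using f'f[of a] that fin_supp_zero[OF g] r_id by (simp add: u'_def ext_def)
  define B1 where "B1 = {x \<in> K'. e/2 \<le> \<bar>f' x - u' (r x) - g x\<bar>}"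
  define B2 where "B2 = {a \<in> K' \<inter> A. d \<le> \<bar>u' a - v a\<bar>}"
  have "compactin X B1" unfolding B1_def
    by (intro compactin_abs_ge K'(1) continuous_map_diff C_carrier_cont[OF f'C] r_cont u' fin_supp_continuous g)
  moreover have "compactin XA B2" unfolding B2_def
    by (intro compactin_abs_ge compactin_XA K'(1) continuous_map_diff C_carrier_cont u' vC)
  ultimately have B: "compactin X (B1 \<union> B2)" by (simp add: compactin_Un compactin_subtopology)
  have BM1: "x \<notin> B1 \<union> B2" if x: "x \<in> M1" for x
  proof -
    have "\<bar>u' (r x) - v (r x)\<bar> < d" by (rule r_close[OF u' vC M1(2) M1X d(1) u'v x])
    moreover have "\<bar>f' x - (v (r x) + g x)\<bar> < d" using f'f[OF x] by (simp add: ext_def)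
    ultimately have "\<bar>f' x - u' (r x) - g x\<bar> < e/2" using d(4) by linarith
    then show ?thesis using u'v[of x] x by (auto simp: B1_def B2_def)
  qed
  have "Cball XA u' (K' \<inter> A) e' \<subseteq> Cball XA u (K \<inter> A) e"
  proof
    fix z assume z: "z \<in> Cball XA u' (K' \<inter> A) e'"
    have "\<bar>z a - u a\<bar> < e" if a: "a \<in> K \<inter> A" for a
    proof -
      have "\<bar>z a - u' a\<bar> < e'" using z a M1(3) K'(3) by (auto simp: Cball_iff)
      moreover have "\<bar>u' a - v a\<bar> < d" using u'v[of a] a M1(3) by auto
      ultimately show ?thesis using d1(2)[OF a] d(3) e'(4) by linarith
    qed
    then show "z \<in> Cball XA u (K \<inter> A) e" using z by (simp add: Cball_iff)
  qed
  moreover have "Cball X (ext u' g') K' (3 * e') \<subseteq> W"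
  proof
    fix h assume h: "h \<in> Cball X (ext u' g') K' (3 * e')"
    have "\<bar>h x - f' x\<bar> < c" if x: "x \<in> K1" for x
    proof -
      have "x \<in> K'" using x K'(4) by blast
      then have "\<bar>h x - ext u' g' x\<bar> < 3 * e'" "\<bar>f' x - ext u' g' x\<bar> < c/8"
        using h g'(2) by (simp_all add: Cball_iff)
      then show ?thesis using e'(3) K1(2) by linarith
    qed
    then have "h \<in> Cball X f' K1 c" using h by (simp add: Cball_iff)
    then show "h \<in> W" using K1(3) by blast
  qed
  moreover have "\<bar>g' x - g x\<bar> \<le> e/2" if "x \<notin> B1 \<union> B2" for x
    using g'(3)[of x] that e by (auto simp: B1_def)
  moreover have "\<bar>u' a - v a\<bar> < d0" if "a \<in> K' \<inter> A" "a \<notin> B1 \<union> B2" for a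
    using that d(2) by (auto simp: B2_def)
  moreover have "valid u' g' K' e'" using u' g'(1) K'(1,2) e'(1) by (simp add: valid_def)
  moreover have "(B1 \<union> B2) \<inter> M = {}" "(B1 \<union> B2) \<inter> K = {}" "K \<subseteq> K'" using BM1 M1(3,4) K'(3) by auto
  ultimately show ?thesis using B e'(2)
    by (intro exI[of _ u'] exI[of _ g'] exI[of _ K'] exI[of _ e'] exI[of _ "B1 \<union> B2"]) simp
qed

end

section \<open>Fusion along a branch of the tree of conditions\<close>

context isolated_complement
begin

lemma Baire_Ck_extend:
  assumes M: "Moving_Off_Property X" and BA: "Baire_space (Ck XA)"
    and S: "countable S" "Ck_dense XA S"
  shows "Baire_space (Ck X)"
  unfolding Baire_Ck_iff
proof (intro allI impI)
  fix W :: "nat \<Rightarrow> ('a \<Rightarrow> real) set"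
  assume W: "\<forall>n. openin (Ck X) (W n) \<and> Ck_dense X (W n)"
  show "Ck_dense X (\<Inter>n. W n)"
    unfolding Ck_dense_def
  proof (intro allI impI)
    fix f0 K0 and e0 :: real assume f0: "f0 \<in> C_carrier X" and K0: "compactin X K0" and e0: "e0 > 0"
    have "restrict f0 A \<in> C_carrier XA" by (rule restrict_C_carrier_subtopology[OF f0 A_subset])
    then obtain s where "s \<in> S" using Ck_denseD[OF S(2) _ compactin_empty zero_less_one] by blast
    then have S_ne: "S \<noteq> {}" by blast
    define ws where "ws = from_nat_into S"
    \<comment> \<open>The instruction i codes a pair (j, k): aim at the j-th function of the dense
      set with precision \<open>1 / 2 ^ k\<close>. If that target is outside the current ball, the
      center \<open>u\<close> replaces it, so the step is always legitimate.\<close>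
    define choice_at where "choice_at u K e i =
        (if ws (fst (prod_decode i)) \<in> Cball XA u (K \<inter> A) e then ws (fst (prod_decode i)) else u)"
      for u K e i
    \<comment> \<open>The later changes amount to one radius for the function on A and one for the
      limit of the \<open>g\<close>; the factor 3 leaves a margin.\<close>
    define R where "R = (\<lambda>(n, u, g, K, e) i (n', u', g', K', e') B.
        n' = Suc n \<and> K \<subseteq> K' \<and> e' \<le> e / 2 \<and> Cball XA u' (K' \<inter> A) e' \<subseteq> Cball XA u (K \<inter> A) e \<and>
        Cball X (ext u' g') K' (3 * e') \<subseteq> W n \<and> B \<inter> K = {} \<and> (\<forall>x. x \<notin> B \<longrightarrow> \<bar>g' x - g x\<bar> \<le> e / 2) \<and>
        (\<forall>a\<in>K' \<inter> A. a \<notin> B \<longrightarrow> \<bar>u' a - choice_at u K e i a\<bar> < 1 / 2 ^ snd (prod_decode i)))"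
    define V where "V = {(n::nat, u, g, K, e). valid u g K e}"
    let ?u0 = "restrict f0 A"
    have "fin_supp (\<lambda>_. 0)" by (simp add: fin_supp_def)
    moreover have "compactin X (r_hull K0)" by (rule r_hull_compactin[OF K0])
    \<comment> \<open>A quarter, because the limit stays within three radii of the root condition,
      which is itself within one radius of \<open>f0\<close> on \<open>K0\<close>.\<close>
    moreover have "e0/4 > 0" using e0 by simp
    ultimately obtain g0 where g0: "fin_supp g0" "\<And>x. x \<in> r_hull K0 \<Longrightarrow> \<bar>f0 x - ext ?u0 g0 x\<bar> < e0/4"
      using fin_supp_approx[OF f0] by metis
    define \<sigma>0 where "\<sigma>0 = (0::nat, ?u0, g0, r_hull K0, e0/4)"
    have V0: "\<sigma>0 \<in> V"
      using g0(1) e0 r_hull(2) r_hull_compactin[OF K0] restrict_C_carrier_subtopology[OF f0 A_subset]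
      by (simp add: V_def \<sigma>0_def valid_def)
    have step: "\<exists>\<sigma>'\<in>V. \<exists>B. compactin X B \<and> B \<inter> L = {} \<and> R \<sigma> i \<sigma>' B"
      if \<sigma>: "\<sigma> \<in> V" and L: "compactin X L" for \<sigma> i L
    proof -
      obtain n u g K e where s: "\<sigma> = (n, u, g, K, e)" by (cases \<sigma>)
      have val: "valid u g K e" using \<sigma> s by (simp add: V_def)
      have "u \<in> Cball XA u (K \<inter> A) e" using val by (simp add: valid_def Cball_iff)
      then have v: "choice_at u K e i \<in> Cball XA u (K \<inter> A) e" by (simp add: choice_at_def)
      have "(1::real) / 2 ^ snd (prod_decode i) > 0" by simp
      from extend_condition[OF W[rule_format, THEN conjunct1] W[rule_format, THEN conjunct2] val v this L, of n]
      obtain u' g' K' e' B where "valid u' g' K' e'" "compactin X B" "B \<inter> L = {}"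
        "B \<inter> K = {}" "K \<subseteq> K'" "e' \<le> e / 2" "Cball XA u' (K' \<inter> A) e' \<subseteq> Cball XA u (K \<inter> A) e"
        "Cball X (ext u' g') K' (3 * e') \<subseteq> W n" "\<forall>x. x \<notin> B \<longrightarrow> \<bar>g' x - g x\<bar> \<le> e / 2"
        "\<forall>a\<in>K' \<inter> A. a \<notin> B \<longrightarrow> \<bar>u' a - choice_at u K e i a\<bar> < 1 / 2 ^ snd (prod_decode i)"
        by (elim exE conjE)
      then have "(Suc n, u', g', K', e') \<in> V" "compactin X B" "B \<inter> L = {}"
        "R \<sigma> i (Suc n, u', g', K', e') B"
        by (simp_all add: V_def R_def s)
      then show ?thesis by blast
    qed
    have "\<exists>\<tau> B. \<tau> [] = \<sigma>0 \<and> (\<forall>t. \<tau> t \<in> V) \<and> (\<forall>t i. R (\<tau> t) i (\<tau> (i # t)) (B (i # t))) \<and> loc_finite X B"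
      by (rule Moving_Off_tree[OF M V0 step])
    then obtain \<tau> B where \<tau>0: "\<tau> [] = \<sigma>0" and \<tau>V: "\<forall>t. \<tau> t \<in> V"
      and \<tau>R: "\<forall>t i. R (\<tau> t) i (\<tau> (i # t)) (B (i # t))" and B: "loc_finite X B" by (elim exE conjE)
    define N u g K e where "N t = fst (\<tau> t)" and "u t = fst (snd (\<tau> t))" and "g t = fst (snd (snd (\<tau> t)))"
      and "K t = fst (snd (snd (snd (\<tau> t))))" and "e t = snd (snd (snd (snd (\<tau> t))))" for t
    have \<tau>_eq: "\<tau> t = (N t, u t, g t, K t, e t)" for t
      by (simp add: N_def u_def g_def K_def e_def)
    have "N [] = 0 \<and> u [] = ?u0 \<and> g [] = g0 \<and> K [] = r_hull K0 \<and> e [] = e0/4"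
      using \<tau>0 unfolding \<tau>_eq \<sigma>0_def by simp
    then have root: "N [] = 0" "u [] = ?u0" "g [] = g0" "K [] = r_hull K0" "e [] = e0/4" by simp_all
    have "valid (u t) (g t) (K t) (e t)" for t
      using \<tau>V[rule_format, of t] unfolding \<tau>_eq V_def by simp
    then have val: "\<And>t. u t \<in> C_carrier XA" "\<And>t. fin_supp (g t)" "\<And>t. compactin X (K t)"
      "\<And>t. r_closed (K t)" "\<And>t. e t > 0" by (simp_all add: valid_def)
    define p where "p t = Cball XA (u t) (K t \<inter> A) (e t)" for t
    have RR: "N (i # t) = Suc (N t)" "K t \<subseteq> K (i # t)" "e (i # t) \<le> e t / 2" "p (i # t) \<subseteq> p t"
      "Cball X (ext (u (i # t)) (g (i # t))) (K (i # t)) (3 * e (i # t)) \<subseteq> W (N t)"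
      "B (i # t) \<inter> K t = {}" "\<And>x. x \<notin> B (i # t) \<Longrightarrow> \<bar>g (i # t) x - g t x\<bar> \<le> e t / 2"
      "\<And>a. a \<in> K (i # t) \<Longrightarrow> a \<in> A \<Longrightarrow> a \<notin> B (i # t) \<Longrightarrow>
        \<bar>u (i # t) a - choice_at (u t) (K t) (e t) i a\<bar> < 1 / 2 ^ snd (prod_decode i)" for i t
      using \<tau>R[rule_format, of t i] unfolding \<tau>_eq R_def p_def by simp_all
    \<comment> \<open>For a function in \<open>p t\<close>, lying in \<open>D t\<close> means lying
      in the projection of a child. The complement of the closure is added so that
      \<open>D t\<close> can be dense in the whole space.\<close>
    define D where "D t = (topspace (Ck XA) - Ck XA closure_of p t) \<union> (\<Union>i. p (i # t))" for t
    have p_open: "openin (Ck XA) (p t)" for t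
      unfolding p_def by (intro openin_Cball val compactin_XA)
    have D_open: "openin (Ck XA) (D t)" for t
      unfolding D_def by (intro openin_Un openin_diff openin_topspace closedin_closure_of openin_Union)
        (auto intro: p_open)
    have D_dense: "Ck_dense XA (D t)" for t
      unfolding Ck_dense_def
    proof (intro allI impI)
      fix f L and c :: real assume f: "f \<in> C_carrier XA" and L: "compactin XA L" and c: "c > 0"
      show "\<exists>h\<in>D t. h \<in> Cball XA f L c"
      proof (cases "p t \<inter> Cball XA f L c = {}")
        case True
        have ff: "f \<in> Cball XA f L c" using f c by (simp add: Cball_iff)
        have "f \<notin> Ck XA closure_of p t"
          by (rule not_in_closure_of[OF openin_Cball[OF f L c] ff]) (use True in blast)
        then have "f \<in> D t" using f by (simp add: D_def topspace_Ck)
        then show ?thesis using ff by blast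
      next
        case False
        then obtain z where z: "z \<in> p t \<inter> Cball XA f L c" by blast
        have "openin (Ck XA) (p t \<inter> Cball XA f L c)" by (intro openin_Int p_open openin_Cball f L c)
        then have "\<exists>L1 \<eta>. compactin XA L1 \<and> \<eta> > 0 \<and> Cball XA z L1 \<eta> \<subseteq> p t \<inter> Cball XA f L c"
          using z unfolding openin_Ck_iff by simp
        then obtain L1 \<eta> where L1: "compactin XA L1" "\<eta> > 0" "Cball XA z L1 \<eta> \<subseteq> p t \<inter> Cball XA f L c"
          by (elim exE conjE)
        have zC: "z \<in> C_carrier XA" using z by (simp add: Cball_iff)
        have "\<eta> / 3 > 0" using L1(2) by simp
        then obtain w where w: "w \<in> S" "w \<in> Cball XA z L1 (\<eta> / 3)" using Ck_denseD[OF S(2) zC L1(1)] by blast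
        obtain j where j: "w = ws j" using from_nat_into_surj[OF S(1) w(1)] by (auto simp: ws_def)
        have "w \<in> Cball XA z L1 \<eta>" using w(2) L1(2) by (fastforce simp: Cball_iff)
        then have wp: "w \<in> p t" using L1(3) by blast
        have L1X: "compactin X L1" "L1 \<subseteq> A" using L1(1) by (simp_all add: compactin_subtopology)
        have "finite {s. B s \<inter> L1 \<noteq> {}}" by (rule loc_finite_compactin[OF B L1X(1)])
        \<comment> \<open>For the fixed target j, different k give different nodes, so only finitely
          many k have a set B that meets L1. Any larger k is safe, and can also be taken large
          enough to bring the precision below \<open>\<eta> / 3\<close>.\<close>
        then have "finite ((\<lambda>k. prod_encode (j, k) # t) -` {s. B s \<inter> L1 \<noteq> {}})"
          by (rule finite_vimageI) (simp add: inj_def)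
        then obtain k0 where k0: "\<forall>k\<in>((\<lambda>k. prod_encode (j, k) # t) -` {s. B s \<inter> L1 \<noteq> {}}). k < k0"
          using finite_nat_set_iff_bounded by auto
        obtain k1 where k1: "(1/2::real) ^ k1 < \<eta> / 3"
          using real_arch_pow_inv[of "\<eta>/3" "1/2"] L1(2) by auto
        define k where "k = max k0 k1"
        have "(1/2::real) ^ k \<le> (1/2) ^ k1" by (rule power_decreasing) (simp_all add: k_def)
        then have k: "1 / 2 ^ k < \<eta> / 3" using k1 by (simp add: power_one_over)
        define i where "i = prod_encode (j, k)"
        have BL1: "B (i # t) \<inter> L1 = {}"
        proof (rule ccontr)
          assume "B (i # t) \<inter> L1 \<noteq> {}"
          then have "k < k0" using k0 by (simp add: i_def)
          then show False by (simp add: k_def)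
        qed
        have ci: "choice_at (u t) (K t) (e t) i = w"
          using wp j by (simp add: choice_at_def i_def p_def)
        have near: "\<bar>u (i # t) a - z a\<bar> < \<eta>" if a: "a \<in> L1" "a \<in> K (i # t) \<inter> A" for a
        proof -
          have "a \<notin> B (i # t)" using BL1 a(1) by blast
          then have "\<bar>u (i # t) a - w a\<bar> < 1 / 2 ^ k"
            using RR(8)[of a i t] a(2) ci by (simp add: i_def)
          moreover have "\<bar>w a - z a\<bar> < \<eta> / 3" using w(2) a(1) by (simp add: Cball_iff)
          ultimately show ?thesis using k L1(2) by linarith
        qed
        have cl: "closedin XA (K (i # t) \<inter> A)"
          by (rule compactin_imp_closedin[OF Hausdorff_XA compactin_XA[OF val(3)]])
        \<comment> \<open>On L1 the center of the child is within \<open>\<eta>\<close> of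
          \<open>z\<close>, so its values on the child's compact set extend to a function that stays
          in the ball around \<open>z\<close>.\<close>
        obtain h where h: "h \<in> Cball XA z L1 \<eta>" "\<And>x. x \<in> K (i # t) \<inter> A \<Longrightarrow> h x = u (i # t) x"
          by (rule Ck_extend[OF normal_XA Hausdorff_XA cl zC
                continuous_map_from_subtopology[OF C_carrier_cont[OF val(1)[of "i # t"]]] L1(1,2)])
            (erule (1) near, rule that)
        have "h \<in> p (i # t)" using h val(5)[of "i # t"] by (simp add: p_def Cball_iff)
        then have "h \<in> D t" by (auto simp: D_def)
        then show ?thesis using h(1) L1(3) by blast
      qed
    qed
    obtain z where z0: "z \<in> Cball XA (u []) (K [] \<inter> A) (e [])" and zD: "\<And>t. t \<in> UNIV \<Longrightarrow> z \<in> D t"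
      using Baire_Ck_countable[OF BA countableI_type[of UNIV], where G = D, OF D_open D_dense
          val(1)[of "[]"] compactin_XA[OF val(3)[of "[]"]] val(5)[of "[]"]] by metis
    have zC: "z \<in> C_carrier XA" using z0 by (simp add: Cball_iff)
    have next_i: "\<exists>i. z \<in> p (i # t)" if zt: "z \<in> p t" for t
    proof -
      have "p t \<subseteq> Ck XA closure_of p t" by (intro closure_of_subset openin_subset p_open)
      then show ?thesis using zD[of t] zt by (auto simp: D_def)
    qed
    \<comment> \<open>The branch follows children whose projections contain \<open>z\<close>. Lists
      grow at the head, so \<open>b n\<close> has length n and \<open>b\<close> is
      injective.\<close>
    define b where "b = rec_nat [] (\<lambda>_ t. (SOME i. z \<in> p (i # t)) # t)"
    have b0: "b 0 = []" by (simp add: b_def)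
    have bS: "\<exists>i. b (Suc n) = i # b n" for n by (simp add: b_def)
    have zb: "z \<in> p (b n)" for n
    proof (induction n)
      case 0
      then show ?case using z0 by (simp add: b0 p_def)
    next
      case (Suc n)
      have "b (Suc n) = (SOME i. z \<in> p (i # b n)) # b n" by (simp add: b_def)
      then show ?case using someI_ex[OF next_i[OF Suc]] by simp
    qed
    have lb: "length (b n) = n" for n by (induction n) (simp_all add: b_def)
    have Nb: "N (b n) = n" for n
    proof (induction n)
      case 0
      then show ?case by (simp add: b0 root)
    next
      case (Suc n)
      obtain i where "b (Suc n) = i # b n" using bS by blast
      then show ?case using Suc RR(1) by simp
    qed
    have bK: "K (b n) \<subseteq> K (b (Suc n))" and be: "e (b (Suc n)) \<le> e (b n) / 2"
      and bW: "Cball X (ext (u (b (Suc n))) (g (b (Suc n)))) (K (b (Suc n))) (3 * e (b (Suc n))) \<subseteq> W n"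
      and bB: "B (b (Suc n)) \<inter> K (b n) = {}"
      and bg: "\<And>x. x \<notin> B (b (Suc n)) \<Longrightarrow> \<bar>g (b (Suc n)) x - g (b n) x\<bar> \<le> e (b n) / 2" for n
    proof -
      obtain i where i: "b (Suc n) = i # b n" using bS by blast
      show "K (b n) \<subseteq> K (b (Suc n))" "e (b (Suc n)) \<le> e (b n) / 2"
        "Cball X (ext (u (b (Suc n))) (g (b (Suc n)))) (K (b (Suc n))) (3 * e (b (Suc n))) \<subseteq> W n"
        "B (b (Suc n)) \<inter> K (b n) = {}"
        "\<And>x. x \<notin> B (b (Suc n)) \<Longrightarrow> \<bar>g (b (Suc n)) x - g (b n) x\<bar> \<le> e (b n) / 2"
        unfolding i using RR(2)[of "b n" i] RR(3,6)[of i "b n"] RR(5)[of i "b n"] RR(7)[of _ i "b n"] Nb by simp_all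
    qed
    \<comment> \<open>Each step changes \<open>g\<close> by at most \<open>e (b k) / 2\<close>,
      which is at most \<open>e (b k) - e (b (Suc k))\<close> because the radii at least halve;
      these bounds telescope.\<close>
    have tel: "\<bar>g (b k) x - g (b m) x\<bar> \<le> e (b m) - e (b k)"
      if "m \<le> k" "\<And>l. m < l \<Longrightarrow> l \<le> k \<Longrightarrow> x \<notin> B (b l)" for m k x
      using that
    proof (induction k rule: dec_induct)
      case base
      then show ?case by simp
    next
      case (step k)
      have "x \<notin> B (b (Suc k))" using step.prems step.hyps by simp
      from bg[OF this] have "\<bar>g (b (Suc k)) x - g (b k) x\<bar> \<le> e (b k) / 2" .
      moreover have "\<bar>g (b k) x - g (b m) x\<bar> \<le> e (b m) - e (b k)" using step by simp
      ultimately show ?case using be[of k] by linarith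
    qed
    have e_lim: "\<exists>m\<ge>m0. e (b m) < c" if c: "c > 0" for c m0
    proof -
      have bound: "e (b m) \<le> e (b 0) * (1/2) ^ m" for m
      proof (induction m)
        case (Suc m)
        then show ?case using be[of m] by simp
      qed simp
      have pos: "e (b 0) > 0" by (rule val(5))
      obtain k where k: "(1/2::real) ^ k < c / e (b 0)"
        using real_arch_pow_inv[of "c / e (b 0)" "1/2"] c pos by auto
      have "(1/2::real) ^ max m0 k \<le> (1/2) ^ k" by (rule power_decreasing) simp_all
      then have "(1/2::real) ^ max m0 k < c / e (b 0)" using k by linarith
      then have "e (b 0) * (1/2) ^ max m0 k < c" using pos by (simp add: field_simps)
      then have "e (b (max m0 k)) < c" using bound[of "max m0 k"] by linarith
      then show ?thesis by (intro exI[of _ "max m0 k"]) simp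
    qed
    \<comment> \<open>The nodes of the branch are distinct, so some neighborhood of x meets only
      finitely many of their sets B. On it the later functions \<open>g\<close> converge
      uniformly.\<close>
    have eventually_out: "\<exists>Nx m. openin X Nx \<and> x \<in> Nx \<and> (\<forall>l>m. B (b l) \<inter> Nx = {})"
      if x: "x \<in> topspace X" for x
    proof -
      obtain Nx where Nx: "openin X Nx" "x \<in> Nx" "finite {t. B t \<inter> Nx \<noteq> {}}"
        using loc_finiteD[OF B x] by (elim exE conjE)
      have "inj b" using lb by (metis injI)
      then have "finite (b -` {t. B t \<inter> Nx \<noteq> {}})" by (rule finite_vimageI[OF Nx(3)])
      then obtain m where "\<forall>l\<in>b -` {t. B t \<inter> Nx \<noteq> {}}. l < m" using finite_nat_set_iff_bounded by auto
      then have "\<forall>l>m. B (b l) \<inter> Nx = {}" by force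
      then show ?thesis using Nx by blast
    qed
    \<comment> \<open>\<open>lim\<close> is total; the sequence converges at every point that lies
      outside all later sets B from some stage on, in particular at every point of X.\<close>
    define gl where "gl x = lim (\<lambda>n. g (b n) x)" for x
    have gl: "\<bar>gl x - g (b m) x\<bar> \<le> e (b m)" if out: "\<And>l. m < l \<Longrightarrow> x \<notin> B (b l)" for m x
    proof -
      have "Cauchy (\<lambda>n. g (b n) x)"
      proof (rule metric_CauchyI)
        fix c :: real assume "c > 0"
        then have "c / 2 > 0" by simp
        from e_lim[OF this, of m] obtain q where q: "q \<ge> m" "e (b q) < c / 2" by blast
        have "\<bar>g (b k) x - g (b q) x\<bar> < c / 2" if "k \<ge> q" for k
        proof -
          have "\<bar>g (b k) x - g (b q) x\<bar> \<le> e (b q) - e (b k)" using that out q(1) by (intro tel) auto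
          then show ?thesis using q(2) val(5)[of "b k"] by linarith
        qed
        then have "dist (g (b k) x) (g (b l) x) < c" if "k \<ge> q" "l \<ge> q" for k l
          using that unfolding dist_real_def by (smt (verit, best) field_sum_of_halves)
        then show "\<exists>q. \<forall>k\<ge>q. \<forall>l\<ge>q. dist (g (b k) x) (g (b l) x) < c" by blast
      qed
      then have "(\<lambda>n. g (b n) x) \<longlonglongrightarrow> gl x"
        unfolding gl_def using Cauchy_convergent convergent_LIMSEQ_iff by blast
      then have "(\<lambda>n. \<bar>g (b n) x - g (b m) x\<bar>) \<longlonglongrightarrow> \<bar>gl x - g (b m) x\<bar>"
        by (intro tendsto_intros)
      moreover have "\<exists>q. \<forall>n\<ge>q. \<bar>g (b n) x - g (b m) x\<bar> \<le> e (b m)"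
      proof (intro exI[of _ m] allI impI)
        fix n assume "m \<le> n"
        then have "\<bar>g (b n) x - g (b m) x\<bar> \<le> e (b m) - e (b n)" using out by (intro tel) auto
        then show "\<bar>g (b n) x - g (b m) x\<bar> \<le> e (b m)" using val(5)[of "b n"] by linarith
      qed
      ultimately show ?thesis by (rule LIMSEQ_le_const2)
    qed
    have cont: "continuous_map X euclideanreal (\<lambda>x. z (r x) + gl x)"
    proof (rule continuous_map_locally_approx)
      fix x and c :: real assume x: "x \<in> topspace X" and c: "c > 0"
      obtain Nx m where Nx: "openin X Nx" "x \<in> Nx" "\<forall>l>m. B (b l) \<inter> Nx = {}"
        using eventually_out[OF x] by (elim exE conjE)
      obtain q where q: "q \<ge> m" "e (b q) < c" using e_lim[OF c] by blast
      have "\<bar>(z (r y) + gl y) - ext z (g (b q)) y\<bar> \<le> c" if y: "y \<in> Nx" for y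
      proof -
        have "y \<notin> B (b l)" if "q < l" for l
        proof -
          have "B (b l) \<inter> Nx = {}" using Nx(3) q(1) that by simp
          then show ?thesis using y by blast
        qed
        then have "\<bar>gl y - g (b q) y\<bar> \<le> e (b q)" by (rule gl)
        then show ?thesis using q(2) by (simp add: ext_def)
      qed
      then show "\<exists>N f. openin X N \<and> x \<in> N \<and> continuous_map X euclideanreal f \<and>
          (\<forall>y\<in>N. \<bar>(z (r y) + gl y) - f y\<bar> \<le> c)"
        using Nx ext_continuous[OF zC val(2)] by blast
    qed
    define h where "h = restrict (\<lambda>x. z (r x) + gl x) (topspace X)"
    have hC: "h \<in> C_carrier X" unfolding h_def by (rule restrict_C_carrier[OF cont])
    have h_in: "h \<in> Cball X (ext (u (b n)) (g (b n))) (K (b n)) (3 * e (b n))" for n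
    proof -
      have KX: "K (b n) \<subseteq> topspace X" by (rule compactin_subset_topspace[OF val(3)])
      have "\<bar>h x - ext (u (b n)) (g (b n)) x\<bar> < 3 * e (b n)" if x: "x \<in> K (b n)" for x
      proof -
        have zu: "\<And>a. a \<in> K (b n) \<inter> A \<Longrightarrow> \<bar>z a - u (b n) a\<bar> < e (b n)"
          using zb[of n] by (simp add: p_def Cball_iff)
        have "\<bar>z (r x) - u (b n) (r x)\<bar> < e (b n)"
          by (rule r_close[OF zC val(1) val(4) KX val(5) zu x])
        \<comment> \<open>The compact sets increase along the branch and each B misses the compact
          set of its parent, so no later exceptional set contains a point of
          \<open>K (b n)\<close>.\<close>
        moreover have "x \<notin> B (b l)" if nl: "n < l" for l
        proof -
          obtain k where k: "l = Suc k" "n \<le> k" using nl by (cases l) auto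
          have "K (b n) \<subseteq> K (b k)" using lift_Suc_mono_le[of "\<lambda>n. K (b n)"] bK k(2) by blast
          then show ?thesis using bB[of k] x k(1) by auto
        qed
        then have "\<bar>gl x - g (b n) x\<bar> \<le> e (b n)" by (rule gl)
        moreover have "h x = z (r x) + gl x" using x KX by (auto simp: h_def)
        ultimately show ?thesis using val(5)[of "b n"] by (simp add: ext_def)
      qed
      then show ?thesis using hC by (simp add: Cball_iff)
    qed
    have "h \<in> W n" for n using h_in[of "Suc n"] bW[of n] by blast
    moreover have "h \<in> Cball X f0 K0 e0"
    proof -
      have "\<bar>h x - f0 x\<bar> < e0" if "x \<in> K0" for x
      proof -
        have x: "x \<in> r_hull K0" using that r_hull(1) by blast
        then have "\<bar>h x - ext ?u0 g0 x\<bar> < 3 * (e0 / 4)"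
          using h_in[of 0] by (simp add: b0 root Cball_iff)
        then show ?thesis using g0(2)[OF x] by linarith
      qed
      then show ?thesis using hC by (simp add: Cball_iff)
    qed
    ultimately show "\<exists>h\<in>\<Inter>n. W n. h \<in> Cball X f0 K0 e0" by blast
  qed
qed

end

section \<open>Adding one layer of isolated points, and induction along the derived sets\<close>

lemma stratifiable_isolated_complement:
  assumes X: "stratifiable X" and A: "closedin X A" and iso: "\<And>x. x \<in> topspace X - A \<Longrightarrow> openin X {x}"
  shows "\<exists>r. isolated_complement X A r"
proof (cases "A = {}")
  case True
  have "continuous_map X euclideanreal (\<lambda>x. u (id x))" if "u \<in> C_carrier (subtopology X A)" for u
  proof -
    have "u = (\<lambda>x. undefined)" using that True by (simp add: C_carrier_def)
    then show ?thesis by simp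
  qed
  then have "isolated_complement X A id"
    using True X A iso by unfold_locales (simp_all add: stratifiable_normal stratifiable_Hausdorff)
  then show ?thesis by (intro exI[of _ id])
next
  case False
  obtain U where U: "stratification X U" using stratifiable_imp_stratification[OF X] by blast
  have "\<exists>r. continuous_map X X r \<and> r ` topspace X \<subseteq> A \<and> (\<forall>a\<in>A. r a = a)"
    by (rule stratification_retraction[OF U A False iso])
  then obtain r where r: "continuous_map X X r" "r ` topspace X \<subseteq> A" "\<forall>a\<in>A. r a = a"
    by (elim exE conjE)
  have rA: "continuous_map X (subtopology X A) r"
    using r(1,2) by (simp add: continuous_map_in_subtopology image_subset_iff_funcset)
  have "isolated_complement X A r"
  proof
    show "normal_space X" "Hausdorff_space X" "closedin X A"
      using X A by (simp_all add: stratifiable_normal stratifiable_Hausdorff)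
    show "\<And>x. x \<in> topspace X - A \<Longrightarrow> openin X {x}" by (rule iso)
    show "r x \<in> A" if "x \<in> topspace X" for x using r(2) that by blast
    show "r a = a" if "a \<in> A" for a using r(3) that by blast
    show "continuous_map X euclideanreal (\<lambda>x. u (r x))" if "u \<in> C_carrier (subtopology X A)" for u
      using continuous_map_compose[OF rA C_carrier_cont[OF that]] by (simp add: o_def)
    show "compactin X (r ` K \<inter> A)" if "compactin X K" for K
      by (rule compact_Int_closedin[OF image_compactin[OF that r(1)] A])
  qed
  then show ?thesis by (intro exI[of _ r])
qed

text \<open>The fusion needs a countable dense set of functions, so it is run in the closure Z of a
  countable set. There \<open>A \<inter> Z\<close> is closed in A and inherits the Baire property,
  and the rest of Z still consists of isolated points.\<close>

lemma Baire_Ck_isolated_complement: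
  assumes X: "stratifiable X" and M: "Moving_Off_Property X" and A: "closedin X A"
    and iso: "\<And>x. x \<in> topspace X - A \<Longrightarrow> openin X {x}"
    and B: "Baire_space (Ck (subtopology X A))"
  shows "Baire_space (Ck X)"
proof (rule Baire_Ck_if_separable_subspaces[OF X])
  fix Q assume Q: "countable Q" "Q \<subseteq> topspace X"
  define Z where "Z = X closure_of Q"
  have Z: "closedin X Z" unfolding Z_def by (rule closedin_closure_of)
  have ZX: "Z \<subseteq> topspace X" using Z by (rule closedin_subset)
  let ?Z = "subtopology X Z"
  have sZ: "stratifiable ?Z" by (rule stratifiable_closed_subspace[OF X Z])
  have AZ: "closedin X (A \<inter> Z)" using A Z by (rule closedin_Int)
  have cAZ: "closedin ?Z (A \<inter> Z)"
    using AZ closedin_subset_topspace[of X "A \<inter> Z" Z] by simp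
  have eq: "subtopology ?Z (A \<inter> Z) = subtopology X (A \<inter> Z)"
    by (simp add: subtopology_subtopology Int_commute Int_left_commute)
  have eqA: "subtopology (subtopology X A) (A \<inter> Z) = subtopology X (A \<inter> Z)"
    by (simp add: subtopology_subtopology)
  have "openin ?Z {x}" if "x \<in> topspace ?Z - A \<inter> Z" for x
    using iso[of x] that ZX openin_subtopology_Int2[of X "{x}" Z] by auto
  then obtain r where r: "isolated_complement ?Z (A \<inter> Z) r"
    using stratifiable_isolated_complement[OF sZ cAZ] by blast
  have "closedin (subtopology X A) (A \<inter> Z)"
    using AZ closedin_subset_topspace[of X "A \<inter> Z" A] by simp
  then have "Baire_space (Ck (subtopology (subtopology X A) (A \<inter> Z)))"
    using Baire_Ck_closed_subspace[OF stratifiable_normal stratifiable_Hausdorff _ B]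
      stratifiable_closed_subspace[OF X A] by blast
  then have BA: "Baire_space (Ck (subtopology ?Z (A \<inter> Z)))"
    by (simp only: eq eqA)
  obtain S where S: "countable S" "Ck_dense (subtopology X (A \<inter> Z)) S"
    using countable_dense_Ck[OF X Q AZ] by (auto simp: Z_def)
  show "Baire_space (Ck (subtopology X (X closure_of Q)))"
    unfolding Z_def[symmetric]
    by (rule isolated_complement.Baire_Ck_extend[OF r MOP_closed_subspace[OF M Z] BA S(1)])
      (use S(2) eq in simp)
qed

text \<open>In a T1 space singletons are closed, so being isolated amounts to openness of the
  singleton, and the isolated points form an open set.\<close>

lemma closedin_non_isolated: "t1_space X \<Longrightarrow> closedin X (non_isolated X)"
proof -
  assume t1: "t1_space X"
  have iso: "isolated_in_space X x \<longleftrightarrow> x \<in> topspace X \<and> openin X {x}" for x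
    using t1 by (auto simp: isolated_in_space_def t1_space_closedin_singleton)
  have "topspace X - non_isolated X = \<Union>{{x} | x. x \<in> topspace X \<and> openin X {x}}"
    by (auto simp: non_isolated_def iso)
  moreover have "openin X (\<Union>{{x} | x. x \<in> topspace X \<and> openin X {x}})"
    by (rule openin_Union) auto
  ultimately show ?thesis by (simp add: closedin_def non_isolated_def)
qed

lemma derived_space_stratifiable_Moving_Off:
  assumes "stratifiable X" "Moving_Off_Property X"
  shows "stratifiable (derived_space X n) \<and> Moving_Off_Property (derived_space X n)"
proof (induction n)
  case 0
  then show ?case using assms by simp
next
  case (Suc n)
  then have "closedin (derived_space X n) (non_isolated (derived_space X n))"
    by (simp add: closedin_non_isolated stratifiable_def)
  then show ?case using Suc by (simp add: stratifiable_closed_subspace MOP_closed_subspace)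
qed

text \<open>The induction descends: each derived space is a closed subset of the previous one with
  isolated complement, so the Baire property climbs back from stage \<open>Suc n\<close> to stage n,
  where the induction hypothesis takes over.\<close>

lemma Baire_Ck_derived_space:
  assumes X: "stratifiable X" "Moving_Off_Property X" and B: "Baire_space (Ck (derived_space X n))"
  shows "Baire_space (Ck X)"
  using B
proof (induction n)
  case 0
  then show ?case by simp
next
  case (Suc n)
  let ?Y = "derived_space X n"
  have Y: "stratifiable ?Y" "Moving_Off_Property ?Y"
    using derived_space_stratifiable_Moving_Off[OF X] by simp_all
  then have "closedin ?Y (non_isolated ?Y)" by (simp add: closedin_non_isolated stratifiable_def)
  moreover have "openin ?Y {x}" if "x \<in> topspace ?Y - non_isolated ?Y" for x
    using that by (auto simp: non_isolated_def isolated_in_space_def)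
  ultimately have "Baire_space (Ck ?Y)"
    using Baire_Ck_isolated_complement[OF Y, of "non_isolated ?Y"] Suc.prems by simp
  then show ?case by (rule Suc.IH)
qed

theorem corollary1p3:
  fixes X :: "'a topology"
  assumes "stratifiable X"
  shows "Baire_space (Ck X) \<longleftrightarrow>
    Moving_Off_Property X \<and> (\<exists>n :: nat. Baire_space (Ck (derived_space X n)))"
proof
  assume B: "Baire_space (Ck X)"
  have "Moving_Off_Property X"
    by (rule Baire_imp_Moving_Off[OF stratifiable_normal[OF assms] stratifiable_Hausdorff[OF assms] B])
  moreover have "Baire_space (Ck (derived_space X 0))" using B by simp
  ultimately show "Moving_Off_Property X \<and> (\<exists>n :: nat. Baire_space (Ck (derived_space X n)))" by blast
next
  assume "Moving_Off_Property X \<and> (\<exists>n :: nat. Baire_space (Ck (derived_space X n)))"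
  then show "Baire_space (Ck X)" using Baire_Ck_derived_space[OF assms] by blast
qed

end
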